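(* Fix $\delta>0$ and let $p\to0$. Let $K_0$ be the graph obtained from $K_{2,4}$ by adding one edge between two vertices on the side with four vertices. Then \[\inf_{\substack{W\ p\text{-regular}\\ \mathrm{Hom}(K_0,W)\geq (1+\delta)p^{9}}}I_p(W)=(1+o(1))(18\delta)^{\frac{1}{3}}p^3\left(\log\frac{1}{p}\right)^{\frac{2}{3}}\left(\log\log\frac{1}{p}\right)^{\frac{1}{3}}.\] Furthermore, if $n\to\infty$ and $p=p(n)$ satisfies $(n^{-1}\log n)^{\frac{1}{15}}\ll p\ll 1$, the upper bound is attained by a graphon $W=W(n)$ which is a block graphon on $O(1)$ blocks satisfying Conditions (1)–(10) below with $K=K_0$.
   Context: Graphon: symmetric measurable $W:[0,1]^2\to[0,1]$; $p$-regular: $\int_0^1W(x,y)dy=p$ for all $x$; $\mathrm{Hom}(K,W)=\int\prod_{uv\in E(K)}W(x_u,x_v)\prod_v dx_v$; $I_p(x)=x\log\frac xp+(1-x)\log\frac{1-x}{1-p}$ ($0\log0=0$), $I_p(W)=\int I_p(W(x,y))dxdy$. Block graphon on intervals $[0,1]=S_1\cup\dots\cup S_k$ with value $w_{ij}$ on $S_i\times S_j$; $m$ Lebesgue measure; $K$-block $B:V(K)\to[k]$, $\mathrm{Hom}_B(K,W)$ the integral restricted to $x_v\in S_{B(v)}$, negligible if $o(p^{e(K)})$. Conditions (asymptotics as $n\to\infty$, $\ll$ meaning $o$): (1) $W$ $p$-regular; (2) $m(S_k)\ge1-p$; (3) $\mathrm{Hom}(K,W)\ge(1+\Omega(1))p^{e(K)}$;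 (4) $n^{-1}\log n\ll I_p(W)\ll p^{2e(K)}n$; (5) $m(S_i)\gg n^{-1}$; (6) for $i,j\le k-1$, $w_{ij}\ge p$ and either $w_{ij}=p$ or $m(S_i)m(S_j)w_{ij}\ll(\log\log\log\frac1p)^{-1}I_p(W)$; $(i,j)$ important if $i,j\le k-1$ and the latter holds, else unimportant; important blocks somewhat important if $w_{ij}<1$, very important if $w_{ij}=1$; (7) for non-negligible $B$, edges sent to somewhat important blocks form a matching; (8) for non-negligible $B$ and unimportant $(i,j)=(B(u),B(v))$ for an edge $uv$: $m(S_i)m(S_j)\ge(1+o(1))p^{-1}I_p(W)$, $w_{ij}=p+o(p)$; (9) $w_{ij}m(S_i)\gg n^{-1}\log n$ for important $(i,j)$; (10) $\mathrm{Hom}(K,W+p)=O(p^{e(K)})$. *)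

theory Defs
  imports "HOL-Analysis.Analysis" "HOL-Library.Landau_Symbols"
begin

unbundle asymp_equiv_syntax

section \<open>Graphs\<close>

text \<open>Edges are two-element sets of vertices.\<close>

datatype graph = Graph (verts: "nat set") (edges: "nat set set")

abbreviation num_edges :: "graph \<Rightarrow> nat" where
  "num_edges K \<equiv> card (edges K)"

definition matching :: "nat set set \<Rightarrow> bool" where
  "matching M \<longleftrightarrow> pairwise disjnt M"

text \<open>The sides of the complete bipartite part are \<open>{0, 1}\<close> and \<open>{2, 3, 4, 5}\<close>;
  the additional edge is \<open>{2, 3}\<close>.\<close>

definition K0 :: graph where
  "K0 = Graph {0..5} ({{a, b} |a b. a \<in> {0, 1} \<and> b \<in> {2, 3, 4, 5}} \<union> {{2, 3}})"

lemma num_edges_K0: "num_edges K0 = 9"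
proof -
  have *: "{{a, b} |a b. a \<in> A \<and> b \<in> B} = (\<Union>a\<in>A. (\<lambda>b. {a, b}) ` B)" for A B :: "nat set"
    by blast
  show ?thesis
    unfolding K0_def graph.sel * by (simp add: doubleton_eq_iff card_insert_if)
qed


section \<open>Graphons\<close>

abbreviation unit_interval :: "real measure" where
  "unit_interval \<equiv> restrict_space lborel {0..1}"

text \<open>A graphon is a function on the plane of which only the values on the unit square matter.
  Measurability is Borel measurability.\<close>

definition graphon :: "(real \<Rightarrow> real \<Rightarrow> real) \<Rightarrow> bool" where
  "graphon W \<longleftrightarrow>
     (\<lambda>(x, y). W x y) \<in> borel_measurable (unit_interval \<Otimes>\<^sub>M unit_interval) \<and>
     (\<forall>x\<in>{0..1}. \<forall>y\<in>{0..1}. 0 \<le> W x y \<and> W x y \<le> 1 \<and> W x y = W y x)"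

definition regular_graphon :: "real \<Rightarrow> (real \<Rightarrow> real \<Rightarrow> real) \<Rightarrow> bool" where
  "regular_graphon p W \<longleftrightarrow> graphon W \<and> (\<forall>x\<in>{0..1}. (LINT y|unit_interval. W x y) = p)"

text \<open>The function below is only applied to symmetric \<open>W\<close>, so the choice of the order in which
  the endpoints \<open>Min e\<close> and \<open>Max e\<close> of an edge \<open>e\<close> are passed to \<open>W\<close> is immaterial.\<close>

definition edge_prod :: "graph \<Rightarrow> (real \<Rightarrow> real \<Rightarrow> real) \<Rightarrow> (nat \<Rightarrow> real) \<Rightarrow> real" where
  "edge_prod K W x = (\<Prod>e\<in>edges K. W (x (Min e)) (x (Max e)))"

definition Hom :: "graph \<Rightarrow> (real \<Rightarrow> real \<Rightarrow> real) \<Rightarrow> real" where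
  "Hom K W = (LINT x|(\<Pi>\<^sub>M v\<in>verts K. unit_interval). edge_prod K W x)"

text \<open>Since \<^term>\<open>ln 0 = (0::real)\<close>, the convention \<open>0 log 0 = 0\<close> is respected.\<close>

definition rel_entropy :: "real \<Rightarrow> real \<Rightarrow> real" where
  "rel_entropy p x = x * ln (x / p) + (1 - x) * ln ((1 - x) / (1 - p))"

definition graphon_entropy :: "real \<Rightarrow> (real \<Rightarrow> real \<Rightarrow> real) \<Rightarrow> real" where
  "graphon_entropy p W = (LINT (x, y)|(unit_interval \<Otimes>\<^sub>M unit_interval). rel_entropy p (W x y))"


section \<open>Block graphons\<close>

definition block_graphon ::
    "nat \<Rightarrow> (nat \<Rightarrow> real set) \<Rightarrow> (nat \<Rightarrow> nat \<Rightarrow> real) \<Rightarrow> (real \<Rightarrow> real \<Rightarrow> real) \<Rightarrow> bool" where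
  "block_graphon k S w W \<longleftrightarrow>
     graphon W \<and> k \<ge> 1 \<and>
     (\<forall>i\<in>{1..k}. is_interval (S i)) \<and> disjoint_family_on S {1..k} \<and>
     (\<Union>i\<in>{1..k}. S i) = {0..1} \<and>
     (\<forall>i\<in>{1..k}. \<forall>j\<in>{1..k}. \<forall>x\<in>S i. \<forall>y\<in>S j. W x y = w i j)"

definition Hom_block ::
    "graph \<Rightarrow> (nat \<Rightarrow> real set) \<Rightarrow> (nat \<Rightarrow> nat) \<Rightarrow> (real \<Rightarrow> real \<Rightarrow> real) \<Rightarrow> real" where
  "Hom_block K S B W =
     (LINT x:(\<Pi>\<^sub>E v\<in>verts K. S (B v))|(\<Pi>\<^sub>M v\<in>verts K. unit_interval). edge_prod K W x)"

text \<open>In the following, \<open>p n\<close>, \<open>S n i\<close>, \<open>w n i j\<close> and \<open>W n\<close> depend on \<open>n\<close>, whereas the number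
  \<open>k\<close> of blocks does not. Hence a pair of block indices, or a map \<open>B\<close> from the vertices to the
  block indices, determines a sequence indexed by \<open>n\<close>, and being negligible or important is a
  property of this sequence. The relation \<open>f \<lless> g\<close> is rendered as \<open>f \<in> o(g)\<close>, and relations
  between quantities depending on \<open>n\<close> are required for all sufficiently large \<open>n\<close>.\<close>

context
  fixes K :: graph
    and p :: "nat \<Rightarrow> real"
    and k :: nat
    and S :: "nat \<Rightarrow> nat \<Rightarrow> real set"
    and w :: "nat \<Rightarrow> nat \<Rightarrow> nat \<Rightarrow> real"
    and W :: "nat \<Rightarrow> real \<Rightarrow> real \<Rightarrow> real"
begin

abbreviation (input) "m n i \<equiv> measure lborel (S n i)"
abbreviation (input) "Ip n \<equiv> graphon_entropy (p n) (W n)"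

definition K_blocks :: "(nat \<Rightarrow> nat) set" where
  "K_blocks = verts K \<rightarrow> {1..k}"

definition negligible_block :: "(nat \<Rightarrow> nat) \<Rightarrow> bool" where
  "negligible_block B \<longleftrightarrow> (\<lambda>n. Hom_block K (S n) B (W n)) \<in> o(\<lambda>n. p n ^ num_edges K)"

definition small_block :: "nat \<Rightarrow> nat \<Rightarrow> bool" where
  "small_block i j \<longleftrightarrow>
     (\<lambda>n. m n i * m n j * w n i j) \<in> o(\<lambda>n. inverse (ln (ln (ln (1 / p n)))) * Ip n)"

definition important :: "nat \<Rightarrow> nat \<Rightarrow> bool" where
  "important i j \<longleftrightarrow> i \<in> {1..k-1} \<and> j \<in> {1..k-1} \<and> small_block i j"

definition very_important :: "nat \<Rightarrow> nat \<Rightarrow> bool" where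
  "very_important i j \<longleftrightarrow> important i j \<and> (\<forall>\<^sub>F n in sequentially. w n i j = 1)"

text \<open>The value of an important block should be below 1 for all large \<open>n\<close> or equal to 1 for all
  large \<open>n\<close>. Asking only for values below 1 infinitely often ensures that every important block is
  somewhat or very important, so that an oscillating value does not escape from condition 7.\<close>

definition somewhat_important :: "nat \<Rightarrow> nat \<Rightarrow> bool" where
  "somewhat_important i j \<longleftrightarrow> important i j \<and> (\<exists>\<^sub>F n in sequentially. w n i j < 1)"

definition condition1 :: bool where
  "condition1 \<longleftrightarrow> (\<forall>\<^sub>F n in sequentially. regular_graphon (p n) (W n))"

definition condition2 :: bool where
  "condition2 \<longleftrightarrow> (\<forall>\<^sub>F n in sequentially. m n k \<ge> 1 - p n)"

definition condition3 :: bool where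
  "condition3 \<longleftrightarrow>
     (\<exists>c>0. \<forall>\<^sub>F n in sequentially. Hom K (W n) \<ge> (1 + c) * p n ^ num_edges K)"

definition condition4 :: bool where
  "condition4 \<longleftrightarrow>
     (\<lambda>n. ln (real n) / real n) \<in> o(\<lambda>n. Ip n) \<and>
     (\<lambda>n. Ip n) \<in> o(\<lambda>n. p n ^ (2 * num_edges K) * real n)"

definition condition5 :: bool where
  "condition5 \<longleftrightarrow> (\<forall>i\<in>{1..k}. (\<lambda>n. 1 / real n) \<in> o(\<lambda>n. m n i))"

definition condition6 :: bool where
  "condition6 \<longleftrightarrow>
     (\<forall>i\<in>{1..k-1}. \<forall>j\<in>{1..k-1}.
        (\<forall>\<^sub>F n in sequentially. w n i j \<ge> p n) \<and>
        ((\<forall>\<^sub>F n in sequentially. w n i j = p n) \<or> small_block i j))"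

definition condition7 :: bool where
  "condition7 \<longleftrightarrow>
     (\<forall>B\<in>K_blocks. \<not> negligible_block B \<longrightarrow>
        matching {{u, v} |u v. {u, v} \<in> edges K \<and> somewhat_important (B u) (B v)})"

definition condition8 :: bool where
  "condition8 \<longleftrightarrow>
     (\<forall>B\<in>K_blocks. \<not> negligible_block B \<longrightarrow>
        (\<forall>u v. {u, v} \<in> edges K \<and> \<not> important (B u) (B v) \<longrightarrow>
           (\<exists>\<epsilon>. \<epsilon> \<longlonglongrightarrow> 0 \<and>
              (\<forall>\<^sub>F n in sequentially. m n (B u) * m n (B v) \<ge> (1 + \<epsilon> n) * (inverse (p n) * Ip n))) \<and>
           (\<lambda>n. w n (B u) (B v) - p n) \<in> o(p)))"

definition condition9 :: bool where
  "condition9 \<longleftrightarrow>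
     (\<forall>i j. important i j \<longrightarrow> (\<lambda>n. ln (real n) / real n) \<in> o(\<lambda>n. w n i j * m n i))"

definition condition10 :: bool where
  "condition10 \<longleftrightarrow> (\<lambda>n. Hom K (\<lambda>x y. W n x y + p n)) \<in> O(\<lambda>n. p n ^ num_edges K)"

definition block_conditions :: bool where
  "block_conditions \<longleftrightarrow>
     condition1 \<and> condition2 \<and> condition3 \<and> condition4 \<and> condition5 \<and>
     condition6 \<and> condition7 \<and> condition8 \<and> condition9 \<and> condition10"

end

definition upper_tail_rate :: "real \<Rightarrow> real \<Rightarrow> real" where
  "upper_tail_rate \<delta> p =
     (18 * \<delta>) powr (1/3) * p ^ 3 * ln (1 / p) powr (2/3) * ln (ln (1 / p)) powr (1/3)"

end

theory Submission
  imports Defs "HOL-Probability.Infinite_Product_Measure" "HOL-Real_Asymp.Real_Asymp"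
begin

text \<open>
  Write \<open>L = ln (1 / p)\<close>, \<open>l = ln L\<close> and \<open>U = W - p\<close>. For the upper bound, a set of measure about
  \<open>p\<^sup>2 sqrt (\<delta> / r)\<close> is completely joined to a set of measure about \<open>p\<close>, inside which the density is
  \<open>p r\<close>. This adds \<open>\<delta> p ^ 9\<close> to the homomorphism density, at the cost \<open>p ^ 3 (2 sqrt (\<delta> / r) L + r ln r)\<close>; the
  optimal \<open>r\<close> is of order \<open>(L / l) powr (2/3)\<close>, so that \<open>ln r\<close> is about \<open>2 / 3 * l\<close>.

  For the lower bound, an entropy of at most the claimed order forces \<open>\<integral>U\<^sup>2 = o(p ^ 3)\<close>. Together with
  regularity, which bounds all codegrees of \<open>\<bar>U\<bar>\<close> by \<open>2 p\<close>, this makes all terms negligible in the expansion of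
  the homomorphism density in \<open>U\<close> except the constant one and that of the full graph. In the latter,
  the edge \<open>{2, 3}\<close> only matters for values of \<open>U\<close> between \<open>p L powr (2/3) / l\<close> and \<open>1 / l\<close>, with integral
  \<open>Y\<close> say, and the other edges only for values above \<open>1 / l\<close>, with square integral \<open>H\<close> say. The vertices
  \<open>0\<close> and \<open>1\<close> have to be vertices of large degree, which are so few that almost no part of \<open>H\<close> lies between
  two of them. Hence the contribution is at most \<open>(H / 2)\<^sup>2 Y\<close>, whereas the entropy is at least
  \<open>L H + 2 / 3 * l Y\<close>. The arithmetic-geometric mean inequality concludes.
\<close>

section \<open>Integrals of bounded kernels\<close>

text \<open>The constant 18 comes from one optimisation. Put A = L H and B = (2/3) l Y. The
  constraint (H / 2)^2 Y \<ge> \<delta> p^9 says A^2 B \<ge> (8/3) \<delta> p^9 L^2 l, and the least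
  value of A + B occurs at A = 2 B, where (A + B)^3 = (27/4) A^2 B = 18 \<delta> p^9 L^2 l. So two
  thirds of the entropy pay for the edges at the few vertices of large degree and one third for the
  edge {2, 3}, and the construction divides it in the same way. The obstacle is the intermediate
  scale of the edge {2, 3}: its density exceeds p only by a power of L, so a unit of its mass costs
  ln r instead of L, and already an error of order l in this price would spoil the constant. The
  lower cutoff p K with K = \<open>L powr (2/3) / l\<close> has to satisfy ln K = (1 + o(1)) ln r,
  and values below it must still be negligible; K lies below the optimal r by a factor of order
  l^(1/3) only, and the values below p K then contribute O(p^9 l^(-1/3)). The exponent 15 is 2 * 9 -
  3: condition 4 asks for an entropy far below p^18 n, and the entropy is p^3 up to logarithmic
  factors.\<close>

definition bounded_measurable :: "'a measure \<Rightarrow> ('a \<Rightarrow> real) \<Rightarrow> bool" where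
  "bounded_measurable N f \<longleftrightarrow> f \<in> borel_measurable N \<and> (\<exists>B. \<forall>x. \<bar>f x\<bar> \<le> B)"

abbreviation kernel :: "'a measure \<Rightarrow> ('a \<Rightarrow> 'a \<Rightarrow> real) \<Rightarrow> bool" where
  "kernel M f \<equiv> bounded_measurable (M \<Otimes>\<^sub>M M) (\<lambda>z. f (fst z) (snd z))"

lemma bounded_measurableI:
  "f \<in> borel_measurable N \<Longrightarrow> (\<And>x. \<bar>f x\<bar> \<le> B) \<Longrightarrow> bounded_measurable N f"
  by (auto simp: bounded_measurable_def)

lemma bounded_measurable_const: "bounded_measurable N (\<lambda>x. c)"
  by (auto simp: bounded_measurable_def)

lemma bounded_measurable_add:
  assumes "bounded_measurable N f" "bounded_measurable N g"
  shows "bounded_measurable N (\<lambda>x. f x + g x)"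
proof -
  from assms obtain A B where "\<And>x. \<bar>f x\<bar> \<le> A" "\<And>x. \<bar>g x\<bar> \<le> B"
    unfolding bounded_measurable_def by blast
  then have "\<bar>f x + g x\<bar> \<le> A + B" for x
    by (meson abs_triangle_ineq add_mono order_trans)
  with assms show ?thesis
    unfolding bounded_measurable_def by (blast intro: borel_measurable_add)
qed

lemma bounded_measurable_mult:
  assumes "bounded_measurable N f" "bounded_measurable N g"
  shows "bounded_measurable N (\<lambda>x. f x * g x)"
proof -
  from assms obtain A B where "\<And>x. \<bar>f x\<bar> \<le> A" "\<And>x. \<bar>g x\<bar> \<le> B"
    unfolding bounded_measurable_def by blast
  then have "\<bar>f x * g x\<bar> \<le> A * B" for x
    unfolding abs_mult by (intro mult_mono) (auto intro: order_trans[OF abs_ge_zero])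
  with assms show ?thesis
    unfolding bounded_measurable_def by (blast intro: borel_measurable_times)
qed

lemma bounded_measurable_power:
  "bounded_measurable N f \<Longrightarrow> bounded_measurable N (\<lambda>x. f x ^ n)"
  by (induction n) (auto intro: bounded_measurable_const bounded_measurable_mult)

lemma bounded_measurable_uminus:
  "bounded_measurable N f \<Longrightarrow> bounded_measurable N (\<lambda>x. - f x)"
  using bounded_measurable_mult[OF bounded_measurable_const[of N "-1"]] by simp

lemma bounded_measurable_diff:
  "bounded_measurable N f \<Longrightarrow> bounded_measurable N g \<Longrightarrow> bounded_measurable N (\<lambda>x. f x - g x)"
  using bounded_measurable_add[OF _ bounded_measurable_uminus] by fastforce

lemma bounded_measurable_divide_const:
  "bounded_measurable N f \<Longrightarrow> bounded_measurable N (\<lambda>x. f x / c)"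
  unfolding divide_inverse by (intro bounded_measurable_mult bounded_measurable_const)

lemma bounded_measurable_abs:
  "bounded_measurable N f \<Longrightarrow> bounded_measurable N (\<lambda>x. \<bar>f x\<bar>)"
  by (auto simp: bounded_measurable_def)

lemma bounded_measurable_compose:
  "bounded_measurable M f \<Longrightarrow> g \<in> N \<rightarrow>\<^sub>M M \<Longrightarrow> bounded_measurable N (\<lambda>x. f (g x))"
  by (auto simp: bounded_measurable_def)

text \<open>The arguments of a kernel may be any measurable functions of the variables at hand.
  Together with the closure rules, this reduces the integrability of every nested integral below to
  introduction rules.\<close>

lemma kernel_compose:
  "kernel M f \<Longrightarrow> g \<in> N \<rightarrow>\<^sub>M M \<Longrightarrow> h \<in> N \<rightarrow>\<^sub>M M \<Longrightarrow> bounded_measurable N (\<lambda>x. f (g x) (h x))"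
  using bounded_measurable_compose[of "M \<Otimes>\<^sub>M M" "\<lambda>z. f (fst z) (snd z)" "\<lambda>x. (g x, h x)" N] by simp

locale full_prob_space = prob_space M for M :: "'a measure" +
  assumes space_UNIV: "space M = UNIV"
begin

sublocale MM: pair_sigma_finite M M ..

lemma const_measurable [measurable]: "(\<lambda>z. x) \<in> N \<rightarrow>\<^sub>M M"
  by (simp add: space_UNIV)

lemma bounded_measurable_integrable: "bounded_measurable M f \<Longrightarrow> integrable M f"
  unfolding bounded_measurable_def
  by (metis AE_I2 integrable_const_bound real_norm_def)

lemma abs_integral_le:
  fixes f :: "'a \<Rightarrow> real"
  assumes "\<And>x. \<bar>f x\<bar> \<le> B" shows "\<bar>integral\<^sup>L M f\<bar> \<le> B"
proof (cases "integrable M f")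
  case True
  then have "\<bar>integral\<^sup>L M f\<bar> \<le> (\<integral>x. \<bar>f x\<bar> \<partial>M)"
    using integral_norm_bound[of M f] by simp
  also have "\<dots> \<le> (\<integral>x. B \<partial>M)"
    using True assms by (intro integral_mono) auto
  finally show ?thesis by (simp add: prob_space)
next
  case False
  then show ?thesis
    using assms[of undefined] by (simp add: not_integrable_integral_eq)
qed

lemma bounded_measurable_integral:
  assumes "bounded_measurable (N \<Otimes>\<^sub>M M) (\<lambda>z. f (fst z) (snd z))"
  shows "bounded_measurable N (\<lambda>x. \<integral>y. f x y \<partial>M)"
proof -
  from assms obtain B where B: "\<And>z. \<bar>f (fst z) (snd z)\<bar> \<le> B"
    and m: "(\<lambda>z. f (fst z) (snd z)) \<in> borel_measurable (N \<Otimes>\<^sub>M M)"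
    by (auto simp: bounded_measurable_def)
  show ?thesis
  proof (rule bounded_measurableI)
    show "(\<lambda>x. \<integral>y. f x y \<partial>M) \<in> borel_measurable N"
      by (rule borel_measurable_lebesgue_integral) (use m in \<open>simp add: case_prod_beta\<close>)
    show "\<bar>\<integral>y. f x y \<partial>M\<bar> \<le> B" for x
      using B[of "(x, _)"] by (intro abs_integral_le) simp
  qed
qed

lemma integral_swap:
  assumes "kernel M f"
  shows "(\<integral>x. \<integral>y. f x y \<partial>M \<partial>M) = (\<integral>y. \<integral>x. f x y \<partial>M \<partial>M)"
proof -
  interpret P: finite_measure "M \<Otimes>\<^sub>M M"
    by (rule finite_measure_pair_measure) unfold_locales
  have "integrable (M \<Otimes>\<^sub>M M) (case_prod f)"
    using assms unfolding bounded_measurable_def case_prod_beta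
    by (metis (mono_tags, lifting) AE_I2 P.integrable_const_bound real_norm_def)
  then show ?thesis
    by (rule MM.Fubini_integral[symmetric])
qed

lemmas bounded_measurable_intros = bounded_measurable_const bounded_measurable_add bounded_measurable_mult
  bounded_measurable_power bounded_measurable_uminus bounded_measurable_diff bounded_measurable_abs
  bounded_measurable_divide_const bounded_measurable_integral bounded_measurable_integrable
  measurable_fst'' measurable_snd'' measurable_ident_sets[OF refl] const_measurable

lemma integral_le_integral:
  "bounded_measurable M f \<Longrightarrow> bounded_measurable M g \<Longrightarrow> (\<And>x. f x \<le> g x) \<Longrightarrow> integral\<^sup>L M f \<le> integral\<^sup>L M g"
  by (intro integral_mono bounded_measurable_integrable)

lemma integral_const [simp]: "(\<integral>x. c \<partial>M) = (c::real)"
  by (simp add: prob_space)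

lemma integral_plus:
  "bounded_measurable M f \<Longrightarrow> bounded_measurable M g \<Longrightarrow> (\<integral>x. f x + g x \<partial>M) = integral\<^sup>L M f + integral\<^sup>L M g"
  by (intro Bochner_Integration.integral_add bounded_measurable_integrable)

lemma integral2_mono:
  assumes "kernel M f" "kernel M g" "\<And>x y. f x y \<le> g x y"
  shows "(\<integral>x. \<integral>y. f x y \<partial>M \<partial>M) \<le> (\<integral>x. \<integral>y. g x y \<partial>M \<partial>M)"
  by (intro integral_le_integral bounded_measurable_intros kernel_compose[OF assms(1)] kernel_compose[OF assms(2)] assms(3))

lemma integral2_plus:
  assumes "kernel M f" "kernel M g"
  shows "(\<integral>x. \<integral>y. f x y + g x y \<partial>M \<partial>M) = (\<integral>x. \<integral>y. f x y \<partial>M \<partial>M) + (\<integral>x. \<integral>y. g x y \<partial>M \<partial>M)"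
proof -
  note * = kernel_compose[OF assms(1)] kernel_compose[OF assms(2)]
  have "(\<integral>x. \<integral>y. f x y + g x y \<partial>M \<partial>M) = (\<integral>x. (\<integral>y. f x y \<partial>M) + (\<integral>y. g x y \<partial>M) \<partial>M)"
    by (intro Bochner_Integration.integral_cong refl integral_plus bounded_measurable_intros *)
  also have "\<dots> = (\<integral>x. \<integral>y. f x y \<partial>M \<partial>M) + (\<integral>x. \<integral>y. g x y \<partial>M \<partial>M)"
    by (intro integral_plus bounded_measurable_intros *)
  finally show ?thesis .
qed

text \<open>The integral of (u f + v g)^2 is a nonnegative quadratic form in u and v. The choice u =
  C, v = - B turns it into C (A C - B^2), which settles the case C > 0.\<close>

lemma Cauchy_Schwarz:
  assumes [intro]: "bounded_measurable M f" "bounded_measurable M g"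
  shows "(\<integral>x. f x * g x \<partial>M)\<^sup>2 \<le> (\<integral>x. (f x)\<^sup>2 \<partial>M) * (\<integral>x. (g x)\<^sup>2 \<partial>M)"
proof -
  define A B C where "A = (\<integral>x. (f x)\<^sup>2 \<partial>M)" and "B = (\<integral>x. f x * g x \<partial>M)" and "C = (\<integral>x. (g x)\<^sup>2 \<partial>M)"
  have nonneg: "0 \<le> u\<^sup>2 * A + 2 * u * v * B + v\<^sup>2 * C" for u v
  proof -
    have "0 \<le> (\<integral>x. (u * f x + v * g x)\<^sup>2 \<partial>M)"
      by simp
    also have "\<dots> = (\<integral>x. u\<^sup>2 * (f x)\<^sup>2 + (2 * u * v * (f x * g x) + v\<^sup>2 * (g x)\<^sup>2) \<partial>M)"
      by (intro Bochner_Integration.integral_cong) (auto simp: power2_eq_square algebra_simps)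
    also have "\<dots> = u\<^sup>2 * A + (2 * u * v * B + v\<^sup>2 * C)"
      unfolding A_def B_def C_def
      by (subst integral_plus integral_plus, (intro bounded_measurable_intros assms)+)+ simp
    finally show ?thesis by simp
  qed
  have "A \<ge> 0" "C \<ge> 0" by (simp_all add: A_def C_def)
  have "B\<^sup>2 \<le> A * C"
  proof (cases "C = 0")
    case True
    have "B = 0"
    proof (rule ccontr)
      assume "B \<noteq> 0"
      \<comment> \<open>With C = 0 the form is u^2 A + 2 u v B, which for this u and v equals A - 2
        (A + 1) < 0.\<close>
      have "0 \<le> 1\<^sup>2 * A + 2 * 1 * (- (A + 1) / B) * B + (- (A + 1) / B)\<^sup>2 * C"
        by (rule nonneg)
      with True \<open>B \<noteq> 0\<close> \<open>A \<ge> 0\<close> show False by simp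
    qed
    with True show ?thesis by simp
  next
    case False
    with \<open>C \<ge> 0\<close> have "C > 0" by simp
    have "0 \<le> C\<^sup>2 * A + 2 * C * (- B) * B + (- B)\<^sup>2 * C"
      by (rule nonneg)
    also have "\<dots> = C * (A * C - B\<^sup>2)"
      by (simp add: power2_eq_square algebra_simps)
    finally show ?thesis
      using \<open>C > 0\<close> by (simp add: zero_le_mult_iff)
  qed
  then show ?thesis by (simp add: A_def B_def C_def)
qed

end

section \<open>Codegrees, kites and the contribution of the full graph\<close>

context full_prob_space
begin

text \<open>The weight of a common neighbour of \<open>x\<close> and \<open>y\<close>. In
  \<open>K0\<close>, each of the vertices 4 and 5 contributes such a factor for the images of 0 and
  1.\<close>

definition codeg :: "('a \<Rightarrow> 'a \<Rightarrow> real) \<Rightarrow> 'a \<Rightarrow> 'a \<Rightarrow> real" where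
  "codeg f x y = (\<integral>z. f x z * f y z \<partial>M)"

definition sqdeg :: "('a \<Rightarrow> 'a \<Rightarrow> real) \<Rightarrow> 'a \<Rightarrow> real" where
  "sqdeg f x = (\<integral>y. (f x y)\<^sup>2 \<partial>M)"

definition sqnorm :: "('a \<Rightarrow> 'a \<Rightarrow> real) \<Rightarrow> real" where
  "sqnorm f = (\<integral>x. sqdeg f x \<partial>M)"

text \<open>This is \<open>K0\<close> without the vertices 4 and 5, where 0 and 1 are sent to
  \<open>x\<close> and \<open>y\<close>, and 2 and 3 to \<open>a\<close> and \<open>b\<close>. The
  edge {2, 3} carries a weight \<open>V\<close> of its own, because only its values are cut by size
  while the other four edges keep the weight \<open>f\<close>.\<close>

definition kite :: "('a \<Rightarrow> 'a \<Rightarrow> real) \<Rightarrow> ('a \<Rightarrow> 'a \<Rightarrow> real) \<Rightarrow> 'a \<Rightarrow> 'a \<Rightarrow> real" where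
  "kite f V x y = (\<integral>a. \<integral>b. (f x a * f y a) * (f x b * f y b) * V a b \<partial>M \<partial>M)"

lemma bounded_measurable_codeg:
  assumes "kernel M f" "g \<in> N \<rightarrow>\<^sub>M M" "h \<in> N \<rightarrow>\<^sub>M M"
  shows "bounded_measurable N (\<lambda>z. codeg f (g z) (h z))"
  unfolding codeg_def
  by (intro bounded_measurable_intros kernel_compose[OF assms(1)] measurable_compose[OF _ assms(2)] measurable_compose[OF _ assms(3)])

lemma bounded_measurable_kite:
  assumes "kernel M f" "kernel M V" "g \<in> N \<rightarrow>\<^sub>M M" "h \<in> N \<rightarrow>\<^sub>M M"
  shows "bounded_measurable N (\<lambda>z. kite f V (g z) (h z))"
  unfolding kite_def
  by (intro bounded_measurable_intros kernel_compose[OF assms(1)] kernel_compose[OF assms(2)]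
      measurable_compose[OF _ assms(3)] measurable_compose[OF _ assms(4)])

lemma bounded_measurable_sqdeg:
  assumes "kernel M f" "g \<in> N \<rightarrow>\<^sub>M M"
  shows "bounded_measurable N (\<lambda>z. sqdeg f (g z))"
  unfolding sqdeg_def
  by (intro bounded_measurable_intros kernel_compose[OF assms(1)] measurable_compose[OF _ assms(2)])

lemmas kernel_intros = bounded_measurable_intros bounded_measurable_codeg bounded_measurable_kite bounded_measurable_sqdeg

lemma codeg_commute: "codeg f x y = codeg f y x"
  by (simp add: codeg_def mult.commute)

lemma codeg_nonneg: "(\<And>x y. 0 \<le> f x y) \<Longrightarrow> 0 \<le> codeg f x y"
  by (simp add: codeg_def)

lemma sqdeg_nonneg: "0 \<le> sqdeg f x"
  by (simp add: sqdeg_def)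

lemma sqnorm_nonneg: "0 \<le> sqnorm f"
  by (simp add: sqnorm_def sqdeg_nonneg)

lemma codeg_le_deg:
  assumes "kernel M f" "\<And>x y. 0 \<le> f x y" "\<And>x y. f x y \<le> 1"
  shows "codeg f x y \<le> (\<integral>z. f x z \<partial>M)"
  unfolding codeg_def
  by (intro integral_le_integral bounded_measurable_intros kernel_compose[OF assms(1)] mult_left_le assms)

lemma codeg_power2_le:
  assumes "kernel M f"
  shows "(codeg f x y)\<^sup>2 \<le> sqdeg f x * sqdeg f y"
  unfolding codeg_def sqdeg_def
  by (intro Cauchy_Schwarz bounded_measurable_intros kernel_compose[OF assms])

text \<open>Uses the inequality 2 s t \<le> s^2 + t^2 inside the codegree. It serves the terms of
  the expansion that contain a single codegree, where Cauchy-Schwarz would only give a bound on the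
  square.\<close>

lemma integral2_codeg_le:
  assumes "kernel M f"
  shows "(\<integral>x. \<integral>y. codeg f x y \<partial>M \<partial>M) \<le> sqnorm f"
proof -
  note bm = kernel_intros kernel_compose[OF assms]
  have "codeg f x y \<le> (sqdeg f x + sqdeg f y) / 2" for x y
  proof -
    have "codeg f x y \<le> (\<integral>z. (f x z)\<^sup>2 / 2 + (f y z)\<^sup>2 / 2 \<partial>M)"
      unfolding codeg_def
    proof (intro integral_le_integral bm)
      fix z show "f x z * f y z \<le> (f x z)\<^sup>2 / 2 + (f y z)\<^sup>2 / 2"
        using sum_squares_bound[of "f x z" "f y z"] by simp
    qed
    also have "\<dots> = (sqdeg f x + sqdeg f y) / 2"
      unfolding sqdeg_def by (subst integral_plus, (intro bm)+) (simp add: add_divide_distrib)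
    finally show ?thesis .
  qed
  then have "(\<integral>x. \<integral>y. codeg f x y \<partial>M \<partial>M) \<le> (\<integral>x. \<integral>y. (sqdeg f x + sqdeg f y) / 2 \<partial>M \<partial>M)"
    by (intro integral2_mono) (intro bm assms)+
  also have "\<dots> = (\<integral>x. \<integral>y. sqdeg f x + sqdeg f y \<partial>M \<partial>M) / 2"
    by simp
  also have "\<dots> = sqnorm f"
    by (subst integral2_plus, (intro bm assms)+) (simp add: sqnorm_def prob_space)
  finally show ?thesis .
qed

text \<open>The left-hand side is the density of the 4-cycle in \<open>f\<close>. Cauchy-Schwarz for
  each codegree makes the double integral factorise.\<close>

lemma integral2_codeg_power2_le:
  assumes "kernel M f"
  shows "(\<integral>x. \<integral>y. (codeg f x y)\<^sup>2 \<partial>M \<partial>M) \<le> (sqnorm f)\<^sup>2"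
proof -
  note bm = kernel_intros assms
  have "(\<integral>x. \<integral>y. (codeg f x y)\<^sup>2 \<partial>M \<partial>M) \<le> (\<integral>x. \<integral>y. sqdeg f x * sqdeg f y \<partial>M \<partial>M)"
    by (intro integral2_mono) (intro bm codeg_power2_le)+
  also have "\<dots> = (sqnorm f)\<^sup>2"
    by (simp add: sqnorm_def power2_eq_square)
  finally show ?thesis .
qed

lemma kite_nonneg: "(\<And>x y. 0 \<le> f x y) \<Longrightarrow> (\<And>x y. 0 \<le> V x y) \<Longrightarrow> 0 \<le> kite f V x y"
  by (simp add: kite_def)

text \<open>Forgets the edge between \<open>a\<close> and \<open>b\<close>; the rest is a square of
  a codegree. The lemma \<open>kite_le_integral\<close> does the opposite and forgets the other four
  edges. Which one is efficient depends on whether the values of \<open>V\<close> or their integral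
  are small.\<close>

lemma kite_le:
  assumes "kernel M f" "kernel M V" "\<And>x y. 0 \<le> f x y" "\<And>x y. V x y \<le> B"
  shows "kite f V x y \<le> B * (codeg f x y)\<^sup>2"
proof -
  note bm = bounded_measurable_intros kernel_compose[OF assms(1)] kernel_compose[OF assms(2)]
  have "kite f V x y \<le> (\<integral>a. \<integral>b. (f x a * f y a) * (f x b * f y b) * B \<partial>M \<partial>M)"
    unfolding kite_def by (intro integral2_mono bm) (intro mult_left_mono assms mult_nonneg_nonneg)
  also have "\<dots> = B * (codeg f x y)\<^sup>2"
    by (simp add: codeg_def power2_eq_square)
  finally show ?thesis .
qed

lemma kite_le_integral:
  assumes "kernel M f" "kernel M V" "\<And>x y. 0 \<le> f x y" "\<And>x y. f x y \<le> 1" "\<And>x y. 0 \<le> V x y"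
  shows "kite f V x y \<le> (\<integral>a. \<integral>b. V a b \<partial>M \<partial>M)"
proof -
  note bm = bounded_measurable_intros kernel_compose[OF assms(1)] kernel_compose[OF assms(2)]
  have "(f x a * f y a) * (f x b * f y b) * V a b \<le> V a b" for a b
    using assms by (intro mult_left_le_one_le mult_nonneg_nonneg mult_le_one) auto
  then show ?thesis
    unfolding kite_def by (intro integral2_mono bm)
qed

lemma kite_mono:
  assumes "kernel M f" "kernel M V" "kernel M V'" "\<And>x y. 0 \<le> f x y" "\<And>x y. V x y \<le> V' x y"
  shows "kite f V x y \<le> kite f V' x y"
  unfolding kite_def
  by (intro integral2_mono bounded_measurable_intros kernel_compose[OF assms(1)] kernel_compose[OF assms(2)]
      kernel_compose[OF assms(3)]) (intro mult_left_mono assms mult_nonneg_nonneg)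

lemma kite_add:
  assumes "kernel M f" "kernel M V" "kernel M V'"
  shows "kite f (\<lambda>x y. V x y + V' x y) x y = kite f V x y + kite f V' x y"
  unfolding kite_def distrib_left
  by (intro integral2_plus bounded_measurable_intros kernel_compose[OF assms(1)] kernel_compose[OF assms(2)]
      kernel_compose[OF assms(3)])

text \<open>Below, \<open>V1\<close> carries the large values of \<open>f\<close> and \<open>V2\<close> the intermediate ones.\<close>

lemma integral2_codeg_kite_split:
  assumes "kernel M f" "kernel M V1" "kernel M V2"
    and f: "\<And>x y. 0 \<le> f x y" "\<And>x y. f x y \<le> 1"
    and D: "\<And>x. (\<integral>y. f x y \<partial>M) \<le> D"
    and "\<theta> \<ge> 0" and V: "\<And>x y. 0 \<le> V1 x y" "\<And>x y. 0 \<le> V2 x y"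
    and le: "\<And>x y. f x y \<le> \<theta> + V1 x y + V2 x y"
  shows "(\<integral>x. \<integral>y. (codeg f x y)\<^sup>2 * kite f f x y \<partial>M \<partial>M) \<le>
    \<theta> * D\<^sup>2 * (sqnorm f)\<^sup>2 + (\<integral>x. \<integral>y. V1 x y \<partial>M \<partial>M) * (sqnorm f)\<^sup>2
      + (\<integral>x. \<integral>y. (codeg f x y)\<^sup>2 * kite f V2 x y \<partial>M \<partial>M)"
proof -
  note bm = kernel_intros kernel_compose[OF assms(1)] kernel_compose[OF assms(2)] kernel_compose[OF assms(3)] assms(1-3)
  define Y where "Y = (\<integral>x. \<integral>y. V1 x y \<partial>M \<partial>M)"
  have "Y \<ge> 0" unfolding Y_def using V by simp
  have pt: "(codeg f x y)\<^sup>2 * kite f f x y \<le> (\<theta> * D\<^sup>2 + Y) * (codeg f x y)\<^sup>2 + (codeg f x y)\<^sup>2 * kite f V2 x y" for x y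
  proof -
    have "kite f f x y \<le> kite f (\<lambda>x y. (\<theta> + V1 x y) + V2 x y) x y"
      by (intro kite_mono) (intro bm f le)+
    also have "\<dots> = kite f (\<lambda>x y. \<theta>) x y + kite f V1 x y + kite f V2 x y"
      by (subst kite_add kite_add, (intro bm)+)+ simp
    \<comment> \<open>Values up to \<theta> are handled by forgetting the edge between
      \<open>a\<close> and \<open>b\<close>, and the codegree is at most a degree. For
      \<open>V1\<close>, the other four edges are forgotten. Only \<open>V2\<close> keeps its
      kite.\<close>
    also have "kite f (\<lambda>x y. \<theta>) x y \<le> \<theta> * (codeg f x y)\<^sup>2"
      by (intro kite_le) (intro bm f order_refl)+
    also have "\<theta> * (codeg f x y)\<^sup>2 \<le> \<theta> * D\<^sup>2"
      using codeg_le_deg[of f x y] D[of x] codeg_nonneg[of f x y] f \<open>\<theta> \<ge> 0\<close> assms(1)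
      by (intro mult_left_mono power_mono) (auto intro: order_trans)
    also have "kite f V1 x y \<le> Y"
      unfolding Y_def by (intro kite_le_integral) (intro bm f V)+
    finally have "(codeg f x y)\<^sup>2 * kite f f x y \<le> (codeg f x y)\<^sup>2 * (\<theta> * D\<^sup>2 + Y + kite f V2 x y)"
      by (intro mult_left_mono) auto
    then show ?thesis by (simp add: algebra_simps)
  qed
  have "(\<integral>x. \<integral>y. (codeg f x y)\<^sup>2 * kite f f x y \<partial>M \<partial>M) \<le>
    (\<integral>x. \<integral>y. (\<theta> * D\<^sup>2 + Y) * (codeg f x y)\<^sup>2 + (codeg f x y)\<^sup>2 * kite f V2 x y \<partial>M \<partial>M)"
    by (intro integral2_mono) (intro bm pt)+
  also have "\<dots> = (\<theta> * D\<^sup>2 + Y) * (\<integral>x. \<integral>y. (codeg f x y)\<^sup>2 \<partial>M \<partial>M) + (\<integral>x. \<integral>y. (codeg f x y)\<^sup>2 * kite f V2 x y \<partial>M \<partial>M)"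
    by (subst integral2_plus, (intro bm)+) simp
  also have "(\<theta> * D\<^sup>2 + Y) * (\<integral>x. \<integral>y. (codeg f x y)\<^sup>2 \<partial>M \<partial>M) \<le> (\<theta> * D\<^sup>2 + Y) * (sqnorm f)\<^sup>2"
    using \<open>\<theta> \<ge> 0\<close> \<open>Y \<ge> 0\<close> by (intro mult_left_mono integral2_codeg_power2_le assms) auto
  finally show ?thesis by (simp add: Y_def algebra_simps)
qed

lemma integral_const_mult: "(\<integral>x. c * f x \<partial>M) = c * (\<integral>x. f x \<partial>M)" for f :: "'a \<Rightarrow> real"
  by simp

text \<open>Products that involve \<open>l\<close> at one of the two ends are bounded by
  Cauchy-Schwarz. The weighted inequality (c + d)^2 \<le> (1 + \<tau>) c^2 + (1 + 1 / \<tau>) d^2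
  keeps the coefficient of the main term close to 1, which matters for the sharp constant.\<close>

lemma codeg_power2_split:
  assumes "kernel M f" "kernel M h" "kernel M l"
    and h: "\<And>x y. 0 \<le> h x y" and l: "\<And>x y. 0 \<le> l x y" and f: "\<And>x y. f x y = h x y + l x y"
    and "\<tau> > 0"
  shows "(codeg f x y)\<^sup>2 \<le> (1 + \<tau>) * (codeg h x y)\<^sup>2
    + (1 + 1 / \<tau>) * (2 * (sqdeg l x * sqdeg f y + sqdeg f x * sqdeg l y))"
proof -
  note bm = kernel_intros kernel_compose[OF assms(1)] kernel_compose[OF assms(2)] kernel_compose[OF assms(3)] assms(1-3)
  define A B where "A = (\<integral>z. l x z * f y z \<partial>M)" and "B = (\<integral>z. f x z * l y z \<partial>M)"
  have "A \<ge> 0" "B \<ge> 0" "0 \<le> codeg h x y" "0 \<le> codeg f x y"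
    using h l by (auto simp: A_def B_def f intro!: codeg_nonneg)
  have "codeg f x y \<le> (\<integral>z. h x z * h y z + (l x z * f y z + f x z * l y z) \<partial>M)"
    unfolding codeg_def
    by (intro integral_le_integral bm) (use h l in \<open>auto simp: f algebra_simps\<close>)
  also have "\<dots> = codeg h x y + (A + B)"
    unfolding codeg_def A_def B_def by (subst integral_plus integral_plus, (intro bm)+)+ simp
  finally have "(codeg f x y)\<^sup>2 \<le> (codeg h x y + (A + B))\<^sup>2"
    using \<open>0 \<le> codeg f x y\<close> by (intro power_mono)
  also have "\<dots> \<le> (1 + \<tau>) * (codeg h x y)\<^sup>2 + (1 + 1 / \<tau>) * (A + B)\<^sup>2"
  proof -
    have "0 \<le> (\<tau> * codeg h x y - (A + B))\<^sup>2 / \<tau>" using \<open>\<tau> > 0\<close> by simp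
    also have "\<dots> = (1 + \<tau>) * (codeg h x y)\<^sup>2 + (1 + 1 / \<tau>) * (A + B)\<^sup>2 - (codeg h x y + (A + B))\<^sup>2"
      using \<open>\<tau> > 0\<close> by (simp add: power2_eq_square field_simps)
    finally show ?thesis by simp
  qed
  also have "(A + B)\<^sup>2 \<le> 2 * (A\<^sup>2 + B\<^sup>2)"
    using sum_squares_bound[of A B] by (simp add: power2_sum)
  also have "A\<^sup>2 \<le> sqdeg l x * sqdeg f y"
    unfolding A_def sqdeg_def by (intro Cauchy_Schwarz bm)
  also have "B\<^sup>2 \<le> sqdeg f x * sqdeg l y"
    unfolding B_def sqdeg_def by (intro Cauchy_Schwarz bm)
  finally show ?thesis using \<open>\<tau> > 0\<close> by (simp add: mult_left_mono)
qed

text \<open>Replaces \<open>f\<close> by its large values \<open>h\<close> on the edges at the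
  vertices 4 and 5 only; the kite is left alone. In the error term the kite is bounded by the
  integral of \<open>V\<close>, so that the error has a factor \<open>sqnorm l\<close>, which is
  small compared with \<open>sqnorm f\<close>.\<close>

lemma integral2_codeg_kite_high:
  assumes "kernel M f" "kernel M h" "kernel M l" "kernel M V"
    and h: "\<And>x y. 0 \<le> h x y" and l: "\<And>x y. 0 \<le> l x y" and f: "\<And>x y. f x y = h x y + l x y"
    and f1: "\<And>x y. f x y \<le> 1" and V: "\<And>x y. 0 \<le> V x y"
    and "\<tau> > 0"
  shows "(\<integral>x. \<integral>y. (codeg f x y)\<^sup>2 * kite f V x y \<partial>M \<partial>M) \<le>
     (1 + \<tau>) * (\<integral>x. \<integral>y. (codeg h x y)\<^sup>2 * kite f V x y \<partial>M \<partial>M)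
     + (1 + 1 / \<tau>) * (4 * sqnorm l * sqnorm f * (\<integral>x. \<integral>y. V x y \<partial>M \<partial>M))"
proof -
  note bm = kernel_intros kernel_compose[OF assms(1)] kernel_compose[OF assms(2)] kernel_compose[OF assms(3)]
    kernel_compose[OF assms(4)] assms(1-4)
  define Y where "Y = (\<integral>x. \<integral>y. V x y \<partial>M \<partial>M)"
  have f0: "0 \<le> f x y" for x y using h l by (simp add: f)
  have pt: "(codeg f x y)\<^sup>2 * kite f V x y \<le> (1 + \<tau>) * ((codeg h x y)\<^sup>2 * kite f V x y)
    + ((1 + 1 / \<tau>) * 2 * Y) * (sqdeg l x * sqdeg f y + sqdeg f x * sqdeg l y)" for x y
  proof -
    have k: "0 \<le> kite f V x y" by (intro kite_nonneg f0 V)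
    have "(codeg f x y)\<^sup>2 * kite f V x y \<le> ((1 + \<tau>) * (codeg h x y)\<^sup>2
    + (1 + 1 / \<tau>) * (2 * (sqdeg l x * sqdeg f y + sqdeg f x * sqdeg l y))) * kite f V x y"
      by (intro mult_right_mono codeg_power2_split assms k)
    also have "\<dots> = (1 + \<tau>) * ((codeg h x y)\<^sup>2 * kite f V x y)
       + ((1 + 1 / \<tau>) * 2 * (sqdeg l x * sqdeg f y + sqdeg f x * sqdeg l y)) * kite f V x y"
      by (simp add: algebra_simps)
    also have "((1 + 1 / \<tau>) * 2 * (sqdeg l x * sqdeg f y + sqdeg f x * sqdeg l y)) * kite f V x y
      \<le> ((1 + 1 / \<tau>) * 2 * (sqdeg l x * sqdeg f y + sqdeg f x * sqdeg l y)) * Y"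
      unfolding Y_def using \<open>\<tau> > 0\<close>
      by (intro mult_left_mono kite_le_integral f0 f1 V assms mult_nonneg_nonneg add_nonneg_nonneg sqdeg_nonneg) auto
    finally show ?thesis by (simp add: mult_ac)
  qed
  have "(\<integral>x. \<integral>y. (codeg f x y)\<^sup>2 * kite f V x y \<partial>M \<partial>M) \<le>
     (\<integral>x. \<integral>y. (1 + \<tau>) * ((codeg h x y)\<^sup>2 * kite f V x y)
    + ((1 + 1 / \<tau>) * 2 * Y) * (sqdeg l x * sqdeg f y + sqdeg f x * sqdeg l y) \<partial>M \<partial>M)"
    by (intro integral2_mono) (intro bm pt)+
  also have "\<dots> = (1 + \<tau>) * (\<integral>x. \<integral>y. (codeg h x y)\<^sup>2 * kite f V x y \<partial>M \<partial>M)
      + ((1 + 1 / \<tau>) * 2 * Y) * (\<integral>x. \<integral>y. sqdeg l x * sqdeg f y + sqdeg f x * sqdeg l y \<partial>M \<partial>M)"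
    by (subst integral2_plus, (intro bm)+) simp
  also have "(\<integral>x. \<integral>y. sqdeg l x * sqdeg f y + sqdeg f x * sqdeg l y \<partial>M \<partial>M) = 2 * sqnorm l * sqnorm f"
    by (subst integral2_plus, (intro bm)+) (simp add: sqnorm_def)
  finally show ?thesis by (simp add: Y_def algebra_simps)
qed

text \<open>There are few vertices of degree at least \<open>\<rho>\<close>, so that little of \<open>h\<close> lies between two of them. This
  is the source of the factor \<open>1 / 2\<close>, as the part of \<open>h\<close> that starts at such vertices is
  counted twice in \<open>sqnorm h\<close>.\<close>

lemma integral2_codeg_kite_hubs:
  assumes "kernel M f" "kernel M h" "kernel M V"
    and h: "\<And>x y. 0 \<le> h x y" "\<And>x y. h x y \<le> f x y" "\<And>x y. h x y = h y x"
    and f1: "\<And>x y. f x y \<le> 1" and V: "\<And>x y. 0 \<le> V x y" "\<And>x y. V x y \<le> 1"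
    and "\<rho> > 0"
  shows "(\<integral>x. \<integral>y. (codeg h x y)\<^sup>2 * kite f V x y \<partial>M \<partial>M) \<le> \<rho>\<^sup>2 * (sqnorm f)\<^sup>2
     + (\<integral>x. \<integral>y. V x y \<partial>M \<partial>M) * ((sqnorm h + ((\<integral>x. \<integral>y. h x y \<partial>M \<partial>M) / \<rho>)\<^sup>2) / 2)\<^sup>2"
proof -
  define Y where "Y = (\<integral>x. \<integral>y. V x y \<partial>M \<partial>M)"
  define X where "X x = (if (\<integral>y. h x y \<partial>M) \<ge> \<rho> then 1 else 0 :: real)" for x
  have X01: "0 \<le> X x" "X x \<le> 1" for x by (auto simp: X_def)
  have Xbm: "bounded_measurable M X"
  proof (rule bounded_measurableI)
    have [measurable]: "(\<lambda>x. \<integral>y. h x y \<partial>M) \<in> borel_measurable M"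
      using bounded_measurable_integral[of M h] assms(2) by (auto simp: bounded_measurable_def)
    show "X \<in> borel_measurable M" unfolding X_def by measurable
    show "\<bar>X x\<bar> \<le> 1" for x by (simp add: X_def)
  qed
  note bm = kernel_intros kernel_compose[OF assms(1)] kernel_compose[OF assms(2)] kernel_compose[OF assms(3)]
    assms(1-3) bounded_measurable_compose[OF Xbm]
  have f0: "0 \<le> f x y" for x y using h(1,2) order_trans by blast
  have h1: "h x y \<le> 1" for x y using h(2) f1 order_trans by blast
  have "Y \<ge> 0" unfolding Y_def using V by simp
  define m where "m = (\<integral>x. X x \<partial>M)"
  have "m \<ge> 0" using X01 by (simp add: m_def)
  have m_le: "m \<le> (\<integral>x. \<integral>y. h x y \<partial>M \<partial>M) / \<rho>"
  proof -
    have "m \<le> (\<integral>x. (\<integral>y. h x y \<partial>M) / \<rho> \<partial>M)"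
      unfolding m_def using \<open>\<rho> > 0\<close> h(1)
      by (intro integral_le_integral) ((intro bm)+, auto simp: X_def)
    then show ?thesis by simp
  qed
  define S where "S = (\<integral>x. X x * sqdeg h x \<partial>M)"
  have "S \<ge> 0" using X01 sqdeg_nonneg by (auto simp: S_def)
  have S_alt: "S = (\<integral>x. \<integral>y. X x * (h x y)\<^sup>2 \<partial>M \<partial>M)"
    by (simp add: S_def sqdeg_def)
  have S_le: "2 * S \<le> sqnorm h + m\<^sup>2"
  proof -
    have "S = (\<integral>y. \<integral>x. X x * (h x y)\<^sup>2 \<partial>M \<partial>M)"
      unfolding S_alt by (intro integral_swap) (intro bm)+
    also have "\<dots> = (\<integral>x. \<integral>y. X y * (h x y)\<^sup>2 \<partial>M \<partial>M)"
      by (intro Bochner_Integration.integral_cong refl arg_cong2[where f = times] arg_cong[where f = "\<lambda>u. u\<^sup>2"] h(3))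
    finally have "2 * S = S + (\<integral>x. \<integral>y. X y * (h x y)\<^sup>2 \<partial>M \<partial>M)"
      by simp
    also have "\<dots> = (\<integral>x. \<integral>y. X x * (h x y)\<^sup>2 + X y * (h x y)\<^sup>2 \<partial>M \<partial>M)"
      unfolding S_alt by (intro integral2_plus[symmetric]) (intro bm)+
    also have "\<dots> \<le> (\<integral>x. \<integral>y. (h x y)\<^sup>2 + X x * X y \<partial>M \<partial>M)"
    proof (intro integral2_mono)
      fix x y
      \<comment> \<open>The claim is checked on the values of the two indicators. If both are 1, the
        overlap \<open>(h x y)\<^sup>2\<close> is paid for by \<open>X x * X y\<close>.\<close>
      have "(h x y)\<^sup>2 \<le> 1" using h(1) h1 by (simp add: power_le_one)
      then show "X x * (h x y)\<^sup>2 + X y * (h x y)\<^sup>2 \<le> (h x y)\<^sup>2 + X x * X y"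
        by (auto simp: X_def)
    qed (intro bm)+
    also have "\<dots> = sqnorm h + m\<^sup>2"
      by (subst integral2_plus, (intro bm)+) (simp add: sqnorm_def sqdeg_def m_def power2_eq_square)
    finally show ?thesis .
  qed
  have pt: "(codeg h x y)\<^sup>2 * kite f V x y \<le> \<rho>\<^sup>2 * (codeg f x y)\<^sup>2 + Y * ((X x * sqdeg h x) * (X y * sqdeg h y))" for x y
  proof (cases "X x = 1 \<and> X y = 1")
    case True
    \<comment> \<open>The edges at 4 and 5 yield the two factors \<open>sqdeg h\<close>, the edge
      {2, 3} yields \<open>Y\<close>, and the four edges between {0, 1} and {2, 3} are bounded by 1.
      Nothing essential is lost, as all eight edges at 0 and 1 have weight 1 in the dominant part of
      the construction.\<close>
    have "(codeg h x y)\<^sup>2 * kite f V x y \<le> (sqdeg h x * sqdeg h y) * Y"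
      unfolding Y_def
      by (intro mult_mono codeg_power2_le kite_le_integral assms(1-3) f0 f1 V mult_nonneg_nonneg sqdeg_nonneg kite_nonneg)
    with True show ?thesis by (simp add: mult_ac add_increasing)
  next
    case False
    then consider "(\<integral>z. h x z \<partial>M) < \<rho>" | "(\<integral>z. h y z \<partial>M) < \<rho>"
      by (auto simp: X_def split: if_splits)
    \<comment> \<open>A codegree is at most either of the two degrees, one of which is below \<rho>
      here. The kite is then bounded by the square of the codegree of \<open>f\<close>, so that what
      remains is a 4-cycle density.\<close>
    then have "codeg h x y \<le> \<rho>"
      using codeg_le_deg[OF assms(2) h(1) h1, of x y] codeg_le_deg[OF assms(2) h(1) h1, of y x]
      by cases (auto simp: codeg_commute)
    then have "(codeg h x y)\<^sup>2 * kite f V x y \<le> \<rho>\<^sup>2 * (1 * (codeg f x y)\<^sup>2)"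
      by (intro mult_mono power_mono kite_le assms(1-3) V h(1) kite_nonneg codeg_nonneg f0) auto
    also have "\<dots> \<le> \<rho>\<^sup>2 * (codeg f x y)\<^sup>2 + Y * ((X x * sqdeg h x) * (X y * sqdeg h y))"
      using \<open>Y \<ge> 0\<close> X01 sqdeg_nonneg by simp
    finally show ?thesis .
  qed
  have "(\<integral>x. \<integral>y. (codeg h x y)\<^sup>2 * kite f V x y \<partial>M \<partial>M) \<le>
    (\<integral>x. \<integral>y. \<rho>\<^sup>2 * (codeg f x y)\<^sup>2 + Y * ((X x * sqdeg h x) * (X y * sqdeg h y)) \<partial>M \<partial>M)"
    by (intro integral2_mono) (intro bm pt)+
  also have "\<dots> = \<rho>\<^sup>2 * (\<integral>x. \<integral>y. (codeg f x y)\<^sup>2 \<partial>M \<partial>M) + Y * S\<^sup>2"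
    by (subst integral2_plus, (intro bm)+) (simp add: S_def power2_eq_square)
  also have "\<dots> \<le> \<rho>\<^sup>2 * (sqnorm f)\<^sup>2 + Y * ((sqnorm h + ((\<integral>x. \<integral>y. h x y \<partial>M \<partial>M) / \<rho>)\<^sup>2) / 2)\<^sup>2"
  proof (intro add_mono mult_left_mono power_mono integral2_codeg_power2_le assms(1))
    have "m\<^sup>2 \<le> ((\<integral>x. \<integral>y. h x y \<partial>M \<partial>M) / \<rho>)\<^sup>2"
      using m_le \<open>m \<ge> 0\<close> by (intro power_mono)
    with S_le show "S \<le> (sqnorm h + ((\<integral>x. \<integral>y. h x y \<partial>M \<partial>M) / \<rho>)\<^sup>2) / 2"
      by simp
  qed (simp_all add: \<open>S \<ge> 0\<close> \<open>Y \<ge> 0\<close>)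
  finally show ?thesis by (simp add: Y_def)
qed

end

section \<open>Expansion around the constant graphon\<close>

text \<open>Here c stands for a codegree, Q for a kite and P for a mixed term. The bounds c \<le> 2
  p, Q \<le> c^2 and P \<le> 16 p^4 reduce every product to one of p^6 c, p^3 c^2, p^4 P, except p^9
  and the product c^2 Q of the full graph. The constants add up as 44 = 4 + 8 + 32 and 71 = 6 + 8 +
  4 + 1 + 4 + 16 + 16 + 16.\<close>

lemma hom_pointwise_bound:
  fixes p c Q P :: real
  assumes p: "0 < p" "p \<le> 1" and c: "0 \<le> c" "c \<le> 2 * p" and Q: "0 \<le> Q" "Q \<le> c\<^sup>2"
    and P: "0 \<le> P" "P \<le> 16 * p ^ 4"
  shows "p * (p\<^sup>2 + c) ^ 4 + (p\<^sup>2 + c)\<^sup>2 * (Q + 8 * p\<^sup>2 * c + P)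
     \<le> p ^ 9 + 44 * p ^ 6 * c + 71 * p ^ 3 * c\<^sup>2 + p ^ 4 * P + c\<^sup>2 * Q"
proof -
  have pw: "p ^ n * c\<^sup>2 \<le> p ^ 3 * c\<^sup>2" if "n \<ge> 3" for n
    using p that by (intro mult_right_mono power_decreasing) auto
  have pw6: "p ^ 7 * c \<le> p ^ 6 * c"
    using p c by (intro mult_right_mono power_decreasing) auto
  have c3: "c ^ 3 \<le> 2 * p * c\<^sup>2"
    using mult_right_mono[OF c(2), of "c\<^sup>2"] by (simp add: power3_eq_cube power2_eq_square mult_ac)
  have c4: "c ^ 4 \<le> 4 * p\<^sup>2 * c\<^sup>2"
  proof -
    have "c\<^sup>2 \<le> (2 * p)\<^sup>2" using c by (intro power_mono)
    from mult_right_mono[OF this, of "c\<^sup>2"] show ?thesis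
      by (simp add: power_mult_distrib flip: power_add)
  qed
  have a1: "p * p\<^sup>2 * c ^ 3 \<le> 2 * p ^ 3 * c\<^sup>2"
  proof -
    have "p ^ 3 * c ^ 3 \<le> p ^ 3 * (2 * p * c\<^sup>2)" using c3 p by (intro mult_left_mono) auto
    also have "\<dots> = 2 * (p ^ 4 * c\<^sup>2)" by (simp add: power_numeral_reduce)
    finally show ?thesis using pw[of 4] by (simp add: power_numeral_reduce)
  qed
  have a2: "p * c ^ 4 \<le> 4 * p ^ 3 * c\<^sup>2"
    using mult_left_mono[OF c4, of p] p by (simp add: power_numeral_reduce mult_ac)
  have a3: "p\<^sup>2 * c * Q \<le> 2 * p ^ 3 * c\<^sup>2"
  proof -
    have "p\<^sup>2 * c * Q \<le> p\<^sup>2 * c * c\<^sup>2" using Q c by (intro mult_left_mono) auto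
    also have "\<dots> = p\<^sup>2 * c ^ 3" by (simp add: power_numeral_reduce)
    also have "\<dots> \<le> p\<^sup>2 * (2 * p * c\<^sup>2)" using c3 by (intro mult_left_mono) auto
    finally show ?thesis by (simp add: power_numeral_reduce mult_ac)
  qed
  have a4: "p ^ 4 * Q \<le> p ^ 3 * c\<^sup>2"
    by (rule order_trans[OF mult_left_mono[OF Q(2)] pw]) (use p in auto)
  have a5: "c\<^sup>2 * P \<le> 16 * p ^ 3 * c\<^sup>2"
    using mult_left_mono[OF P(2), of "c\<^sup>2"] pw[of 4] by (simp add: mult_ac)
  have a6: "p\<^sup>2 * c * P \<le> 16 * p ^ 6 * c"
    using mult_left_mono[OF P(2), of "p\<^sup>2 * c"] c by (simp add: power_numeral_reduce mult_ac)
  have a7: "p\<^sup>2 * c ^ 3 \<le> 2 * p ^ 3 * c\<^sup>2"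
    using mult_left_mono[OF c3, of "p\<^sup>2"] by (simp add: power_numeral_reduce mult_ac)
  have "p * (p\<^sup>2 + c) ^ 4 + (p\<^sup>2 + c)\<^sup>2 * (Q + 8 * p\<^sup>2 * c + P) =
     p ^ 9 + 4 * (p ^ 7 * c) + 6 * (p ^ 5 * c\<^sup>2) + 4 * (p * p\<^sup>2 * c ^ 3) + p * c ^ 4
     + (p ^ 4 * Q + 2 * (p\<^sup>2 * c * Q) + c\<^sup>2 * Q + 8 * (p ^ 6 * c) + 16 * (p ^ 4 * c\<^sup>2) + 8 * (p\<^sup>2 * c ^ 3)
     + p ^ 4 * P + 2 * (p\<^sup>2 * c * P) + c\<^sup>2 * P)"
    by algebra
  moreover have "p ^ 5 * c\<^sup>2 \<le> p ^ 3 * c\<^sup>2" "p ^ 4 * c\<^sup>2 \<le> p ^ 3 * c\<^sup>2" by (auto intro: pw)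
  moreover have "0 \<le> p ^ 3 * c\<^sup>2" using p by simp
  ultimately show ?thesis
    using pw6 a1 a2 a3 a4 a5 a6 a7 by linarith
qed

context full_prob_space
begin

lemma integral2_plus_eq:
  assumes "kernel M f" "kernel M g"
    and "(\<integral>x. \<integral>y. f x y \<partial>M \<partial>M) = A" "(\<integral>x. \<integral>y. g x y \<partial>M \<partial>M) = B"
  shows "(\<integral>x. \<integral>y. f x y + g x y \<partial>M \<partial>M) = A + B"
  using integral2_plus[OF assms(1,2)] assms(3,4) by simp

text \<open>Regularity says that the integral of \<open>U\<close> over either variable vanishes.
  This removes the linear terms from \<open>codeg W\<close>, and it permits subtracting p^2 from the
  two products of edges in the kite. After that, absolute values can be taken: in every surviving
  term other than the constant one and the full graph, there are powers of p to spare. The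
  coefficient 48 is 44 + 4, where 4 comes from the integral of p^4 \<open>P\<close>.\<close>

lemma hom_le:
  assumes U: "kernel M U" and sym: "\<And>x y. U x y = U y x" and bound: "\<And>x y. \<bar>U x y\<bar> \<le> 1"
    and reg: "\<And>x. (\<integral>y. U x y \<partial>M) = 0" and deg: "\<And>x. (\<integral>y. \<bar>U x y\<bar> \<partial>M) \<le> 2 * p"
    and p: "0 < p" "p \<le> 1"
  defines "W \<equiv> \<lambda>x y. p + U x y" and "f \<equiv> \<lambda>x y. \<bar>U x y\<bar>"
  shows "(\<integral>x. \<integral>y. (codeg W x y)\<^sup>2 * kite W W x y \<partial>M \<partial>M) \<le>
    p ^ 9 + 48 * p ^ 6 * sqnorm f + 71 * p ^ 3 * (sqnorm f)\<^sup>2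
      + (\<integral>x. \<integral>y. (codeg f x y)\<^sup>2 * kite f f x y \<partial>M \<partial>M)"
proof -
  have fk: "kernel M f" unfolding f_def by (intro kernel_intros U)
  have Wk: "kernel M W" unfolding W_def by (intro kernel_intros U)
  note bm = kernel_intros kernel_compose[OF U] kernel_compose[OF fk] kernel_compose[OF Wk] U fk Wk
  have f0: "0 \<le> f x y" and f1: "f x y \<le> 1" and fU: "\<bar>U x y\<bar> \<le> f x y" for x y
    using bound by (auto simp: f_def)
  have fsym: "f x y = f y x" for x y unfolding f_def by (subst sym) simp
  have fdeg: "(\<integral>y. f x y \<partial>M) \<le> 2 * p" for x using deg by (simp add: f_def)
  define e where "e x = (\<integral>y. codeg f x y \<partial>M)" for x
  have ebm: "bounded_measurable M e" unfolding e_def by (intro bm)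
  have c0: "0 \<le> codeg f x y" for x y by (intro codeg_nonneg f0)
  have c2p: "codeg f x y \<le> 2 * p" for x y
    using codeg_le_deg[OF fk f0 f1, of x y] fdeg[of x] by simp
  have codegW: "codeg W x y = p\<^sup>2 + codeg U x y" for x y
  proof -
    have "codeg W x y = (\<integral>z. p\<^sup>2 + (p * U x z + (p * U y z + U x z * U y z)) \<partial>M)"
      unfolding codeg_def W_def
      by (intro Bochner_Integration.integral_cong) (auto simp: power2_eq_square algebra_simps)
    also have "\<dots> = p\<^sup>2 + codeg U x y"
      unfolding codeg_def by (subst integral_plus integral_plus integral_plus, (intro bm)+)+ (simp add: reg prob_space)
    finally show ?thesis .
  qed
  have codegU: "\<bar>codeg U x y\<bar> \<le> codeg f x y" for x y
  proof -
    have "\<bar>codeg U x y\<bar> \<le> (\<integral>z. \<bar>U x z * U y z\<bar> \<partial>M)"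
      unfolding codeg_def by simp
    then show ?thesis by (simp add: codeg_def f_def abs_mult)
  qed
  \<comment> \<open>The part of the kite in which \<open>a\<close> and \<open>b\<close> are both
    attached to {x, y} by a single edge of \<open>f\<close>, the other one being replaced by
    p.\<close>
  define P where "P x y = (\<integral>a. \<integral>b. p * (f x a + f y a) * (p * (f x b + f y b)) * f a b \<partial>M \<partial>M)" for x y
  have P0: "0 \<le> P x y" for x y unfolding P_def using f0 p by simp
  have v_int: "(\<integral>a. p * (f x a + f y a) \<partial>M) \<le> 4 * p\<^sup>2" for x y
  proof -
    have "(\<integral>a. p * (f x a + f y a) \<partial>M) = p * ((\<integral>a. f x a \<partial>M) + (\<integral>a. f y a \<partial>M))"
      by (subst integral_const_mult, subst integral_plus, (intro bm)+) simp
    also have "\<dots> \<le> p * (2 * p + 2 * p)"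
      using p fdeg by (intro mult_left_mono add_mono) auto
    finally show ?thesis by (simp add: power2_eq_square)
  qed
  have v_nonneg: "0 \<le> (\<integral>a. p * (f x a + f y a) \<partial>M)" for x y using f0 p by simp
  have P_le: "P x y \<le> 16 * p ^ 4" for x y
  proof -
    have "P x y \<le> (\<integral>a. \<integral>b. p * (f x a + f y a) * (p * (f x b + f y b)) \<partial>M \<partial>M)"
      unfolding P_def using f0 f1 p
      by (intro integral2_mono) ((intro bm)+, intro mult_left_le, auto)
    also have "\<dots> = (\<integral>a. p * (f x a + f y a) \<partial>M)\<^sup>2"
      by (simp only: integral_mult_right_zero integral_mult_left_zero power2_eq_square)
    also have "\<dots> \<le> (4 * p\<^sup>2)\<^sup>2"
      by (intro power_mono v_int v_nonneg)
    finally show ?thesis by (simp add: power_mult_distrib flip: power_mult)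
  qed
  \<comment> \<open>Bounding the edge at \<open>a\<close> by 1 leaves the path from \<open>x\<close>
    or \<open>y\<close> over \<open>b\<close> to \<open>a\<close>, whose integral is
    \<open>e\<close>. The uniform bound \<open>P_le\<close> would not suffice for p^4
    \<open>P\<close>, since 16 p^8 exceeds p^9; it is used where \<open>P\<close> is multiplied by a
    codegree.\<close>
  have P_le': "P x y \<le> 2 * p\<^sup>2 * (e x + e y)" for x y
  proof -
    have "P x y \<le> (\<integral>a. \<integral>b. (2 * p\<^sup>2) * (f x b * f a b + f y b * f a b) \<partial>M \<partial>M)"
      unfolding P_def
    proof (intro integral2_mono)
      fix a b
      have "(f x a + f y a) * (p\<^sup>2 * (f x b + f y b) * f a b) \<le> 2 * (p\<^sup>2 * (f x b + f y b) * f a b)"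
        using f0 f1[of x a] f1[of y a] by (intro mult_right_mono) auto
      then show "p * (f x a + f y a) * (p * (f x b + f y b)) * f a b \<le> (2 * p\<^sup>2) * (f x b * f a b + f y b * f a b)"
        by (simp add: power2_eq_square algebra_simps)
    qed (intro bm)+
    also have "\<dots> = 2 * p\<^sup>2 * (e x + e y)"
      unfolding integral_const_mult e_def codeg_def by (subst integral2_plus, (intro bm)+) simp
    finally show ?thesis .
  qed
  have kiteW: "kite W W x y \<le> p * (codeg W x y)\<^sup>2 + (kite f f x y + 8 * p\<^sup>2 * codeg f x y + P x y)" for x y
  proof -
    define w where "w a = W x a * W y a" for a
    define D where "D a = w a - p\<^sup>2" for a
    define D' where "D' a = p * (f x a + f y a) + f x a * f y a" for a
    have w_bm: "bounded_measurable M w" unfolding w_def by (intro bm)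
    have D_bm: "bounded_measurable M D" unfolding D_def by (intro bm w_bm)
    have D'_bm: "bounded_measurable M D'" unfolding D'_def by (intro bm)
    note bm = bm bounded_measurable_compose[OF w_bm] bounded_measurable_compose[OF D_bm]
      bounded_measurable_compose[OF D'_bm]
    define E where "E = (\<integral>a. \<integral>b. D a * D b * U a b \<partial>M \<partial>M)"
    define v where "v = (\<integral>a. p * (f x a + f y a) \<partial>M)"
    have "kite W W x y = (\<integral>a. \<integral>b. w a * w b * p + w a * w b * U a b \<partial>M \<partial>M)"
      by (simp add: kite_def w_def W_def algebra_simps)
    also have "\<dots> = (\<integral>a. \<integral>b. w a * w b * p \<partial>M \<partial>M) + (\<integral>a. \<integral>b. w a * w b * U a b \<partial>M \<partial>M)"
      by (intro integral2_plus) (intro bm)+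
    also have "(\<integral>a. \<integral>b. w a * w b * p \<partial>M \<partial>M) = p * (codeg W x y)\<^sup>2"
      by (simp add: codeg_def w_def power2_eq_square)
    also have "(\<integral>a. \<integral>b. w a * w b * U a b \<partial>M \<partial>M) = E"
    proof -
      \<comment> \<open>The difference between \<open>w\<close> and \<open>D\<close> is constant and
        \<open>U a\<close> integrates to 0. After exchanging the integrals and using symmetry, the
        same is done in the other variable.\<close>
      have inner: "(\<integral>b. w b * U a b \<partial>M) = (\<integral>b. D b * U a b \<partial>M)" for a
      proof -
        have "(\<integral>b. w b * U a b \<partial>M) = (\<integral>b. D b * U a b + p\<^sup>2 * U a b \<partial>M)"
          by (intro Bochner_Integration.integral_cong) (auto simp: D_def algebra_simps)
        also have "\<dots> = (\<integral>b. D b * U a b \<partial>M)"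
          by (subst integral_plus, (intro bm)+) (simp add: reg)
        finally show ?thesis .
      qed
      have "(\<integral>a. \<integral>b. w a * w b * U a b \<partial>M \<partial>M) = (\<integral>a. \<integral>b. w a * (D b * U a b) \<partial>M \<partial>M)"
        by (simp only: mult.assoc integral_mult_right_zero inner)
      also have "\<dots> = (\<integral>b. \<integral>a. w a * (D b * U a b) \<partial>M \<partial>M)"
        by (intro integral_swap) (intro bm)+
      also have "\<dots> = (\<integral>b. \<integral>a. D b * (w a * U b a) \<partial>M \<partial>M)"
        by (intro Bochner_Integration.integral_cong refl) (subst sym, simp add: mult_ac)
      also have "\<dots> = (\<integral>a. \<integral>b. D a * D b * U a b \<partial>M \<partial>M)"
        by (simp only: mult.assoc integral_mult_right_zero inner)
      finally show ?thesis by (simp only: E_def)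
    qed
    finally have kite_eq: "kite W W x y = p * (codeg W x y)\<^sup>2 + E" .
    have "E \<le> (\<integral>a. \<integral>b. p * (f x a + f y a) * (p * (f x b + f y b)) * f a b
        + ((f x a * f y a) * (f x b * f y b) * f a b
          + (p * (f x a + f y a) * (f x b * f y b) + (f x a * f y a) * (p * (f x b + f y b)))) \<partial>M \<partial>M)"
      unfolding E_def
    proof (intro integral2_mono)
      fix a b
      have DD': "\<bar>D a\<bar> \<le> D' a" for a
      proof -
        have "D a = p * (U x a + U y a) + U x a * U y a"
          by (simp add: D_def w_def W_def power2_eq_square algebra_simps)
        then have "\<bar>D a\<bar> \<le> \<bar>p * (U x a + U y a)\<bar> + \<bar>U x a * U y a\<bar>" by linarith
        also have "\<dots> \<le> D' a"
          unfolding D'_def abs_mult f_def using p by (intro add_mono mult_mono abs_triangle_ineq) auto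
        finally show ?thesis .
      qed
      have D'0: "0 \<le> D' a" for a using DD'[of a] by simp
      have "D a * D b * U a b \<le> \<bar>D a\<bar> * \<bar>D b\<bar> * \<bar>U a b\<bar>"
        by (metis abs_ge_self abs_mult)
      also have "\<dots> \<le> D' a * D' b * f a b"
        by (intro mult_mono DD' D'0 fU mult_nonneg_nonneg) auto
      also have "\<dots> = p * (f x a + f y a) * (p * (f x b + f y b)) * f a b
        + ((f x a * f y a) * (f x b * f y b) * f a b
          + (p * (f x a + f y a) * (f x b * f y b) + (f x a * f y a) * (p * (f x b + f y b))) * f a b)"
        by (simp add: D'_def algebra_simps)
      \<comment> \<open>In the two mixed products the edge between \<open>a\<close> and
        \<open>b\<close> is dropped. Each then factorises into a codegree and an integral of at most
        4 p^2, which explains the term 8 p^2 \<open>codeg f x y\<close>.\<close>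
      also have "(p * (f x a + f y a) * (f x b * f y b) + (f x a * f y a) * (p * (f x b + f y b))) * f a b
        \<le> p * (f x a + f y a) * (f x b * f y b) + (f x a * f y a) * (p * (f x b + f y b))"
        using f0 f1 p by (intro mult_left_le) auto
      finally show "D a * D b * U a b \<le> p * (f x a + f y a) * (p * (f x b + f y b)) * f a b
        + ((f x a * f y a) * (f x b * f y b) * f a b
          + (p * (f x a + f y a) * (f x b * f y b) + (f x a * f y a) * (p * (f x b + f y b))))"
        by simp
    qed (intro bm)+
    also have "\<dots> = P x y + (kite f f x y + (v * codeg f x y + codeg f x y * v))"
      unfolding P_def kite_def codeg_def v_def
      by (intro integral2_plus_eq refl; (intro bm)?) (simp_all only: integral_mult_right_zero integral_mult_left_zero)
    finally have "E \<le> P x y + (kite f f x y + (v * codeg f x y + codeg f x y * v))" .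
    moreover have "v * codeg f x y \<le> 4 * p\<^sup>2 * codeg f x y"
      unfolding v_def by (intro mult_right_mono v_int c0)
    ultimately show ?thesis unfolding kite_eq by (simp add: mult.commute[of _ v])
  qed
  have pt: "(codeg W x y)\<^sup>2 * kite W W x y \<le>
    p ^ 9 + (44 * p ^ 6 * codeg f x y + (71 * p ^ 3 * (codeg f x y)\<^sup>2 + (2 * p ^ 6 * (e x + e y)
      + (codeg f x y)\<^sup>2 * kite f f x y)))" for x y
  proof -
    have q0: "0 \<le> kite f f x y" by (intro kite_nonneg f0)
    have q1: "kite f f x y \<le> (codeg f x y)\<^sup>2"
      using kite_le[OF fk fk f0 f1, of x y] by simp
    have W2: "(codeg W x y)\<^sup>2 \<le> (p\<^sup>2 + codeg f x y)\<^sup>2"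
    proof -
      have "\<bar>codeg W x y\<bar> \<le> p\<^sup>2 + codeg f x y"
        using codegU[of x y] zero_le_power2[of p] unfolding codegW by linarith
      then show ?thesis by (metis abs_ge_zero power2_abs power_mono)
    qed
    have "(codeg W x y)\<^sup>2 * kite W W x y \<le>
      (codeg W x y)\<^sup>2 * (p * (codeg W x y)\<^sup>2 + (kite f f x y + 8 * p\<^sup>2 * codeg f x y + P x y))"
      by (intro mult_left_mono kiteW) auto
    also have "\<dots> \<le> (p\<^sup>2 + codeg f x y)\<^sup>2 * (p * (p\<^sup>2 + codeg f x y)\<^sup>2 + (kite f f x y + 8 * p\<^sup>2 * codeg f x y + P x y))"
      using W2 q0 c0 P0 p
      by (intro mult_mono add_mono mult_left_mono add_nonneg_nonneg mult_nonneg_nonneg) auto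
    also have "\<dots> = p * (p\<^sup>2 + codeg f x y) ^ 4 + (p\<^sup>2 + codeg f x y)\<^sup>2 * (kite f f x y + 8 * p\<^sup>2 * codeg f x y + P x y)"
      by algebra
    also have "\<dots> \<le> p ^ 9 + 44 * p ^ 6 * codeg f x y + 71 * p ^ 3 * (codeg f x y)\<^sup>2 + p ^ 4 * P x y
       + (codeg f x y)\<^sup>2 * kite f f x y"
      by (intro hom_pointwise_bound p c0 c2p q0 q1 P0 P_le)
    also have "p ^ 4 * P x y \<le> p ^ 4 * (2 * p\<^sup>2 * (e x + e y))"
      using p by (intro mult_left_mono P_le') auto
    also have "p ^ 4 * (2 * p\<^sup>2 * (e x + e y)) = 2 * p ^ 6 * (e x + e y)"
      by algebra
    finally show ?thesis by simp
  qed
  note bm = bm bounded_measurable_compose[OF ebm]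
  have e_int: "(\<integral>x. e x \<partial>M) \<le> sqnorm f"
    unfolding e_def by (intro integral2_codeg_le fk)
  have "(\<integral>x. \<integral>y. (codeg W x y)\<^sup>2 * kite W W x y \<partial>M \<partial>M) \<le>
     (\<integral>x. \<integral>y. p ^ 9 + (44 * p ^ 6 * codeg f x y + (71 * p ^ 3 * (codeg f x y)\<^sup>2 + (2 * p ^ 6 * (e x + e y)
      + (codeg f x y)\<^sup>2 * kite f f x y))) \<partial>M \<partial>M)"
    by (intro integral2_mono) (intro bm pt)+
  also have "\<dots> = p ^ 9 + (44 * p ^ 6 * (\<integral>x. e x \<partial>M) + (71 * p ^ 3 * (\<integral>x. \<integral>y. (codeg f x y)\<^sup>2 \<partial>M \<partial>M)
      + (2 * p ^ 6 * (2 * (\<integral>x. e x \<partial>M)) + (\<integral>x. \<integral>y. (codeg f x y)\<^sup>2 * kite f f x y \<partial>M \<partial>M))))"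
  proof -
    have "(\<integral>x. \<integral>y. e x + e y \<partial>M \<partial>M) = 2 * (\<integral>x. e x \<partial>M)"
      by (subst integral2_plus, (intro bm)+) (simp add: prob_space)
    moreover have "(\<integral>x. \<integral>y. codeg f x y \<partial>M \<partial>M) = (\<integral>x. e x \<partial>M)" by (simp add: e_def)
    ultimately show ?thesis
      by (intro integral2_plus_eq; (intro bm)?) (simp_all only: integral_mult_right_zero integral_const)
  qed
  also have "\<dots> \<le> p ^ 9 + (44 * p ^ 6 * sqnorm f + (71 * p ^ 3 * (sqnorm f)\<^sup>2
      + (2 * p ^ 6 * (2 * sqnorm f) + (\<integral>x. \<integral>y. (codeg f x y)\<^sup>2 * kite f f x y \<partial>M \<partial>M))))"
    using p by (intro add_mono mult_left_mono e_int integral2_codeg_power2_le fk order_refl) auto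
  finally show ?thesis by (simp add: algebra_simps)
qed

end

section \<open>Pointwise bounds for the relative entropy\<close>

lemma mult_ln_divide_ge:
  fixes t s :: real
  assumes "t \<ge> 0" "s > 0"
  shows "t - s \<le> t * ln (t / s)"
proof (cases "t = 0")
  case False
  with assms have "t > 0" by simp
  have "ln (s / t) \<le> s / t - 1"
    using assms \<open>t > 0\<close> by (intro ln_le_minus_one) simp
  then have "1 - s / t \<le> ln (t / s)"
    using assms \<open>t > 0\<close> by (simp add: ln_div)
  then have "t * (1 - s / t) \<le> t * ln (t / s)"
    using \<open>t > 0\<close> by (intro mult_left_mono) auto
  then show ?thesis using \<open>t > 0\<close> by (simp add: algebra_simps)
qed (use assms in auto)

context
  fixes p w :: real
  assumes p: "0 < p" "p < 1" and w: "0 \<le> w" "w \<le> 1"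
begin

lemma rel_entropy_ge_ln: "w * ln (w / p) - (w - p) \<le> rel_entropy p w"
  using mult_ln_divide_ge[of "1 - w" "1 - p"] p w by (simp add: rel_entropy_def)

text \<open>Comparison with the Hellinger distance \<open>(sqrt w - sqrt p)\<^sup>2\<close>.\<close>

lemma rel_entropy_ge_square: "(w - p)\<^sup>2 / (2 * (w + p)) \<le> rel_entropy p w"
proof -
  have "(w - p)\<^sup>2 / (2 * (w + p)) \<le> (sqrt w - sqrt p)\<^sup>2"
  proof -
    have "(w - p)\<^sup>2 = ((sqrt w - sqrt p) * (sqrt w + sqrt p))\<^sup>2"
      using p w by (simp add: algebra_simps flip: power2_eq_square)
    also have "\<dots> = (sqrt w - sqrt p)\<^sup>2 * (sqrt w + sqrt p)\<^sup>2"
      by (rule power_mult_distrib)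
    also have "(sqrt w + sqrt p)\<^sup>2 \<le> 2 * (w + p)"
      using sum_squares_bound[of "sqrt w" "sqrt p"] p w by (simp add: power2_sum)
    finally show ?thesis
      using p w by (simp add: divide_le_eq mult_left_mono add_nonneg_pos)
  qed
  also have "(sqrt w - sqrt p)\<^sup>2 \<le> w * ln (w / p) - (w - p)"
  proof (cases "w = 0")
    case False
    with w have "w > 0" by simp
    have "w * (1 - sqrt p / sqrt w) \<le> w * (ln (w / p) / 2)"
    proof (rule mult_left_mono)
      have "ln (sqrt p / sqrt w) \<le> sqrt p / sqrt w - 1"
        using p \<open>w > 0\<close> by (intro ln_le_minus_one) simp
      moreover have "ln (sqrt p / sqrt w) = - (ln (w / p) / 2)"
        using p \<open>w > 0\<close> by (simp add: ln_div ln_sqrt field_simps)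
      ultimately show "1 - sqrt p / sqrt w \<le> ln (w / p) / 2" by simp
    qed (use w in simp)
    moreover have "w * (1 - sqrt p / sqrt w) = w - sqrt w * sqrt p"
      using \<open>w > 0\<close> by (simp add: field_simps)
    ultimately have "w - sqrt w * sqrt p \<le> w * (ln (w / p) / 2)"
      by simp
    then show ?thesis
      using p w by (simp add: power2_diff)
  qed (use p in simp)
  also have "\<dots> \<le> rel_entropy p w"
    by (rule rel_entropy_ge_ln)
  finally show ?thesis .
qed

lemma rel_entropy_nonneg: "0 \<le> rel_entropy p w"
  by (rule order_trans[OF _ rel_entropy_ge_square]) (use p w in simp)

text \<open>The two terms t ln t with t = w and t = 1 - w are at least - 1 / e each; the cruder -
  1/2 makes the total loss 1.\<close>

lemma rel_entropy_ge_linear: "w * ln (1 / p) - 1 \<le> rel_entropy p w"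
proof -
  have aux: "- (1/2) \<le> t * ln t" if "0 \<le> t" for t :: real
  proof -
    have "t - exp (-1) \<le> t * ln (t / exp (-1))"
      using that by (intro mult_ln_divide_ge) auto
    moreover have "t * ln (t / exp (-1)) = t * ln t + t"
      using that by (cases "t = 0") (auto simp: ln_div algebra_simps)
    moreover have "exp (-1) \<le> (1/2 :: real)"
      using exp_ge_add_one_self[of "1::real"] by (simp add: exp_minus field_simps)
    ultimately show ?thesis by simp
  qed
  have "w * ln (w / p) = w * ln (1 / p) + w * ln w"
    using p w by (cases "w = 0") (auto simp: ln_div algebra_simps)
  moreover have "(1 - w) * ln ((1 - w) / (1 - p)) = (1 - w) * ln (1 - w) - (1 - w) * ln (1 - p)"
    using p w by (cases "w = 1") (auto simp: ln_div algebra_simps)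
  moreover have "(1 - w) * ln (1 - p) \<le> 0"
    using p w by (intro mult_nonneg_nonpos) auto
  ultimately show ?thesis
    using aux[of w] aux[of "1 - w"] w unfolding rel_entropy_def by simp
qed

lemma rel_entropy_ge_ln_linear:
  assumes "w - p \<ge> p * K" "K \<ge> 1"
  shows "(w - p) * (ln K - 1) \<le> rel_entropy p w"
proof -
  have "K \<le> w / p" using assms p by (simp add: field_simps)
  then have "0 \<le> ln K" "ln K \<le> ln (w / p)" using assms by auto
  then have "(w - p) * ln K \<le> w * ln (w / p)"
    using p w by (intro mult_mono) auto
  then show ?thesis
    using rel_entropy_ge_ln by (simp add: algebra_simps)
qed

text \<open>The loss of 1 in the linear bound is at most (w - p) / \<eta>, and (w - p)^2 \<le> w -
  p. The last step is sharp for values near 1, such as those at the hubs of the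
  construction.\<close>

lemma rel_entropy_ge_high:
  assumes "w - p > \<eta>" "\<eta> > 0" "\<eta> * ln (1 / p) \<ge> 1"
  shows "(ln (1 / p) - 1 / \<eta>) * (w - p)\<^sup>2 \<le> rel_entropy p w"
proof -
  define L where "L = ln (1 / p)"
  have L: "L > 0" using p by (simp add: L_def)
  have L1: "0 \<le> L - 1 / \<eta>" using assms by (simp add: field_simps L_def)
  have "(w - p)\<^sup>2 \<le> w - p"
    using p w assms by (simp add: power2_eq_square mult_left_le)
  then have "(L - 1 / \<eta>) * (w - p)\<^sup>2 \<le> (L - 1 / \<eta>) * (w - p)"
    using L1 by (rule mult_left_mono)
  also have "\<dots> \<le> (w - p) * L - 1"
    using assms by (simp add: algebra_simps)
  also have "\<dots> \<le> w * L - 1"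
    using p L by simp
  also have "\<dots> \<le> rel_entropy p w"
    unfolding L_def by (rule rel_entropy_ge_linear)
  finally show ?thesis by (simp add: L_def)
qed

text \<open>The coefficient is larger than that for high values by a factor of order 1 / \<eta>, so
  that values up to \<eta> have a small share in the square integral. Up to deviation sqrt p, the
  Hellinger bound gives the coefficient 1 / (6 sqrt p), which is more than enough; beyond it, ln (w
  / p) is at least half of ln (1 / p).\<close>

lemma rel_entropy_ge_low:
  assumes "w - p \<le> \<eta>" "\<eta> > 0" "ln (1 / p) \<ge> 4" "3 * sqrt p * ln (1 / p) \<le> 2 * \<eta>"
  shows "ln (1 / p) / (4 * \<eta>) * (w - p)\<^sup>2 \<le> rel_entropy p w"
proof -
  define L where "L = ln (1 / p)"
  have L: "L \<ge> 4" using assms by (simp add: L_def)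
  have pp: "p \<le> sqrt p" using p by (intro real_le_rsqrt) (simp add: power2_eq_square mult_left_le)
  show ?thesis
  proof (cases "w - p \<le> sqrt p")
    case True
    then have "w + p \<le> 3 * sqrt p" using pp by simp
    have "L / (4 * \<eta>) * (w - p)\<^sup>2 \<le> 1 / (6 * sqrt p) * (w - p)\<^sup>2"
      using assms p by (intro mult_right_mono) (simp_all add: L_def field_simps)
    also have "\<dots> \<le> (w - p)\<^sup>2 / (2 * (w + p))"
      using \<open>w + p \<le> 3 * sqrt p\<close> p w by (simp add: frac_le)
    also have "\<dots> \<le> rel_entropy p w" by (rule rel_entropy_ge_square)
    finally show ?thesis by (simp add: L_def)
  next
    case False
    define x where "x = w - p"
    have x: "x > sqrt p" using False by (simp add: x_def)
    have "x > 0" using x p by (meson less_trans real_sqrt_gt_zero)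
    have "sqrt p \<le> w" using x p by (simp add: x_def)
    then have "1 / sqrt p \<le> w / p"
      using p by (simp add: field_simps) (metis less_eq_real_def mult.commute mult_left_mono real_sqrt_ge_zero real_sqrt_mult_self abs_of_pos)
    then have "ln (1 / sqrt p) \<le> ln (w / p)"
      using p by (intro ln_mono) auto
    then have "L / 2 \<le> ln (w / p)"
      using p by (simp add: L_def ln_div ln_sqrt)
    then have "x * (L / 2) \<le> w * ln (w / p)"
      using L \<open>x > 0\<close> p w by (intro mult_mono) (auto simp: x_def)
    then have *: "x * (L / 2) - x \<le> rel_entropy p w"
      using rel_entropy_ge_ln by (simp add: x_def)
    have "L / (4 * \<eta>) * x\<^sup>2 = x * (L / 4) * (x / \<eta>)"
      using assms by (simp add: power2_eq_square)
    also have "\<dots> \<le> x * (L / 4)"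
      using assms \<open>x > 0\<close> L by (intro mult_left_le) (auto simp: x_def)
    also have "\<dots> \<le> x * (L / 2) - x"
      using L mult_left_mono[of 4 L x] \<open>x > 0\<close> by (simp add: field_simps)
    finally show ?thesis using * by (simp add: x_def L_def)
  qed
qed

end

section \<open>The lower bound\<close>

context full_prob_space
begin

text \<open>Reduces the graphon to three numbers: the square integrals H of the deviations above
  \<eta> and S of the others, and the integral Y of those between p K and \<eta>. What remains is an
  optimisation over real numbers.\<close>

lemma entropy_and_hom_bounds:
  fixes W :: "'a \<Rightarrow> 'a \<Rightarrow> real" and p \<eta> K \<rho> \<tau> :: real
  defines "L \<equiv> ln (1 / p)"
  assumes W: "kernel M W" and sym: "\<And>x y. W x y = W y x" and W01: "\<And>x y. 0 \<le> W x y" "\<And>x y. W x y \<le> 1"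
    and reg: "\<And>x. (\<integral>y. W x y \<partial>M) = p"
    and I: "kernel M (\<lambda>x y. rel_entropy p (W x y))" "(\<integral>x. \<integral>y. rel_entropy p (W x y) \<partial>M \<partial>M) = I"
    and p: "0 < p" "p < 1" and K: "K \<ge> 1" and "\<rho> > 0" "\<tau> > 0"
    and \<eta>: "\<eta> > 0" "p \<le> \<eta>" "\<eta> * L \<ge> 1" "3 * sqrt p * L \<le> 2 * \<eta>" and L: "L \<ge> 4"
  shows "\<exists>H S Y. 0 \<le> H \<and> 0 \<le> S \<and> 0 \<le> Y \<and>
     (L - 1 / \<eta>) * H + (ln K - 1) * Y \<le> I \<and> L / (4 * \<eta>) * S \<le> I \<and>
     (\<integral>x. \<integral>y. (codeg W x y)\<^sup>2 * kite W W x y \<partial>M \<partial>M) \<le> p ^ 9 + 48 * p ^ 6 * (H + S) + 71 * p ^ 3 * (H + S)\<^sup>2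
       + 4 * p ^ 3 * K * (H + S)\<^sup>2 + H / \<eta> * (H + S)\<^sup>2
       + (1 + \<tau>) * (\<rho>\<^sup>2 * (H + S)\<^sup>2 + Y * ((H + (H / \<eta> / \<rho>)\<^sup>2) / 2)\<^sup>2)
       + (1 + 1 / \<tau>) * (4 * S * (H + S) * Y)"
proof -
  define U where "U x y = W x y - p" for x y
  define f where "f x y = \<bar>U x y\<bar>" for x y
  \<comment> \<open>The supports of \<open>h\<close> and \<open>V\<close> are disjoint, which is why
    the entropy bounds for H and Y add up. In contrast, \<open>V\<close> is a part of
    \<open>l\<close>, so the bound for S is kept apart.\<close>
  define h where "h x y = (if f x y > \<eta> then f x y else 0)" for x y
  define l where "l x y = (if f x y > \<eta> then 0 else f x y)" for x y
  define V where "V x y = (if p * K < f x y \<and> f x y \<le> \<eta> then f x y else 0)" for x y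
  have Uk: "kernel M U" unfolding U_def by (intro kernel_intros W)
  have fk: "kernel M f" unfolding f_def by (intro kernel_intros Uk)
  have f0: "0 \<le> f x y" and f1: "f x y \<le> 1" for x y
    using W01[of x y] p by (auto simp: f_def U_def)
  have fm [measurable]: "(\<lambda>z. f (fst z) (snd z)) \<in> borel_measurable (M \<Otimes>\<^sub>M M)"
    using fk by (simp add: bounded_measurable_def)
  have hk: "kernel M h"
  proof (rule bounded_measurableI)
    show "(\<lambda>z. h (fst z) (snd z)) \<in> borel_measurable (M \<Otimes>\<^sub>M M)" unfolding h_def by measurable
    show "\<bar>h (fst z) (snd z)\<bar> \<le> 1" for z using f0 f1 by (auto simp: h_def)
  qed
  have lk: "kernel M l"
  proof (rule bounded_measurableI)
    show "(\<lambda>z. l (fst z) (snd z)) \<in> borel_measurable (M \<Otimes>\<^sub>M M)" unfolding l_def by measurable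
    show "\<bar>l (fst z) (snd z)\<bar> \<le> 1" for z using f0 f1 by (auto simp: l_def)
  qed
  have Vk: "kernel M V"
  proof (rule bounded_measurableI)
    show "(\<lambda>z. V (fst z) (snd z)) \<in> borel_measurable (M \<Otimes>\<^sub>M M)" unfolding V_def by measurable
    show "\<bar>V (fst z) (snd z)\<bar> \<le> 1" for z using f0 f1 by (auto simp: V_def)
  qed
  note bm = kernel_intros kernel_compose[OF Uk] kernel_compose[OF fk] kernel_compose[OF hk] kernel_compose[OF lk]
    kernel_compose[OF Vk] kernel_compose[OF W] Uk fk hk lk Vk W I(1)
  have h0: "0 \<le> h x y" and hf: "h x y \<le> f x y" and l0: "0 \<le> l x y" and flh: "f x y = h x y + l x y"
    and V0: "0 \<le> V x y" and V1: "V x y \<le> 1" for x y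
    using f0 f1 by (auto simp: h_def l_def V_def)
  have fsym: "f x y = f y x" for x y unfolding f_def U_def by (subst sym) simp
  have hsym: "h x y = h y x" for x y unfolding h_def using fsym[of x y] by simp
  have Wint: "integrable M (\<lambda>y. W x y)" for x by (intro bm)
  have Ureg: "(\<integral>y. U x y \<partial>M) = 0" for x
    unfolding U_def by (subst Bochner_Integration.integral_diff) (auto simp: Wint reg prob_space)
  have Udeg: "(\<integral>y. f x y \<partial>M) \<le> 2 * p" for x
  proof -
    have "(\<integral>y. f x y \<partial>M) \<le> (\<integral>y. W x y + p \<partial>M)"
      using W01 p by (intro integral_le_integral bm) (auto simp: f_def U_def abs_if)
    also have "\<dots> = 2 * p"
      by (subst integral_plus, (intro bm)+) (simp add: reg prob_space)
    finally show ?thesis .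
  qed
  define H S Y where "H = sqnorm h" and "S = sqnorm l" and "Y = (\<integral>x. \<integral>y. V x y \<partial>M \<partial>M)"
  have H0: "0 \<le> H" "0 \<le> S" by (simp_all add: H_def S_def sqnorm_nonneg)
  have Y0: "0 \<le> Y" unfolding Y_def using V0 by simp
  have Hint: "H = (\<integral>x. \<integral>y. (h x y)\<^sup>2 \<partial>M \<partial>M)" and Sint: "S = (\<integral>x. \<integral>y. (l x y)\<^sup>2 \<partial>M \<partial>M)"
    by (simp_all add: H_def S_def sqnorm_def sqdeg_def)
  have HS: "sqnorm f = H + S"
  proof -
    have "sqnorm f = (\<integral>x. \<integral>y. (h x y)\<^sup>2 + (l x y)\<^sup>2 \<partial>M \<partial>M)"
      unfolding sqnorm_def sqdeg_def
      by (intro Bochner_Integration.integral_cong) (auto simp: h_def l_def)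
    also have "\<dots> = H + S"
      unfolding Hint Sint by (intro integral2_plus) (intro bm)+
    finally show ?thesis .
  qed
  have hint: "(\<integral>x. \<integral>y. h x y \<partial>M \<partial>M) \<le> H / \<eta>"
  proof -
    have "(\<integral>x. \<integral>y. h x y \<partial>M \<partial>M) \<le> (\<integral>x. \<integral>y. (h x y)\<^sup>2 / \<eta> \<partial>M \<partial>M)"
      using \<eta> by (intro integral2_mono) ((intro bm)+, auto simp: h_def field_simps power2_eq_square)
    then show ?thesis by (simp add: Hint)
  qed
  have hint0: "0 \<le> (\<integral>x. \<integral>y. h x y \<partial>M \<partial>M)" using h0 by simp
  \<comment> \<open>A negative deviation is at most p in absolute value. Both \<open>h\<close> and
    \<open>V\<close> only see deviations above p, hence positive ones, for which the entropy is
    large.\<close>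
  have pos: "f x y = W x y - p" if "f x y > p" for x y
    using that W01[of x y] by (auto simp: f_def U_def abs_if split: if_splits)
  have sq: "(f x y)\<^sup>2 = (W x y - p)\<^sup>2" for x y by (simp add: f_def U_def)
  have pK: "p \<le> p * K" using p K by simp
  have E1: "(L - 1 / \<eta>) * H + (ln K - 1) * Y \<le> I"
  proof -
    have "(L - 1 / \<eta>) * H + (ln K - 1) * Y = (\<integral>x. \<integral>y. (L - 1 / \<eta>) * (h x y)\<^sup>2 + (ln K - 1) * V x y \<partial>M \<partial>M)"
      unfolding Hint Y_def by (subst integral2_plus, (intro bm)+) simp
    also have "\<dots> \<le> (\<integral>x. \<integral>y. rel_entropy p (W x y) \<partial>M \<partial>M)"
    proof (intro integral2_mono)
      fix x y
      show "(L - 1 / \<eta>) * (h x y)\<^sup>2 + (ln K - 1) * V x y \<le> rel_entropy p (W x y)"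
      proof (cases "f x y > \<eta>")
        case True
        then have "f x y = W x y - p" using \<eta> by (intro pos) simp
        with True show ?thesis
          using rel_entropy_ge_high[OF p W01, of \<eta> x y] \<eta> by (simp add: h_def V_def L_def)
      next
        case False
        show ?thesis
        proof (cases "p * K < f x y")
          case True
          then have "f x y = W x y - p" using pK by (intro pos) simp
          with True False show ?thesis
            using rel_entropy_ge_ln_linear[OF p W01, of K x y] K by (simp add: h_def V_def mult.commute)
        next
          case F: False
          with False show ?thesis
            using rel_entropy_nonneg[OF p W01] by (simp add: h_def V_def)
        qed
      qed
    qed (intro bm)+
    finally show ?thesis using I(2) by simp
  qed
  have E2: "L / (4 * \<eta>) * S \<le> I"
  proof -
    have "L / (4 * \<eta>) * S = (\<integral>x. \<integral>y. L / (4 * \<eta>) * (l x y)\<^sup>2 \<partial>M \<partial>M)"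
      unfolding Sint by simp
    also have "\<dots> \<le> (\<integral>x. \<integral>y. rel_entropy p (W x y) \<partial>M \<partial>M)"
    proof (intro integral2_mono)
      fix x y
      show "L / (4 * \<eta>) * (l x y)\<^sup>2 \<le> rel_entropy p (W x y)"
      proof (cases "f x y > \<eta>")
        case True
        then show ?thesis using rel_entropy_nonneg[OF p W01] by (simp add: l_def)
      next
        case False
        then have "W x y - p \<le> \<eta>" by (auto simp: f_def U_def)
        with False show ?thesis
          using rel_entropy_ge_low[OF p W01, of x y \<eta>] \<eta> L by (simp add: l_def L_def sq)
      qed
    qed (intro bm)+
    finally show ?thesis using I(2) by simp
  qed
  define J where "J = (\<integral>x. \<integral>y. (codeg f x y)\<^sup>2 * kite f f x y \<partial>M \<partial>M)"
  define J2 where "J2 = (\<integral>x. \<integral>y. (codeg f x y)\<^sup>2 * kite f V x y \<partial>M \<partial>M)"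
  define J3 where "J3 = (\<integral>x. \<integral>y. (codeg h x y)\<^sup>2 * kite f V x y \<partial>M \<partial>M)"
  have "(\<integral>x. \<integral>y. (codeg (\<lambda>x y. p + U x y) x y)\<^sup>2 * kite (\<lambda>x y. p + U x y) (\<lambda>x y. p + U x y) x y \<partial>M \<partial>M) \<le>
    p ^ 9 + 48 * p ^ 6 * sqnorm (\<lambda>x y. \<bar>U x y\<bar>) + 71 * p ^ 3 * (sqnorm (\<lambda>x y. \<bar>U x y\<bar>))\<^sup>2 +
     (\<integral>x. \<integral>y. (codeg (\<lambda>x y. \<bar>U x y\<bar>) x y)\<^sup>2 * kite (\<lambda>x y. \<bar>U x y\<bar>) (\<lambda>x y. \<bar>U x y\<bar>) x y \<partial>M \<partial>M)"
  proof (rule hom_le)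
    show "U x y = U y x" for x y unfolding U_def by (subst sym) simp
  qed (use Uk f1 Ureg Udeg p in \<open>simp_all add: f_def\<close>)
  moreover have "(\<lambda>x y. p + U x y) = W" "(\<lambda>x y. \<bar>U x y\<bar>) = f"
    by (simp_all add: U_def f_def fun_eq_iff)
  ultimately have hom: "(\<integral>x. \<integral>y. (codeg W x y)\<^sup>2 * kite W W x y \<partial>M \<partial>M) \<le>
     p ^ 9 + 48 * p ^ 6 * (H + S) + 71 * p ^ 3 * (H + S)\<^sup>2 + J"
    by (simp add: HS J_def)
  have "J \<le> (p * K) * (2 * p)\<^sup>2 * (sqnorm f)\<^sup>2 + (\<integral>x. \<integral>y. h x y \<partial>M \<partial>M) * (sqnorm f)\<^sup>2 + J2"
    unfolding J_def J2_def
    by (rule integral2_codeg_kite_split[OF fk hk Vk f0 f1 Udeg _ h0 V0])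
      (use p K in \<open>auto simp: h_def V_def\<close>)
  also have "(p * K) * (2 * p)\<^sup>2 * (sqnorm f)\<^sup>2 = 4 * p ^ 3 * K * (H + S)\<^sup>2"
    unfolding HS by algebra
  also have "(\<integral>x. \<integral>y. h x y \<partial>M \<partial>M) * (sqnorm f)\<^sup>2 \<le> H / \<eta> * (H + S)\<^sup>2"
    unfolding HS using hint by (rule mult_right_mono) simp
  finally have J: "J \<le> 4 * p ^ 3 * K * (H + S)\<^sup>2 + H / \<eta> * (H + S)\<^sup>2 + J2" by simp
  have J2: "J2 \<le> (1 + \<tau>) * J3 + (1 + 1 / \<tau>) * (4 * S * (H + S) * Y)"
    unfolding J2_def J3_def S_def Y_def HS[unfolded S_def, symmetric]
    by (intro integral2_codeg_kite_high fk hk lk Vk h0 l0 flh f1 V0 \<open>\<tau> > 0\<close>)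
  have "J3 \<le> \<rho>\<^sup>2 * (sqnorm f)\<^sup>2 + Y * ((sqnorm h + ((\<integral>x. \<integral>y. h x y \<partial>M \<partial>M) / \<rho>)\<^sup>2) / 2)\<^sup>2"
    unfolding J3_def Y_def
    by (intro integral2_codeg_kite_hubs fk hk Vk h0 hf hsym f1 V0 V1 \<open>\<rho> > 0\<close>)
  also have "\<dots> \<le> \<rho>\<^sup>2 * (H + S)\<^sup>2 + Y * ((H + (H / \<eta> / \<rho>)\<^sup>2) / 2)\<^sup>2"
    unfolding HS H_def[symmetric] using hint hint0 Y0 H0 \<open>\<rho> > 0\<close>
    by (intro add_mono order_refl mult_left_mono power_mono divide_right_mono) auto
  finally have "(1 + \<tau>) * J3 \<le> (1 + \<tau>) * (\<rho>\<^sup>2 * (H + S)\<^sup>2 + Y * ((H + (H / \<eta> / \<rho>)\<^sup>2) / 2)\<^sup>2)"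
    using \<open>\<tau> > 0\<close> by (intro mult_left_mono) auto
  then have "(\<integral>x. \<integral>y. (codeg W x y)\<^sup>2 * kite W W x y \<partial>M \<partial>M) \<le> p ^ 9 + 48 * p ^ 6 * (H + S) + 71 * p ^ 3 * (H + S)\<^sup>2
       + 4 * p ^ 3 * K * (H + S)\<^sup>2 + H / \<eta> * (H + S)\<^sup>2
       + (1 + \<tau>) * (\<rho>\<^sup>2 * (H + S)\<^sup>2 + Y * ((H + (H / \<eta> / \<rho>)\<^sup>2) / 2)\<^sup>2)
       + (1 + 1 / \<tau>) * (4 * S * (H + S) * Y)"
    using hom J J2 by linarith
  with H0 Y0 E1 E2 show ?thesis by blast
qed

end

section \<open>The optimisation over real numbers\<close>

lemma filterlim_ln_inverse: "filterlim (\<lambda>p::real. ln (1 / p)) at_top (at_right 0)"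
  by real_asymp

lemma filterlim_ln_ln_inverse: "filterlim (\<lambda>p::real. ln (ln (1 / p))) at_top (at_right 0)"
  by real_asymp

lemma upper_tail_rate_power3:
  assumes "\<delta> > 0" "ln (1 / p) > 0" "ln (ln (1 / p)) > 0"
  shows "upper_tail_rate \<delta> p ^ 3 = 18 * \<delta> * p ^ 9 * ln (1 / p) ^ 2 * ln (ln (1 / p))"
proof -
  have cube: "(x powr a) ^ 3 = x powr (3 * a)" if "x > 0" for x a :: real
    using that by (metis mult.commute of_nat_numeral powr_powr powr_realpow powr_gt_zero)
  show ?thesis
    using assms unfolding upper_tail_rate_def power_mult_distrib
    by (simp add: cube powr_numeral flip: power_mult)
qed

text \<open>The terms of the bound in \<open>entropy_and_hom_bounds\<close> other than p^9 and (1 +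
  \<tau>) Y H^2 / 4, for \<eta> = 1 / l, K = \<open>L powr (2/3) / l\<close>, \<rho>^2 = p^3 and
  \<tau> = \<open>l powr (-1/2)\<close>, after inserting the a priori bounds H + S \<le> X, S \<le>
  4 R / (L l) and Y \<le> 2 R / l.\<close>

definition hom_error :: "real \<Rightarrow> real \<Rightarrow> real" where
  "hom_error \<delta> p = (let L = ln (1 / p); l = ln L; R = upper_tail_rate \<delta> p; X = 2 * R / L; \<tau> = l powr (-1/2) in
     48 * p ^ 6 * X + 71 * p ^ 3 * X\<^sup>2 + 4 * p ^ 3 * (L powr (2/3) / l) * X\<^sup>2 + X * l * X\<^sup>2
       + (1 + \<tau>) * (p ^ 3 * X\<^sup>2 + 2 * R / l * ((2 * X * ((X * l)\<^sup>2 / p ^ 3) + ((X * l)\<^sup>2 / p ^ 3)\<^sup>2) / 4))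
       + (1 + 1 / \<tau>) * (4 * (4 * R / (L * l)) * X * (2 * R / l)))"

text \<open>Since X has order p^3 (l / L)^(1/3), most terms gain a power of L over p^9. The tight
  ones gain only powers of l: the term with K is of order p^9 l^(-1/3), which is the reason for
  dividing by l in K, and the last one is of order p^9 l^(-1/2), because 1 / \<tau> costs half of
  the gain of 1 / l.\<close>

lemma hom_error_tendsto:
  assumes "\<delta> > 0"
  shows "((\<lambda>p. hom_error \<delta> p / p ^ 9) \<longlongrightarrow> 0) (at_right 0)"
proof -
  define c where "c = (18 * \<delta>) powr (1/3)"
  have "c > 0" using assms by (simp add: c_def)
  then show ?thesis
    unfolding hom_error_def Let_def upper_tail_rate_def c_def[symmetric]
    by real_asymp
qed

text \<open>The numerator is the lower bound that the arithmetic-geometric mean inequality gives for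
  the cube of the entropy. As ln K - 1 is asymptotic to (2/3) l, the limit is 27 * (2/3) / 18 =
  1.\<close>

lemma lower_bound_ratio_tendsto:
  assumes "\<delta> > 0"
  shows "((\<lambda>p. 27 * (ln (1 / p) - ln (ln (1 / p)))\<^sup>2 * (ln (ln (1 / p) powr (2/3) / ln (ln (1 / p))) - 1)
     * ((\<delta> * p ^ 9 - hom_error \<delta> p) / (1 + ln (ln (1 / p)) powr (-1/2))) / upper_tail_rate \<delta> p ^ 3) \<longlongrightarrow> 1) (at_right 0)"
    (is "(?f \<longlongrightarrow> 1) _")
proof -
  have "((\<lambda>p::real. (ln (1 / p) - ln (ln (1 / p)))\<^sup>2 * (ln (ln (1 / p) powr (2/3) / ln (ln (1 / p))) - 1)
     / ((1 + ln (ln (1 / p)) powr (-1/2)) * ln (1 / p) ^ 2 * ln (ln (1 / p)))) \<longlongrightarrow> 2/3) (at_right 0)"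
    (is "(?g \<longlongrightarrow> _) _")
    by real_asymp
  then have "((\<lambda>p. 27 / (18 * \<delta>) * ?g p * (\<delta> - hom_error \<delta> p / p ^ 9)) \<longlongrightarrow> 27 / (18 * \<delta>) * (2/3) * (\<delta> - 0)) (at_right 0)"
    by (intro tendsto_mult tendsto_diff tendsto_const hom_error_tendsto assms)
  moreover have "\<forall>\<^sub>F p in at_right 0. 27 / (18 * \<delta>) * ?g p * (\<delta> - hom_error \<delta> p / p ^ 9) = ?f p"
    using filterlim_at_top_dense[THEN iffD1, OF filterlim_ln_inverse, rule_format, of 0]
      filterlim_at_top_dense[THEN iffD1, OF filterlim_ln_ln_inverse, rule_format, of 0]
      eventually_at_right_less[of 0]
  proof eventually_elim
    case (elim p)
    have a: "1 + ln (ln (1 / p)) powr (-1/2) > 0" by (simp add: add_pos_nonneg)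
    have b: "\<delta> * p ^ 9 - hom_error \<delta> p = p ^ 9 * (\<delta> - hom_error \<delta> p / p ^ 9)"
      using elim by (simp add: field_simps)
    show ?case
      unfolding upper_tail_rate_power3[OF assms elim(1,2)] b using elim a assms
      by (simp add: divide_simps)
  qed
  ultimately show ?thesis
    using assms by (simp add: tendsto_cong)
qed

text \<open>The difference of the two sides is (A - 2 B)^2 (A + B / 4), so equality holds at A = 2
  B. It is applied with A and B the parts of the entropy due to H and to Y.\<close>

lemma power3_AM_GM:
  fixes A B :: real
  assumes "A \<ge> 0" "B \<ge> 0"
  shows "27 * A\<^sup>2 * B / 4 \<le> (A + B) ^ 3"
proof -
  have "(A + B) ^ 3 - 27 * A\<^sup>2 * B / 4 = (A - 2 * B)\<^sup>2 * (A + B / 4)"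
    by (simp add: power2_eq_square power3_eq_cube field_simps)
  also have "\<dots> \<ge> 0" using assms by simp
  finally show ?thesis by simp
qed

text \<open>If the entropy were below the claimed bound, then H, S and Y would be as small as
  assumed in \<open>hom_error\<close>, and the constraint would force Y H^2 / 4 to be almost
  \<delta> p^9, against the arithmetic-geometric mean inequality. The quantifiers stand inside the
  eventuality because the threshold for p has to be uniform in the graphon.\<close>

lemma eventually_entropy_lower_bound:
  fixes \<delta> \<epsilon> :: real
  assumes "\<delta> > 0" "0 < \<epsilon>" "\<epsilon> < 1"
  shows "\<forall>\<^sub>F p in at_right 0. \<forall>H S Y I. 
     0 \<le> H \<longrightarrow> 0 \<le> S \<longrightarrow> 0 \<le> Y \<longrightarrow>
     (ln (1 / p) - ln (ln (1 / p))) * H + (ln (ln (1 / p) powr (2/3) / ln (ln (1 / p))) - 1) * Y \<le> I \<longrightarrow>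
     ln (1 / p) * ln (ln (1 / p)) / 4 * S \<le> I \<longrightarrow>
     (1 + \<delta>) * p ^ 9 \<le> p ^ 9 + 48 * p ^ 6 * (H + S) + 71 * p ^ 3 * (H + S)\<^sup>2
       + 4 * p ^ 3 * (ln (1 / p) powr (2/3) / ln (ln (1 / p))) * (H + S)\<^sup>2 + H * ln (ln (1 / p)) * (H + S)\<^sup>2
       + (1 + ln (ln (1 / p)) powr (-1/2)) * (p ^ 3 * (H + S)\<^sup>2 + Y * ((H + (H * ln (ln (1 / p)))\<^sup>2 / p ^ 3) / 2)\<^sup>2)
       + (1 + 1 / (ln (ln (1 / p)) powr (-1/2))) * (4 * S * (H + S) * Y) \<longrightarrow>
     (1 - \<epsilon>) * upper_tail_rate \<delta> p \<le> I"
proof -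
  have "(1 - \<epsilon>) ^ 3 < 1" using assms by (simp add: power_less_one_iff)
  then have ratio: "\<forall>\<^sub>F p in at_right 0. (1 - \<epsilon>) ^ 3 < 27 * (ln (1 / p) - ln (ln (1 / p)))\<^sup>2 * (ln (ln (1 / p) powr (2/3) / ln (ln (1 / p))) - 1)
     * ((\<delta> * p ^ 9 - hom_error \<delta> p) / (1 + ln (ln (1 / p)) powr (-1/2))) / upper_tail_rate \<delta> p ^ 3"
    using order_tendstoD(1)[OF lower_bound_ratio_tendsto[OF assms(1)]] by blast
  \<comment> \<open>This gives L - l \<ge> (9/10) L and hence H \<le> (10/9) R / L. As l > 8 gives S
    \<le> R / (2 L), the sum is at most 2 R / L.\<close>
  have e1: "\<forall>\<^sub>F p::real in at_right 0. ln (1 / p) / 2 \<ge> 5 * ln (ln (1 / p))"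
    by real_asymp
  have e2: "\<forall>\<^sub>F p::real in at_right 0. ln (ln (1 / p) powr (2/3) / ln (ln (1 / p))) - 1 \<ge> ln (ln (1 / p)) / 2"
    by real_asymp
  have e3: "\<forall>\<^sub>F p::real in at_right 0. ln (ln (1 / p)) > 8"
    using filterlim_at_top_dense[THEN iffD1, OF filterlim_ln_ln_inverse] by blast
  show ?thesis
    using ratio e1 e2 e3 eventually_at_right_less[of 0]
  proof eventually_elim
    case (elim p)
    define L l R \<tau> N where "L = ln (1 / p)" and "l = ln L" and "R = upper_tail_rate \<delta> p" and "\<tau> = l powr (-1/2)"
      and "N = ln (L powr (2/3) / l) - 1"
    have p: "p > 0" and l: "l > 8" and L: "L / 2 \<ge> 5 * l" and N: "N \<ge> l / 2"
      using elim by (simp_all add: L_def l_def N_def)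
    have L0: "L > 0" using l L by simp
    have R3: "R ^ 3 = 18 * \<delta> * p ^ 9 * L\<^sup>2 * l"
      unfolding R_def L_def l_def
      by (rule upper_tail_rate_power3) (use assms L0 l in \<open>simp_all flip: L_def l_def\<close>)
    have "R > 0" unfolding R_def upper_tail_rate_def L_def[symmetric] l_def[symmetric]
      using assms p L0 l by (intro mult_pos_pos) auto
    have \<tau>: "\<tau> > 0" using l by (simp add: \<tau>_def)
    show ?case
    proof (intro allI impI, fold L_def, fold l_def, fold R_def \<tau>_def N_def)
      fix H S Y I :: real
      assume nn: "0 \<le> H" "0 \<le> S" "0 \<le> Y" and I1: "(L - l) * H + N * Y \<le> I" and I2: "L * l / 4 * S \<le> I"
        and hom: "(1 + \<delta>) * p ^ 9 \<le> p ^ 9 + 48 * p ^ 6 * (H + S) + 71 * p ^ 3 * (H + S)\<^sup>2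
          + 4 * p ^ 3 * (L powr (2/3) / l) * (H + S)\<^sup>2 + H * l * (H + S)\<^sup>2
          + (1 + \<tau>) * (p ^ 3 * (H + S)\<^sup>2 + Y * ((H + (H * l)\<^sup>2 / p ^ 3) / 2)\<^sup>2) + (1 + 1 / \<tau>) * (4 * S * (H + S) * Y)"
      show "(1 - \<epsilon>) * R \<le> I"
      proof (rule ccontr)
        assume "\<not> (1 - \<epsilon>) * R \<le> I"
        then have IR: "I < (1 - \<epsilon>) * R" by simp
        have "(1 - \<epsilon>) * R \<le> R" using \<open>R > 0\<close> assms by simp
        with IR have "I \<le> R" by simp
        define X where "X = 2 * R / L"
        have X0: "X > 0" using \<open>R > 0\<close> L0 by (simp add: X_def)
        have Sle: "S \<le> 4 * R / (L * l)"
        proof -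
          have "L * l / 4 * S \<le> R" using I2 \<open>I \<le> R\<close> by simp
          then show ?thesis using L0 l by (simp add: field_simps)
        qed
        have N0: "N \<ge> 0" using N l by simp
        have "(L - l) * H \<le> R" using I1 \<open>I \<le> R\<close> nn mult_nonneg_nonneg[OF N0 nn(3)] by linarith
        moreover have "9 / 10 * L * H \<le> (L - l) * H" using L nn by (intro mult_right_mono) auto
        ultimately have Hle: "H \<le> 10/9 * R / L" using L0 by (simp add: field_simps)
        have HS: "H + S \<le> X"
        proof -
          have "4 * R / (L * l) \<le> 4 * R / (L * 8)"
            using L0 l \<open>R > 0\<close> by (intro divide_left_mono mult_left_mono) auto
          with Sle Hle have "H + S \<le> 10/9 * R / L + 4 * R / (L * 8)" by simp
          also have "\<dots> \<le> X" unfolding X_def using L0 \<open>R > 0\<close> by (simp add: field_simps)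
          finally show ?thesis .
        qed
        have Yle: "Y \<le> 2 * R / l"
        proof -
          have "l / 2 * Y \<le> N * Y" using N nn by (intro mult_right_mono) auto
          also have "\<dots> \<le> R"
            using I1 \<open>I \<le> R\<close> L L0 l mult_nonneg_nonneg[OF _ nn(1), of "L - l"] by linarith
          finally show ?thesis using l by (simp add: field_simps)
        qed
        have HX: "H \<le> X" using HS nn by simp
        define Z where "Z = (X * l)\<^sup>2 / p ^ 3"
        have Z0: "Z \<ge> 0" using p by (simp add: Z_def)
        have sq: "(H + S)\<^sup>2 \<le> X\<^sup>2" using HS nn by (intro power_mono) auto
        have K0: "L powr (2/3) / l \<ge> 0" using l by simp
        have "Y * ((H + (H * l)\<^sup>2 / p ^ 3) / 2)\<^sup>2 \<le> Y * ((H + Z) / 2)\<^sup>2"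
          unfolding Z_def using nn HX l p
          by (intro mult_left_mono power_mono divide_right_mono add_mono mult_right_mono order_refl) auto
        also have "\<dots> = Y * H\<^sup>2 / 4 + Y * ((2 * H * Z + Z\<^sup>2) / 4)"
          by (simp add: power2_eq_square field_simps)
        also have "Y * ((2 * H * Z + Z\<^sup>2) / 4) \<le> 2 * R / l * ((2 * X * Z + Z\<^sup>2) / 4)"
          using Yle HX nn Z0 \<open>R > 0\<close> l
          by (intro mult_mono divide_right_mono add_mono mult_right_mono mult_left_mono order_refl) auto
        finally have "(1 + \<tau>) * (p ^ 3 * (H + S)\<^sup>2 + Y * ((H + (H * l)\<^sup>2 / p ^ 3) / 2)\<^sup>2)
           \<le> (1 + \<tau>) * (p ^ 3 * X\<^sup>2 + (Y * H\<^sup>2 / 4 + 2 * R / l * ((2 * X * Z + Z\<^sup>2) / 4)))"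
          using \<tau> p sq by (intro mult_left_mono add_mono) auto
        moreover have "(1 + 1 / \<tau>) * (4 * S * (H + S) * Y) \<le> (1 + 1 / \<tau>) * (4 * (4 * R / (L * l)) * X * (2 * R / l))"
          using \<tau> Sle HS Yle nn X0 \<open>R > 0\<close> L0 l by (intro mult_left_mono mult_mono) auto
        moreover have "48 * p ^ 6 * (H + S) \<le> 48 * p ^ 6 * X" using HS p by simp
        moreover have "71 * p ^ 3 * (H + S)\<^sup>2 \<le> 71 * p ^ 3 * X\<^sup>2" using sq p by simp
        moreover have "4 * p ^ 3 * (L powr (2/3) / l) * (H + S)\<^sup>2 \<le> 4 * p ^ 3 * (L powr (2/3) / l) * X\<^sup>2"
          using sq p K0 by (intro mult_left_mono mult_nonneg_nonneg) auto
        moreover have "H * l * (H + S)\<^sup>2 \<le> X * l * X\<^sup>2"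
          using sq HX l nn X0 by (intro mult_mono) auto
        moreover have "hom_error \<delta> p = 48 * p ^ 6 * X + 71 * p ^ 3 * X\<^sup>2 + 4 * p ^ 3 * (L powr (2/3) / l) * X\<^sup>2 + X * l * X\<^sup>2
          + (1 + \<tau>) * (p ^ 3 * X\<^sup>2 + 2 * R / l * ((2 * X * Z + Z\<^sup>2) / 4))
          + (1 + 1 / \<tau>) * (4 * (4 * R / (L * l)) * X * (2 * R / l))"
          by (simp add: hom_error_def Let_def X_def Z_def L_def l_def R_def \<tau>_def)
        moreover have "(1 + \<tau>) * (p ^ 3 * X\<^sup>2 + (Y * H\<^sup>2 / 4 + 2 * R / l * ((2 * X * Z + Z\<^sup>2) / 4)))
          = (1 + \<tau>) * (p ^ 3 * X\<^sup>2 + 2 * R / l * ((2 * X * Z + Z\<^sup>2) / 4)) + (1 + \<tau>) * (Y * H\<^sup>2 / 4)"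
          by (subst distrib_left[symmetric]) (simp only: add_ac)
        moreover have "(1 + \<delta>) * p ^ 9 = p ^ 9 + \<delta> * p ^ 9"
          by (simp add: distrib_right)
        ultimately have "\<delta> * p ^ 9 - hom_error \<delta> p \<le> (1 + \<tau>) * (Y * H\<^sup>2 / 4)"
          using hom by linarith
        then have D: "(\<delta> * p ^ 9 - hom_error \<delta> p) / (1 + \<tau>) \<le> Y * H\<^sup>2 / 4"
          using \<tau> by (simp add: divide_le_eq mult.commute)
        have "27 * (L - l)\<^sup>2 * N * ((\<delta> * p ^ 9 - hom_error \<delta> p) / (1 + \<tau>)) \<le> 27 * (L - l)\<^sup>2 * N * (Y * H\<^sup>2 / 4)"
          using D N0 by (intro mult_left_mono) auto
        also have "\<dots> = 27 * ((L - l) * H)\<^sup>2 * (N * Y) / 4"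
          by (simp add: power_mult_distrib)
        also have "\<dots> \<le> ((L - l) * H + N * Y) ^ 3"
          using L L0 l nn N0 by (intro power3_AM_GM mult_nonneg_nonneg) auto
        also have "\<dots> \<le> I ^ 3"
          using I1 L L0 l nn N0 by (intro power_mono add_nonneg_nonneg mult_nonneg_nonneg) auto
        also have "\<dots> < ((1 - \<epsilon>) * R) ^ 3"
        proof (rule power_strict_mono[OF IR])
          have "0 \<le> L * l / 4 * S" using L0 l nn by simp
          then show "0 \<le> I" using I2 by linarith
        qed simp
        finally have "27 * (L - l)\<^sup>2 * N * ((\<delta> * p ^ 9 - hom_error \<delta> p) / (1 + \<tau>)) / R ^ 3 < (1 - \<epsilon>) ^ 3"
          by (subst pos_divide_less_eq) (simp_all only: power_mult_distrib zero_less_power \<open>R > 0\<close>)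
        moreover have "(1 - \<epsilon>) ^ 3 < 27 * (L - l)\<^sup>2 * N * ((\<delta> * p ^ 9 - hom_error \<delta> p) / (1 + \<tau>)) / R ^ 3"
          using elim(1) unfolding L_def l_def N_def R_def \<tau>_def .
        ultimately show False by simp
      qed
    qed
  qed
qed

text \<open>This is \<open>unit_interval\<close> as a measure on the whole line, and \<open>clamped W\<close> below is an extension of the
  graphon \<open>W\<close> to the plane, so that pointwise bounds need not be relativised to the unit square.\<close>

definition unit_space :: "real measure" where
  "unit_space = distr unit_interval borel (\<lambda>x. x)"

definition clamp01 :: "real \<Rightarrow> real" where
  "clamp01 x = max 0 (min 1 x)"

lemma clamp01_id: "x \<in> {0..1} \<Longrightarrow> clamp01 x = x"
  by (simp add: clamp01_def)

lemma clamp01_range: "clamp01 x \<in> {0..1}"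
  by (simp add: clamp01_def)

lemma prob_space_unit_interval: "prob_space unit_interval"
  by (rule prob_spaceI) (simp add: emeasure_restrict_space space_restrict_space)

lemma measurable_id_unit_interval: "(\<lambda>x. x) \<in> unit_interval \<rightarrow>\<^sub>M borel"
  by (rule measurable_restrict_space1) simp

interpretation unit: full_prob_space unit_space
proof -
  interpret prob_space unit_interval by (rule prob_space_unit_interval)
  show "full_prob_space unit_space"
    unfolding full_prob_space_def full_prob_space_axioms_def unit_space_def
    using prob_space_distr[OF measurable_id_unit_interval] by simp
qed

lemma sets_unit_space [measurable_cong]: "sets unit_space = sets borel"
  by (simp add: unit_space_def)

lemma clamp01_measurable: "clamp01 \<in> unit_space \<rightarrow>\<^sub>M unit_interval"
  unfolding measurable_cong_sets[OF sets_unit_space refl]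
proof (rule measurable_restrict_space2)
  show "clamp01 \<in> borel \<rightarrow>\<^sub>M lborel"
    unfolding clamp01_def[abs_def] by measurable
qed (use clamp01_range in auto)

lemma integral_unit_interval:
  fixes f :: "real \<Rightarrow> real"
  assumes "f \<in> borel_measurable unit_space"
  shows "(LINT x|unit_interval. f x) = (LINT x|unit_space. f x)"
  unfolding unit_space_def
  by (subst integral_distr) (use assms measurable_id_unit_interval in \<open>simp_all cong: measurable_cong_sets add: sets_unit_space\<close>)

lemma unit_interval_pair: "unit_space \<Otimes>\<^sub>M unit_space = distr (unit_interval \<Otimes>\<^sub>M unit_interval) (borel \<Otimes>\<^sub>M borel) (\<lambda>z. z)"
proof -
  interpret prob_space unit_interval by (rule prob_space_unit_interval)
  have "sigma_finite_measure (distr unit_interval borel (\<lambda>x. x))"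
    using unit.sigma_finite_measure_axioms by (simp add: unit_space_def)
  from pair_measure_distr[OF measurable_id_unit_interval measurable_id_unit_interval this]
  show ?thesis by (simp add: unit_space_def case_prod_beta id_def)
qed

text \<open>The map \<open>compose I (\<lambda>x. x)\<close> is the identity on the points of the
  product. It makes the product over the unit interval a product of measures on the line.\<close>

lemma PiM_unit_space:
  assumes "finite I"
  shows "PiM I (\<lambda>_. unit_space) = distr (PiM I (\<lambda>_. unit_interval)) (PiM I (\<lambda>_. unit_space)) (compose I (\<lambda>x. x))"
proof -
  have m: "(\<lambda>x. x) \<in> unit_interval \<rightarrow>\<^sub>M unit_space"
    using measurable_id_unit_interval by (simp add: measurable_cong_sets[OF refl sets_unit_space])
  have "distr unit_interval unit_space (\<lambda>x. x) = unit_space"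
    unfolding unit_space_def by (intro distr_cong) auto
  then show ?thesis
    using distr_PiM_finite_prob_space'[of I "\<lambda>_. unit_interval" "\<lambda>_. unit_space" "\<lambda>x. x"]
      assms prob_space_unit_interval unit.prob_space_axioms m by simp
qed

definition clamped :: "(real \<Rightarrow> real \<Rightarrow> real) \<Rightarrow> real \<Rightarrow> real \<Rightarrow> real" where
  "clamped W x y = W (clamp01 x) (clamp01 y)"

section \<open>Homomorphism density and entropy as iterated integrals\<close>

lemma verts_K0: "verts K0 = {0..5}"
  by (simp add: K0_def)

lemma edges_K0: "edges K0 = {{0, 2}, {0, 3}, {0, 4}, {0, 5}, {1, 2}, {1, 3}, {1, 4}, {1, 5}, {2, 3}}"
proof -
  have *: "{{a, b} |a b. a \<in> A \<and> b \<in> B} = (\<Union>a\<in>A. (\<lambda>b. {a, b}) ` B)" for A B :: "nat set"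
    by blast
  show ?thesis
    unfolding K0_def graph.sel * by (simp add: insert_commute)
qed

lemma edge_prod_K0: "edge_prod K0 W x =
    (W (x 0) (x 2) * W (x 1) (x 2)) * (W (x 0) (x 3) * W (x 1) (x 3)) * W (x 2) (x 3)
    * (W (x 0) (x 4) * W (x 1) (x 4)) * (W (x 0) (x 5) * W (x 1) (x 5))"
  unfolding edge_prod_def edges_K0
  by (simp add: doubleton_eq_iff eval_nat_numeral)

lemma clamped_cong: "x \<in> {0..1} \<Longrightarrow> y \<in> {0..1} \<Longrightarrow> clamped W x y = W x y"
  by (simp add: clamped_def clamp01_id)

lemma clamped_measurable:
  assumes "graphon W"
  shows "(\<lambda>z. clamped W (fst z) (snd z)) \<in> borel_measurable (unit_space \<Otimes>\<^sub>M unit_space)"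
proof -
  have [measurable]: "(\<lambda>(x, y). W x y) \<in> borel_measurable (unit_interval \<Otimes>\<^sub>M unit_interval)"
    using assms by (simp add: graphon_def)
  have [measurable]: "clamp01 \<in> unit_space \<rightarrow>\<^sub>M unit_interval"
    by (rule clamp01_measurable)
  have "(\<lambda>z. (\<lambda>(x, y). W x y) (clamp01 (fst z), clamp01 (snd z))) \<in> borel_measurable (unit_space \<Otimes>\<^sub>M unit_space)"
    by measurable
  then show ?thesis by (simp add: clamped_def)
qed

lemma clamped_bounds:
  assumes "graphon W"
  shows "0 \<le> clamped W x y" "clamped W x y \<le> 1" "clamped W x y = clamped W y x"
  using assms clamp01_range unfolding graphon_def clamped_def by blast+

lemma kernel_clamped:
  assumes "graphon W"
  shows "kernel unit_space (clamped W)"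
  by (rule bounded_measurableI[OF clamped_measurable[OF assms], of 1]) (use clamped_bounds[OF assms] in auto)

lemma space_unit_interval: "space unit_interval = {0..1}"
  by (simp add: space_restrict_space)

lemma regular_graphon_clamped:
  assumes "regular_graphon p W"
  shows "(LINT y|unit_space. clamped W x y) = p"
proof -
  have g: "graphon W" using assms by (simp add: regular_graphon_def)
  have "(LINT y|unit_space. clamped W x y) = (LINT y|unit_interval. clamped W x y)"
    by (rule integral_unit_interval[symmetric])
      (use kernel_compose[OF kernel_clamped[OF g], of "\<lambda>_. x" unit_space "\<lambda>y. y"] in
        \<open>simp add: bounded_measurable_def unit.const_measurable\<close>)
  also have "\<dots> = (LINT y|unit_interval. W (clamp01 x) y)"
    by (intro Bochner_Integration.integral_cong) (auto simp: space_unit_interval clamped_def clamp01_id)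
  also have "\<dots> = p"
    using assms clamp01_range by (simp add: regular_graphon_def)
  finally show ?thesis .
qed

lemma rel_entropy_le:
  assumes p: "0 < p" "p < 1" and w: "0 \<le> w" "w \<le> 1"
  shows "rel_entropy p w \<le> w * ln (1 / p) + (1 - w) * ln (1 / (1 - p))"
proof -
  have "w * ln (w / p) \<le> w * ln (1 / p)"
    using p w by (cases "w = 0") (auto intro!: mult_left_mono ln_mono divide_right_mono)
  moreover have "(1 - w) * ln ((1 - w) / (1 - p)) \<le> (1 - w) * ln (1 / (1 - p))"
    using p w by (cases "w = 1") (auto intro!: mult_left_mono ln_mono divide_right_mono)
  ultimately show ?thesis by (simp add: rel_entropy_def)
qed

lemma kernel_rel_entropy:
  assumes "graphon W" "0 < p" "p < 1"
  shows "kernel unit_space (\<lambda>x y. rel_entropy p (clamped W x y))"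
proof (rule bounded_measurableI)
  note [measurable] = clamped_measurable[OF assms(1)]
  show "(\<lambda>z. rel_entropy p (clamped W (fst z) (snd z))) \<in> borel_measurable (unit_space \<Otimes>\<^sub>M unit_space)"
    unfolding rel_entropy_def by measurable
  show "\<bar>rel_entropy p (clamped W (fst z) (snd z))\<bar> \<le> ln (1 / p) + ln (1 / (1 - p))" for z
  proof -
    note b = assms(2,3) clamped_bounds(1,2)[OF assms(1)]
    have "rel_entropy p (clamped W (fst z) (snd z)) \<le> 1 * ln (1 / p) + 1 * ln (1 / (1 - p))"
      by (rule order_trans[OF rel_entropy_le[OF b] add_mono]; rule mult_right_mono)
        (use b in \<open>auto simp: ln_div\<close>)
    with rel_entropy_nonneg[OF b] show ?thesis by simp
  qed
qed

lemma graphon_entropy_eq: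
  assumes "graphon W" "0 < p" "p < 1"
  shows "graphon_entropy p W = (LINT x|unit_space. LINT y|unit_space. rel_entropy p (clamped W x y))"
proof -
  let ?f = "\<lambda>z. rel_entropy p (clamped W (fst z) (snd z))"
  note k = kernel_rel_entropy[OF assms]
  have "graphon_entropy p W = integral\<^sup>L (unit_interval \<Otimes>\<^sub>M unit_interval) ?f"
    unfolding graphon_entropy_def
    by (intro Bochner_Integration.integral_cong) (auto simp: space_pair_measure space_unit_interval clamped_cong)
  also have "\<dots> = integral\<^sup>L (unit_space \<Otimes>\<^sub>M unit_space) ?f"
    unfolding unit_interval_pair
  proof (rule integral_distr[symmetric])
    have "fst \<in> unit_interval \<Otimes>\<^sub>M unit_interval \<rightarrow>\<^sub>M (borel :: real measure)"
      "snd \<in> unit_interval \<Otimes>\<^sub>M unit_interval \<rightarrow>\<^sub>M (borel :: real measure)"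
      by (rule measurable_compose[OF measurable_fst measurable_id_unit_interval]
        measurable_compose[OF measurable_snd measurable_id_unit_interval])+
    then have "(\<lambda>z. (fst z, snd z)) \<in> unit_interval \<Otimes>\<^sub>M unit_interval \<rightarrow>\<^sub>M (borel :: real measure) \<Otimes>\<^sub>M (borel :: real measure)"
      by (rule measurable_Pair)
    then show "(\<lambda>z. z) \<in> unit_interval \<Otimes>\<^sub>M unit_interval \<rightarrow>\<^sub>M (borel :: real measure) \<Otimes>\<^sub>M (borel :: real measure)"
      by simp
    show "?f \<in> borel_measurable (borel \<Otimes>\<^sub>M borel)"
      using k unfolding bounded_measurable_def
        measurable_cong_sets[OF sets_pair_measure_cong[OF sets_unit_space sets_unit_space] refl]
      by blast
  qed
  also have "\<dots> = (LINT x|unit_space. LINT y|unit_space. ?f (x, y))"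
  proof (rule unit.MM.integral_fst'[symmetric])
    interpret P: finite_measure "unit_space \<Otimes>\<^sub>M unit_space"
      by (rule finite_measure_pair_measure) unfold_locales
    obtain B where "?f \<in> borel_measurable (unit_space \<Otimes>\<^sub>M unit_space)" "\<And>z. \<bar>?f z\<bar> \<le> B"
      using k unfolding bounded_measurable_def by blast
    then show "integrable (unit_space \<Otimes>\<^sub>M unit_space) ?f"
      by (intro P.integrable_const_bound[of _ B]) auto
  qed
  finally show ?thesis by simp
qed

lemma prob_space_PiM_unit_space: "prob_space (PiM I (\<lambda>_. unit_space))"
  by (intro prob_space_PiM) unfold_locales

lemma integral_PiM_insert:
  fixes f :: "('i \<Rightarrow> real) \<Rightarrow> real"
  assumes "finite I" "i \<notin> I" "bounded_measurable (PiM (insert i I) (\<lambda>_. unit_space)) f"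
  shows "(LINT x|PiM (insert i I) (\<lambda>_. unit_space). f x)
    = (LINT x|PiM I (\<lambda>_. unit_space). LINT y|unit_space. f (x(i := y)))"
proof -
  interpret product_sigma_finite "\<lambda>_. unit_space" ..
  interpret P: prob_space "PiM (insert i I) (\<lambda>_. unit_space)" by (rule prob_space_PiM_unit_space)
  obtain B where "f \<in> borel_measurable (PiM (insert i I) (\<lambda>_. unit_space))" "\<And>x. \<bar>f x\<bar> \<le> B"
    using assms(3) by (auto simp: bounded_measurable_def)
  then have "integrable (PiM (insert i I) (\<lambda>_. unit_space)) f"
    by (intro P.integrable_const_bound[of _ B]) auto
  with assms(1,2) show ?thesis
    by (rule product_integral_insert)
qed

lemma measurable_component_unit_space: "i \<in> I \<Longrightarrow> (\<lambda>x. x i) \<in> PiM I (\<lambda>_. unit_space) \<rightarrow>\<^sub>M unit_space"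
  by (rule measurable_component_singleton)

lemma Hom_clamped:
  assumes "graphon W" "finite (verts K)" "\<And>e. e \<in> edges K \<Longrightarrow> finite e \<and> e \<noteq> {} \<and> e \<subseteq> verts K"
  shows "Hom K W = (LINT x|PiM (verts K) (\<lambda>_. unit_space). edge_prod K (clamped W) x)"
proof -
  have e: "Min e \<in> verts K" "Max e \<in> verts K" if "e \<in> edges K" for e
  proof -
    have *: "finite e" "e \<noteq> {}" "e \<subseteq> verts K" using assms(3)[OF that] by simp_all
    show "Min e \<in> verts K" by (rule subsetD[OF *(3) Min_in[OF *(1,2)]])
    show "Max e \<in> verts K" by (rule subsetD[OF *(3) Max_in[OF *(1,2)]])
  qed
  have "Hom K W = (LINT x|PiM (verts K) (\<lambda>_. unit_interval). edge_prod K (clamped W) (compose (verts K) (\<lambda>x. x) x))"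
    unfolding Hom_def
  proof (rule Bochner_Integration.integral_cong[OF refl])
    fix x assume "x \<in> space (PiM (verts K) (\<lambda>_. unit_interval))"
    then have "x \<in> verts K \<rightarrow>\<^sub>E {0..1}"
      by (simp only: space_PiM space_unit_interval)
    then have x: "x i \<in> {0..1}" if "i \<in> verts K" for i
      using that by (rule PiE_mem)
    show "edge_prod K W x = edge_prod K (clamped W) (compose (verts K) (\<lambda>x. x) x)"
      unfolding edge_prod_def
    proof (rule prod.cong[OF refl])
      fix d assume "d \<in> edges K"
      then show "W (x (Min d)) (x (Max d)) = clamped W (compose (verts K) (\<lambda>x. x) x (Min d)) (compose (verts K) (\<lambda>x. x) x (Max d))"
        using e[of d] x[of "Min d"] x[of "Max d"] clamped_cong[of "x (Min d)" "x (Max d)" W]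
        by (simp add: compose_def)
    qed
  qed
  also have "\<dots> = (LINT x|distr (PiM (verts K) (\<lambda>_. unit_interval)) (PiM (verts K) (\<lambda>_. unit_space)) (compose (verts K) (\<lambda>x. x)).
      edge_prod K (clamped W) x)"
  proof (rule integral_distr[symmetric])
    show "compose (verts K) (\<lambda>x. x) \<in> PiM (verts K) (\<lambda>_. unit_interval) \<rightarrow>\<^sub>M PiM (verts K) (\<lambda>_. unit_space)"
      unfolding compose_def
    proof (rule measurable_restrict)
      fix i assume "i \<in> verts K"
      then have "(\<lambda>x. x i) \<in> PiM (verts K) (\<lambda>_. unit_interval) \<rightarrow>\<^sub>M unit_interval"
        by (rule measurable_component_singleton)
      from measurable_compose[OF this measurable_id_unit_interval]
      show "(\<lambda>x. x i) \<in> PiM (verts K) (\<lambda>_. unit_interval) \<rightarrow>\<^sub>M unit_space"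
        by (simp add: measurable_cong_sets[OF refl sets_unit_space])
    qed
    have "(\<lambda>x. clamped W (x (Min e)) (x (Max e))) \<in> borel_measurable (PiM (verts K) (\<lambda>_. unit_space))"
      if "e \<in> edges K" for e
      using kernel_compose[OF kernel_clamped[OF assms(1)] measurable_component_unit_space measurable_component_unit_space, OF e[OF that]]
      by (simp add: bounded_measurable_def)
    then show "edge_prod K (clamped W) \<in> borel_measurable (PiM (verts K) (\<lambda>_. unit_space))"
      unfolding edge_prod_def[abs_def] by (rule borel_measurable_prod)
  qed
  finally show ?thesis
    unfolding PiM_unit_space[OF assms(2), symmetric] .
qed

text \<open>The vertices are integrated out from 5 down to 1. Given the images of 0 and 1, the
  vertices 4 and 5 contribute a codegree each, and 2 and 3 together a kite.\<close>

lemma Hom_K0_eq: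
  assumes "graphon W"
  defines "V \<equiv> clamped W"
  shows "Hom K0 W = (LINT x|unit_space. LINT y|unit_space. (unit.codeg V x y)\<^sup>2 * unit.kite V V x y)"
proof -
  have Vk: "kernel unit_space V" unfolding V_def by (rule kernel_clamped) fact
  note bm = unit.kernel_intros kernel_compose[OF Vk] measurable_component_unit_space
  define g where "g x0 x1 x2 x3 = (V x0 x2 * V x1 x2) * (V x0 x3 * V x1 x3) * V x2 x3" for x0 x1 x2 x3
  have "Hom K0 W = (LINT x|PiM {0..5::nat} (\<lambda>_. unit_space). edge_prod K0 V x)"
    unfolding V_def by (subst Hom_clamped[OF assms(1)]) (auto simp: verts_K0 edges_K0)
  also have "\<dots> = (LINT x|PiM (insert 5 {0..4::nat}) (\<lambda>_. unit_space).
      g (x 0) (x 1) (x 2) (x 3) * (V (x 0) (x 4) * V (x 1) (x 4)) * (V (x 0) (x 5) * V (x 1) (x 5)))"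
    unfolding edge_prod_K0 g_def by (intro arg_cong2[where f = "integral\<^sup>L"] arg_cong2[where f = PiM]) auto
  also have "\<dots> = (LINT x|PiM {0..4::nat} (\<lambda>_. unit_space).
      g (x 0) (x 1) (x 2) (x 3) * (V (x 0) (x 4) * V (x 1) (x 4)) * unit.codeg V (x 0) (x 1))"
    unfolding g_def by (subst integral_PiM_insert; (intro bm)?; simp add: unit.codeg_def)
  also have "\<dots> = (LINT x|PiM (insert 4 {0..3::nat}) (\<lambda>_. unit_space).
      (g (x 0) (x 1) (x 2) (x 3) * unit.codeg V (x 0) (x 1)) * (V (x 0) (x 4) * V (x 1) (x 4)))"
    by (intro arg_cong2[where f = "integral\<^sup>L"] arg_cong2[where f = PiM]) auto
  also have "\<dots> = (LINT x|PiM {0..3::nat} (\<lambda>_. unit_space).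
      (g (x 0) (x 1) (x 2) (x 3) * unit.codeg V (x 0) (x 1)) * unit.codeg V (x 0) (x 1))"
    unfolding g_def by (subst integral_PiM_insert; (intro bm)?; simp add: unit.codeg_def)
  also have "\<dots> = (LINT x|PiM (insert 3 {0..2::nat}) (\<lambda>_. unit_space).
      (unit.codeg V (x 0) (x 1))\<^sup>2 * ((V (x 0) (x 2) * V (x 1) (x 2)) * (V (x 0) (x 3) * V (x 1) (x 3)) * V (x 2) (x 3)))"
    unfolding g_def by (intro arg_cong2[where f = "integral\<^sup>L"] arg_cong2[where f = PiM]) (auto simp: power2_eq_square)
  also have "\<dots> = (LINT x|PiM {0..2::nat} (\<lambda>_. unit_space).
      (unit.codeg V (x 0) (x 1))\<^sup>2 * (LINT b|unit_space. (V (x 0) (x 2) * V (x 1) (x 2)) * (V (x 0) b * V (x 1) b) * V (x 2) b))"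
    by (subst integral_PiM_insert; (intro bm)?; simp)
  also have "\<dots> = (LINT x|PiM (insert 2 {0..1::nat}) (\<lambda>_. unit_space).
      (unit.codeg V (x 0) (x 1))\<^sup>2 * (LINT b|unit_space. (V (x 0) (x 2) * V (x 1) (x 2)) * (V (x 0) b * V (x 1) b) * V (x 2) b))"
    by (intro arg_cong2[where f = "integral\<^sup>L"] arg_cong2[where f = PiM]) auto
  also have "\<dots> = (LINT x|PiM {0..1::nat} (\<lambda>_. unit_space). (unit.codeg V (x 0) (x 1))\<^sup>2 * unit.kite V V (x 0) (x 1))"
    by (subst integral_PiM_insert; (intro bm)?; simp add: unit.kite_def)
  also have "\<dots> = (LINT x|PiM (insert 1 {0::nat}) (\<lambda>_. unit_space). (unit.codeg V (x 0) (x 1))\<^sup>2 * unit.kite V V (x 0) (x 1))"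
    by (intro arg_cong2[where f = "integral\<^sup>L"] arg_cong2[where f = PiM]) auto
  also have "\<dots> = (LINT x|PiM {0::nat} (\<lambda>_. unit_space). LINT y|unit_space. (unit.codeg V (x 0) y)\<^sup>2 * unit.kite V V (x 0) y)"
    by (subst integral_PiM_insert; (intro bm Vk)?; simp)
  also have "\<dots> = (LINT x|unit_space. LINT y|unit_space. (unit.codeg V x y)\<^sup>2 * unit.kite V V x y)"
  proof -
    interpret product_sigma_finite "\<lambda>_::nat. unit_space" ..
    have "bounded_measurable unit_space (\<lambda>x. LINT y|unit_space. (unit.codeg V x y)\<^sup>2 * unit.kite V V x y)"
      by (intro bm Vk)
    then show ?thesis
      by (intro product_integral_singleton) (simp add: bounded_measurable_def)
  qed
  finally show ?thesis .
qed

text \<open>Both preceding bounds are combined with \<eta> = 1 / l, K =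
  \<open>L powr (2/3) / l\<close> and \<tau> = \<open>l powr (-1/2)\<close>. Uniformity in
  \<open>W\<close> is what the infimum requires.\<close>

lemma eventually_graphon_entropy_ge:
  fixes \<delta> \<epsilon> :: real
  assumes "\<delta> > 0" "0 < \<epsilon>" "\<epsilon> < 1"
  shows "\<forall>\<^sub>F p in at_right 0. \<forall>W. regular_graphon p W \<longrightarrow> Hom K0 W \<ge> (1 + \<delta>) * p ^ 9 \<longrightarrow>
    (1 - \<epsilon>) * upper_tail_rate \<delta> p \<le> graphon_entropy p W"
proof -
  have e1: "\<forall>\<^sub>F p::real in at_right 0. ln (1 / p) \<ge> 4 \<and> ln (ln (1 / p)) > 0 \<and> p \<le> 1 / ln (ln (1 / p))
    \<and> 1 / ln (ln (1 / p)) * ln (1 / p) \<ge> 1 \<and> 3 * sqrt p * ln (1 / p) \<le> 2 * (1 / ln (ln (1 / p)))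
    \<and> ln (1 / p) powr (2/3) / ln (ln (1 / p)) \<ge> 1 \<and> p < 1"
    by (intro eventually_conj) real_asymp+
  show ?thesis
    using eventually_entropy_lower_bound[OF assms] e1 eventually_at_right_less[of 0]
  proof eventually_elim
    case (elim p)
    define L l where "L = ln (1 / p)" and "l = ln L"
    show ?case
    proof (intro allI impI)
      fix W assume W: "regular_graphon p W" and hom: "(1 + \<delta>) * p ^ 9 \<le> Hom K0 W"
      have g: "graphon W" using W by (simp add: regular_graphon_def)
      have p: "0 < p" "p < 1" using elim by auto
      have l: "l > 0" using elim by (simp add: L_def l_def)
      \<comment> \<open>The degree from which a vertex counts as a hub. It has to be small enough
        for \<rho>^2 (H + S)^2 to be o(p^9), and large enough for the hubs to be few, that is (H l /
        \<rho>)^2 = o(p^3 (l / L)^(1/3)). Only powers of L lie between the two requirements, and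
        \<rho>^2 = p^3 meets both.\<close>
      define \<rho> where "\<rho> = p * sqrt p"
      have \<rho>: "\<rho> > 0" "\<rho>\<^sup>2 = p ^ 3"
        using p by (simp_all add: \<rho>_def power_mult_distrib power3_eq_cube power2_eq_square)
      have \<tau>: "l powr (-1/2) > 0" using l by simp
      obtain H S Y where nn: "0 \<le> H" "0 \<le> S" "0 \<le> Y"
        and I: "(L - 1 / (1 / l)) * H + (ln (L powr (2/3) / l) - 1) * Y \<le> graphon_entropy p W"
          "L / (4 * (1 / l)) * S \<le> graphon_entropy p W"
        and hom': "Hom K0 W \<le> p ^ 9 + 48 * p ^ 6 * (H + S) + 71 * p ^ 3 * (H + S)\<^sup>2
       + 4 * p ^ 3 * (L powr (2/3) / l) * (H + S)\<^sup>2 + H / (1 / l) * (H + S)\<^sup>2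
       + (1 + l powr (-1/2)) * (\<rho>\<^sup>2 * (H + S)\<^sup>2 + Y * ((H + (H / (1 / l) / \<rho>)\<^sup>2) / 2)\<^sup>2)
       + (1 + 1 / (l powr (-1/2))) * (4 * S * (H + S) * Y)"
        using unit.entropy_and_hom_bounds[OF kernel_clamped[OF g] clamped_bounds(3,1,2)[OF g] regular_graphon_clamped[OF W]
            kernel_rel_entropy[OF g p] graphon_entropy_eq[OF g p, symmetric] p, of "L powr (2/3) / l" \<rho> "l powr (-1/2)" "1 / l"]
          elim \<rho>(1) \<tau> unfolding Hom_K0_eq[OF g] L_def[symmetric] l_def[symmetric] by auto
      have *: "(H / (1 / l) / \<rho>)\<^sup>2 = (H * l)\<^sup>2 / p ^ 3"
        using \<rho>(2) by (simp add: power_divide)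
      have "(1 + \<delta>) * p ^ 9 \<le> p ^ 9 + 48 * p ^ 6 * (H + S) + 71 * p ^ 3 * (H + S)\<^sup>2
       + 4 * p ^ 3 * (L powr (2/3) / l) * (H + S)\<^sup>2 + H * l * (H + S)\<^sup>2
       + (1 + l powr (-1/2)) * (p ^ 3 * (H + S)\<^sup>2 + Y * ((H + (H * l)\<^sup>2 / p ^ 3) / 2)\<^sup>2)
       + (1 + 1 / (l powr (-1/2))) * (4 * S * (H + S) * Y)"
        using hom hom' unfolding * \<rho>(2) by simp
      moreover have "(L - l) * H + (ln (L powr (2/3) / l) - 1) * Y \<le> graphon_entropy p W"
        "L * l / 4 * S \<le> graphon_entropy p W"
        using I by simp_all
      ultimately show "(1 - \<epsilon>) * upper_tail_rate \<delta> p \<le> graphon_entropy p W"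
        using elim(1)[unfolded L_def[symmetric] l_def[symmetric], rule_format, OF nn] by blast
    qed
  qed
qed

section \<open>Block graphons with three blocks\<close>

text \<open>The blocks are the hubs, their neighbours and the rest. The first two together have
  measure p, so that the rest has measure exactly 1 - p, as in condition 2. The last interval is
  closed to include 1.\<close>

definition part3 :: "real \<Rightarrow> real \<Rightarrow> nat \<Rightarrow> real set" where
  "part3 s p i = (if i = 1 then {0..<s} else if i = 2 then {s..<p} else {p..1})"

text \<open>Defined on the whole line by two comparisons, which makes block graphons Borel functions
  at once. It describes \<open>part3\<close> only for points of the unit interval.\<close>

definition index3 :: "real \<Rightarrow> real \<Rightarrow> real \<Rightarrow> nat" where
  "index3 s p x = (if x < s then 1 else if x < p then 2 else 3)"

definition size3 :: "real \<Rightarrow> real \<Rightarrow> nat \<Rightarrow> real" where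
  "size3 s p i = (if i = 1 then s else if i = 2 then p - s else 1 - p)"

definition block3 :: "real \<Rightarrow> real \<Rightarrow> (nat \<Rightarrow> nat \<Rightarrow> real) \<Rightarrow> real \<Rightarrow> real \<Rightarrow> real" where
  "block3 s p w x y = w (index3 s p x) (index3 s p y)"

lemma index_set3: "{1..3} = {1, 2, 3::nat}"
  by auto

lemma index3_range: "index3 s p x \<in> {1..3}"
  by (auto simp: index3_def)

context
  fixes s p :: real
  assumes sp: "0 \<le> s" "s \<le> p" "p \<le> 1"
begin

lemma measure_part3: "i \<in> {1..3} \<Longrightarrow> measure lborel (part3 s p i) = size3 s p i"
  using sp by (auto simp: part3_def size3_def)

lemma part3_subset: "part3 s p i \<subseteq> {0..1}"
  using sp by (auto simp: part3_def)

lemma part3_sets: "part3 s p i \<in> sets unit_interval"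
  using part3_subset[of i] by (auto simp: sets_restrict_space_iff part3_def)

lemma measure_unit_interval_part3: "i \<in> {1..3} \<Longrightarrow> measure unit_interval (part3 s p i) = size3 s p i"
  using measure_part3 part3_subset by (simp add: measure_restrict_space)

lemma mem_part3_iff: "x \<in> {0..1} \<Longrightarrow> i \<in> {1..3} \<Longrightarrow> x \<in> part3 s p i \<longleftrightarrow> index3 s p x = i"
  using sp by (auto simp: part3_def index3_def index_set3)

lemma index3_measurable: "(\<lambda>x. f (index3 s p x)) \<in> borel_measurable borel" for f :: "nat \<Rightarrow> real"
  unfolding index3_def if_distrib[of f] by measurable

lemma integral_index3:
  "(LINT x|unit_space. f (index3 s p (clamp01 x))) = (\<Sum>i\<in>{1..3}. size3 s p i * f i)"
  for f :: "nat \<Rightarrow> real"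
proof -
  interpret prob_space unit_interval by (rule prob_space_unit_interval)
  have "clamp01 \<in> borel_measurable borel"
    unfolding clamp01_def[abs_def] by measurable
  from measurable_compose[OF this index3_measurable]
  have "(LINT x|unit_space. f (index3 s p (clamp01 x))) = (LINT x|unit_interval. f (index3 s p (clamp01 x)))"
    by (intro integral_unit_interval[symmetric]) (simp add: measurable_cong_sets[OF sets_unit_space refl])
  also have "\<dots> = (LINT x|unit_interval. (\<Sum>i\<in>{1..3}. f i * indicator (part3 s p i) x))"
  proof (rule Bochner_Integration.integral_cong[OF refl])
    fix x assume "x \<in> space unit_interval"
    then have x: "x \<in> {0..1}" by (simp add: space_unit_interval)
    have "(\<Sum>i\<in>{1..3}. f i * indicator (part3 s p i) x) = (\<Sum>i\<in>{1..3}. if i = index3 s p x then f i else 0)"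
      by (intro sum.cong) (auto simp: mem_part3_iff[OF x] indicator_def)
    also have "\<dots> = f (index3 s p x)"
      using index3_range[of s p x] by simp
    finally show "f (index3 s p (clamp01 x)) = (\<Sum>i\<in>{1..3}. f i * indicator (part3 s p i) x)"
      by (simp add: clamp01_id[OF x])
  qed
  also have "\<dots> = (\<Sum>i\<in>{1..3}. f i * measure unit_interval (part3 s p i))"
    using part3_sets by (subst Bochner_Integration.integral_sum)
      (auto simp: emeasure_eq_measure Int_absorb2[OF part3_subset] intro!: integrable_mult_right integrable_real_indicator)
  also have "\<dots> = (\<Sum>i\<in>{1..3}. size3 s p i * f i)"
    by (intro sum.cong) (auto simp: measure_unit_interval_part3 mult.commute)
  finally show ?thesis .
qed

context
  fixes w :: "nat \<Rightarrow> nat \<Rightarrow> real"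
  assumes w: "\<And>i j. i \<in> {1..3} \<Longrightarrow> j \<in> {1..3} \<Longrightarrow> 0 \<le> w i j \<and> w i j \<le> 1 \<and> w i j = w j i"
begin

lemma graphon_block3: "graphon (block3 s p w)"
proof -
  have "(\<lambda>(x, y). block3 s p w x y) \<in> borel_measurable (borel \<Otimes>\<^sub>M borel)"
    unfolding block3_def index3_def case_prod_beta if_distrib[of w] if_distribR if_distrib[of "w _"] by measurable
  then have "(\<lambda>z. block3 s p w (fst z) (snd z)) \<in> borel_measurable (borel \<Otimes>\<^sub>M borel)"
    by (simp add: case_prod_beta)
  moreover have "(\<lambda>z. (fst z, snd z)) \<in> unit_interval \<Otimes>\<^sub>M unit_interval \<rightarrow>\<^sub>M (borel :: real measure) \<Otimes>\<^sub>M (borel :: real measure)"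
    by (rule measurable_Pair; rule measurable_compose[OF measurable_fst measurable_id_unit_interval]
        measurable_compose[OF measurable_snd measurable_id_unit_interval])
  ultimately have "(\<lambda>(x, y). block3 s p w x y) \<in> borel_measurable (unit_interval \<Otimes>\<^sub>M unit_interval)"
    using measurable_compose by (fastforce simp: case_prod_beta)
  then show ?thesis
    unfolding graphon_def block3_def using w index3_range by blast
qed

lemma block_graphon_block3: "block_graphon 3 (part3 s p) w (block3 s p w)"
  unfolding block_graphon_def
proof (intro conjI ballI graphon_block3)
  show "disjoint_family_on (part3 s p) {1..3}"
    using sp by (auto simp: disjoint_family_on_def part3_def)
  show "(\<Union>i\<in>{1..3}. part3 s p i) = {0..1}"
    using sp unfolding index_set3 by (auto simp: part3_def)
  show "is_interval (part3 s p i)" for i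
    by (auto simp: part3_def is_interval_co is_interval_cc)
  show "block3 s p w x y = w i j" if "i \<in> {1..3}" "j \<in> {1..3}" "x \<in> part3 s p i" "y \<in> part3 s p j" for i j x y
    using that mem_part3_iff part3_subset unfolding block3_def by blast
qed simp

lemma graphon_entropy_block3:
  assumes "0 < p" "p < 1"
  shows "graphon_entropy p (block3 s p w)
    = (\<Sum>i\<in>{1..3}. size3 s p i * (\<Sum>j\<in>{1..3}. size3 s p j * rel_entropy p (w i j)))"
proof -
  have "graphon_entropy p (block3 s p w) = (LINT x|unit_space. LINT y|unit_space.
      rel_entropy p (w (index3 s p (clamp01 x)) (index3 s p (clamp01 y))))"
    by (simp add: graphon_entropy_eq[OF graphon_block3 assms] clamped_def block3_def)
  also have "\<dots> = (LINT x|unit_space. (\<Sum>j\<in>{1..3}. size3 s p j * rel_entropy p (w (index3 s p (clamp01 x)) j)))"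
    by (simp only: integral_index3[of "\<lambda>j. rel_entropy p (w _ j)"])
  also have "\<dots> = (\<Sum>i\<in>{1..3}. size3 s p i * (\<Sum>j\<in>{1..3}. size3 s p j * rel_entropy p (w i j)))"
    by (rule integral_index3)
  finally show ?thesis .
qed

lemma regular_graphon_block3:
  assumes "\<And>i. i \<in> {1..3} \<Longrightarrow> (\<Sum>j\<in>{1..3}. size3 s p j * w i j) = d"
  shows "regular_graphon d (block3 s p w)"
  unfolding regular_graphon_def
proof (intro conjI ballI graphon_block3)
  fix x assume "x \<in> {0..1::real}"
  have "(\<lambda>y. w (index3 s p x) (index3 s p y)) \<in> borel_measurable borel"
    by (rule index3_measurable)
  have "(LINT y|unit_interval. block3 s p w x y) = (LINT y|unit_interval. w (index3 s p x) (index3 s p (clamp01 y)))"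
    by (intro Bochner_Integration.integral_cong) (auto simp: block3_def space_unit_interval clamp01_id)
  also have "\<dots> = (LINT y|unit_space. w (index3 s p x) (index3 s p (clamp01 y)))"
  proof (rule integral_unit_interval)
    have "clamp01 \<in> borel_measurable borel"
      unfolding clamp01_def[abs_def] by measurable
    from measurable_compose[OF this index3_measurable]
    show "(\<lambda>y. w (index3 s p x) (index3 s p (clamp01 y))) \<in> borel_measurable unit_space"
      by (simp add: measurable_cong_sets[OF sets_unit_space refl])
  qed
  also have "\<dots> = d"
    unfolding integral_index3 by (intro assms index3_range)
  finally show "(LINT y|unit_interval. block3 s p w x y) = d" .
qed

end

end

section \<open>Expansion over the assignments of vertices to blocks\<close>

definition block_weight :: "real \<Rightarrow> real \<Rightarrow> (nat \<Rightarrow> nat \<Rightarrow> real) \<Rightarrow> (nat \<Rightarrow> nat) \<Rightarrow> real" where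
  "block_weight s p w B = (\<Prod>v\<in>{0..5}. size3 s p (B v)) * (\<Prod>e\<in>edges K0. w (B (Min e)) (B (Max e)))"

lemma K0_edge_ends:
  assumes "e \<in> edges K0"
  shows "Min e \<in> {0..5}" "Max e \<in> {0..5}"
  using assms by (auto simp: edges_K0)

context
  fixes s p :: real and w :: "nat \<Rightarrow> nat \<Rightarrow> real"
  assumes sp: "0 \<le> s" "s \<le> p" "p \<le> 1"
begin

lemma Hom_block_block3:
  assumes "B \<in> {0..5} \<rightarrow> {1..3}"
  shows "Hom_block K0 (part3 s p) B (block3 s p w) = block_weight s p w B"
proof -
  interpret finite_product_prob_space "\<lambda>_. unit_interval" "{0..5::nat}"
    by unfold_locales (use prob_space_unit_interval in \<open>auto simp: prob_space_def finite_measure_def prob_space_axioms_def finite_measure_axioms_def sigma_finite_measure_def\<close>)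
  let ?A = "\<Pi>\<^sub>E v\<in>{0..5::nat}. part3 s p (B v)"
  let ?c = "\<Prod>e\<in>edges K0. w (B (Min e)) (B (Max e))"
  have A: "?A \<in> sets (PiM {0..5::nat} (\<lambda>_. unit_interval))"
    by (intro sets_PiM_I_finite part3_sets sp) auto
  have "Hom_block K0 (part3 s p) B (block3 s p w) = (LINT x|PiM {0..5::nat} (\<lambda>_. unit_interval). ?c * indicator ?A x)"
    unfolding Hom_block_def set_lebesgue_integral_def verts_K0
  proof (intro Bochner_Integration.integral_cong refl)
    fix x
    show "indicat_real ?A x *\<^sub>R edge_prod K0 (block3 s p w) x = ?c * indicator ?A x"
    proof (cases "x \<in> ?A")
      case True
      have ix: "index3 s p (x v) = B v" if "v \<in> {0..5}" for v
      proof -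
        have "x v \<in> part3 s p (B v)" using True that by (rule PiE_mem)
        moreover have "B v \<in> {1..3}" using assms that by (rule funcset_mem)
        ultimately show ?thesis using mem_part3_iff[OF sp] part3_subset[OF sp] by blast
      qed
      have "edge_prod K0 (block3 s p w) x = ?c"
        unfolding edge_prod_def block3_def
        by (intro prod.cong refl) (simp only: ix[OF K0_edge_ends(1)] ix[OF K0_edge_ends(2)])
      then show ?thesis using True by simp
    qed simp
  qed
  also have "\<dots> = ?c * measure (PiM {0..5::nat} (\<lambda>_. unit_interval)) ?A"
    using A by simp
  also have "measure (PiM {0..5::nat} (\<lambda>_. unit_interval)) ?A = (\<Prod>v\<in>{0..5}. size3 s p (B v))"
    using assms by (subst prob_times) (auto intro!: prod.cong part3_sets measure_unit_interval_part3 sp)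
  finally show ?thesis by (simp add: block_weight_def)
qed

text \<open>Every point of the cube determines the blocks of its six coordinates, and on the points
  with given blocks the product over the edges is constant. Extensional assignments are summed over,
  so that each is counted once.\<close>

lemma Hom_block3:
  assumes "\<And>i j. i \<in> {1..3} \<Longrightarrow> j \<in> {1..3} \<Longrightarrow> 0 \<le> w i j"
  shows "Hom K0 (block3 s p w) = (\<Sum>B\<in>{0..5} \<rightarrow>\<^sub>E {1..3}. block_weight s p w B)"
proof -
  interpret finite_product_prob_space "\<lambda>_. unit_interval" "{0..5::nat}"
    by unfold_locales (use prob_space_unit_interval in \<open>auto simp: prob_space_def finite_measure_def prob_space_axioms_def finite_measure_axioms_def sigma_finite_measure_def\<close>)
  let ?A = "\<lambda>B. \<Pi>\<^sub>E v\<in>{0..5::nat}. part3 s p (B v)"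
  let ?c = "\<lambda>B. \<Prod>e\<in>edges K0. w (B (Min e)) (B (Max e))"
  have A: "?A B \<in> sets (PiM {0..5::nat} (\<lambda>_. unit_interval))" for B
    by (intro sets_PiM_I_finite part3_sets sp) auto
  have "Hom K0 (block3 s p w) = (LINT x|PiM {0..5::nat} (\<lambda>_. unit_interval). (\<Sum>B\<in>{0..5} \<rightarrow>\<^sub>E {1..3}. ?c B * indicator (?A B) x))"
    unfolding Hom_def verts_K0
  proof (intro Bochner_Integration.integral_cong refl)
    fix x assume "x \<in> space (PiM {0..5::nat} (\<lambda>_::nat. unit_interval))"
    then have x: "x \<in> {0..5} \<rightarrow>\<^sub>E {0..1}" by (simp only: space_PiM space_unit_interval)
    define B0 where "B0 = restrict (\<lambda>v. index3 s p (x v)) {0..5}"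
    have B0: "B0 \<in> {0..5} \<rightarrow>\<^sub>E {1..3}" unfolding B0_def using index3_range by auto
    have "(\<Sum>B\<in>{0..5} \<rightarrow>\<^sub>E {1..3}. ?c B * indicator (?A B) x) = (\<Sum>B\<in>{0..5} \<rightarrow>\<^sub>E {1..3}. if B = B0 then ?c B else 0)"
    proof (rule sum.cong[OF refl])
      fix B assume B: "B \<in> {0..5::nat} \<rightarrow>\<^sub>E {1..3::nat}"
      have "x \<in> ?A B \<longleftrightarrow> (\<forall>v\<in>{0..5}. index3 s p (x v) = B v)"
      proof -
        have "x v \<in> part3 s p (B v) \<longleftrightarrow> index3 s p (x v) = B v" if "v \<in> {0..5}" for v
          using mem_part3_iff[OF sp] PiE_mem[OF x that] PiE_mem[OF B that] by blast
        then show ?thesis using x by (auto simp: PiE_iff)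
      qed
      also have "\<dots> \<longleftrightarrow> B = B0"
        using B B0 by (auto simp: B0_def fun_eq_iff PiE_iff extensional_def)
      finally show "?c B * indicator (?A B) x = (if B = B0 then ?c B else 0)"
        by (simp add: indicator_def)
    qed
    also have "\<dots> = ?c B0"
      using B0 by (simp add: finite_PiE)
    also have "\<dots> = edge_prod K0 (block3 s p w) x"
      unfolding edge_prod_def block3_def B0_def
      by (intro prod.cong refl) (simp only: restrict_apply' K0_edge_ends)
    finally show "edge_prod K0 (block3 s p w) x = (\<Sum>B\<in>{0..5} \<rightarrow>\<^sub>E {1..3}. ?c B * indicator (?A B) x)" by simp
  qed
  also have "\<dots> = (\<Sum>B\<in>{0..5} \<rightarrow>\<^sub>E {1..3}. ?c B * measure (PiM {0..5::nat} (\<lambda>_. unit_interval)) (?A B))"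
    using A by (subst Bochner_Integration.integral_sum) (auto simp: emeasure_eq_measure intro!: integrable_mult_right integrable_real_indicator)
  also have "\<dots> = (\<Sum>B\<in>{0..5} \<rightarrow>\<^sub>E {1..3}. block_weight s p w B)"
  proof (rule sum.cong[OF refl])
    fix B assume "B \<in> {0..5::nat} \<rightarrow>\<^sub>E {1..3::nat}"
    then have "measure (PiM {0..5::nat} (\<lambda>_. unit_interval)) (?A B) = (\<Prod>v\<in>{0..5}. size3 s p (B v))"
      by (subst prob_times) (auto intro!: prod.cong part3_sets measure_unit_interval_part3 sp)
    then show "?c B * measure (PiM {0..5::nat} (\<lambda>_. unit_interval)) (?A B) = block_weight s p w B"
      by (simp add: block_weight_def)
  qed
  finally show ?thesis .
qed

end

section \<open>The optimal block graphon\<close>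

text \<open>Both logarithms are bounded by ln u \<le> u - 1. This is efficient for the weights that
  differ from p by lower order only, whose entropy is quadratically small.\<close>

lemma rel_entropy_le_chi_square:
  assumes p: "0 < p" "p < 1" and w: "0 \<le> w" "w \<le> 1"
  shows "rel_entropy p w \<le> (w - p)\<^sup>2 / (p * (1 - p))"
proof -
  have ln_le: "t * ln (t / u) \<le> t * (t / u - 1)" if "t \<ge> 0" "u > 0" for t u :: real
    using that by (cases "t = 0") (auto intro!: mult_left_mono ln_le_minus_one)
  have "rel_entropy p w \<le> w * (w / p - 1) + (1 - w) * ((1 - w) / (1 - p) - 1)"
    unfolding rel_entropy_def using p w by (intro add_mono ln_le) auto
  also have "\<dots> = (w - p)\<^sup>2 / (p * (1 - p))"
    using p by (simp add: field_simps power2_eq_square)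
  finally show ?thesis .
qed

text \<open>Up to logarithmic factors, block \<open>i\<close> has measure \<open>p ^ vertex_exp i\<close> and the weight between the blocks
  \<open>i\<close> and \<open>j\<close> is at most \<open>p ^ edge_exp i j\<close>, in the block graphon defined below.\<close>

definition vertex_exp :: "nat \<Rightarrow> nat" where
  "vertex_exp i = (if i = 1 then 2 else if i = 2 then 1 else 0)"

definition edge_exp :: "nat \<Rightarrow> nat \<Rightarrow> nat" where
  "edge_exp i j = (if i = 1 \<and> j = 2 \<or> i = 2 \<and> j = 1 then 0 else 1)"

lemma atLeastAtMost_0_5: "{0..5} = {0, 1, 2, 3, 4, 5 :: nat}"
  by auto

text \<open>All 3^6 assignments are checked. The two excluded ones have exponent 9 and are those
  that matter: everything in the rest, and 0 and 1 in the hubs with the other vertices in their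
  neighbourhood. The sum is grouped by the vertices 2 to 5, each with its edges to 0 and 1.\<close>

lemma exponent_sum_explicit:
  assumes "b0 \<in> {1..3}" "b1 \<in> {1..3}" "b2 \<in> {1..3}" "b3 \<in> {1..3}" "b4 \<in> {1..3}" "b5 \<in> {1..3}"
    and "\<not> (b0 = 3 \<and> b1 = 3 \<and> b2 = 3 \<and> b3 = 3 \<and> b4 = 3 \<and> b5 = 3)"
    and "\<not> (b0 = 1 \<and> b1 = 1 \<and> b2 = 2 \<and> b3 = 2 \<and> b4 = 2 \<and> b5 = 2)"
  shows "10 \<le> vertex_exp b0 + vertex_exp b1 + edge_exp b2 b3
    + (vertex_exp b2 + edge_exp b0 b2 + edge_exp b1 b2) + (vertex_exp b3 + edge_exp b0 b3 + edge_exp b1 b3)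
    + (vertex_exp b4 + edge_exp b0 b4 + edge_exp b1 b4) + (vertex_exp b5 + edge_exp b0 b5 + edge_exp b1 b5)"
  using assms unfolding index_set3 by (elim insertE emptyE; simp add: vertex_exp_def edge_exp_def)

definition all_rest :: "nat \<Rightarrow> nat" where
  "all_rest v = 3"

definition hub_block :: "nat \<Rightarrow> nat" where
  "hub_block v = (if v \<le> 1 then 1 else 2)"

lemma prod_edges_K0:
  "(\<Prod>e\<in>edges K0. g (Min e) (Max e)) = g 0 2 * g 0 3 * g 0 4 * g 0 5 * g 1 2 * g 1 3 * g 1 4 * g 1 5 * (g 2 3 :: 'a :: comm_monoid_mult)"
  unfolding edges_K0 by (simp add: doubleton_eq_iff eval_nat_numeral mult_ac)

lemma sum_edges_K0:
  "(\<Sum>e\<in>edges K0. g (Min e) (Max e)) = g 0 2 + g 0 3 + g 0 4 + g 0 5 + g 1 2 + g 1 3 + g 1 4 + g 1 5 + (g 2 3 :: nat)"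
  unfolding edges_K0 by (simp add: doubleton_eq_iff eval_nat_numeral)

lemma exponent_sum:
  assumes B: "B \<in> {0..5} \<rightarrow> {1..3}" and "\<not> (\<forall>v\<in>{0..5}. B v = all_rest v)" "\<not> (\<forall>v\<in>{0..5}. B v = hub_block v)"
  shows "10 \<le> (\<Sum>v\<in>{0..5}. vertex_exp (B v)) + (\<Sum>e\<in>edges K0. edge_exp (B (Min e)) (B (Max e)))"
proof -
  have "B v \<in> {1..3}" if "v \<in> {0, 1, 2, 3, 4, 5}" for v
    using B that by (auto simp only: atLeastAtMost_0_5 Pi_iff)
  then have "B 0 \<in> {1..3}" "B 1 \<in> {1..3}" "B 2 \<in> {1..3}" "B 3 \<in> {1..3}" "B 4 \<in> {1..3}" "B 5 \<in> {1..3}"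
    by auto
  note * = exponent_sum_explicit[OF this]
  have "(\<Sum>v\<in>{0..5}. vertex_exp (B v)) + (\<Sum>e\<in>edges K0. edge_exp (B (Min e)) (B (Max e))) =
    vertex_exp (B 0) + vertex_exp (B 1) + edge_exp (B 2) (B 3)
    + (vertex_exp (B 2) + edge_exp (B 0) (B 2) + edge_exp (B 1) (B 2)) + (vertex_exp (B 3) + edge_exp (B 0) (B 3) + edge_exp (B 1) (B 3))
    + (vertex_exp (B 4) + edge_exp (B 0) (B 4) + edge_exp (B 1) (B 4)) + (vertex_exp (B 5) + edge_exp (B 0) (B 5) + edge_exp (B 1) (B 5))"
    unfolding sum_edges_K0[of "\<lambda>a b. edge_exp (B a) (B b)"] atLeastAtMost_0_5 by simp
  also have "\<dots> \<ge> 10"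
    using assms(2,3) by (intro *) (auto simp: atLeastAtMost_0_5 all_rest_def hub_block_def)
  finally show ?thesis .
qed

text \<open>The constant C absorbs the logarithmic factors; it appears once for each of the nine
  edges. The spare power of p beats C^9.\<close>

lemma block_weight_le:
  fixes s p r C :: real
  assumes p: "0 \<le> p" "p \<le> 1" and s: "0 \<le> s" "s \<le> p\<^sup>2" and B: "B \<in> {0..5} \<rightarrow> {1..3}"
    and w: "\<And>i j. i \<in> {1..3} \<Longrightarrow> j \<in> {1..3} \<Longrightarrow> 0 \<le> w i j \<and> w i j \<le> C * p ^ edge_exp i j"
    and C: "C \<ge> 0"
    and special: "\<not> (\<forall>v\<in>{0..5}. B v = all_rest v)" "\<not> (\<forall>v\<in>{0..5}. B v = hub_block v)"
  shows "block_weight s p w B \<le> C ^ 9 * p ^ 10"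
proof -
  have "p\<^sup>2 \<le> p" using p by (simp add: power2_eq_square mult_left_le)
  then have sp: "s \<le> p" using s by simp
  have size: "0 \<le> size3 s p i \<and> size3 s p i \<le> p ^ vertex_exp i" for i
    using p s sp by (simp add: size3_def vertex_exp_def)
  have Bv: "B v \<in> {1..3}" if "v \<in> {0..5}" for v using B that by auto
  have "block_weight s p w B \<le> (\<Prod>v\<in>{0..5}. p ^ vertex_exp (B v)) * (\<Prod>e\<in>edges K0. C * p ^ edge_exp (B (Min e)) (B (Max e)))"
    unfolding block_weight_def
  proof (intro mult_mono prod_mono)
    show "0 \<le> w (B (Min e)) (B (Max e)) \<and> w (B (Min e)) (B (Max e)) \<le> C * p ^ edge_exp (B (Min e)) (B (Max e))"
      if "e \<in> edges K0" for e
      by (intro w Bv K0_edge_ends that)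
    then show "0 \<le> (\<Prod>e\<in>edges K0. w (B (Min e)) (B (Max e)))"
      by (intro prod_nonneg) blast
  qed (use size p in \<open>auto intro: prod_nonneg\<close>)
  also have "\<dots> = C ^ 9 * p ^ ((\<Sum>v\<in>{0..5}. vertex_exp (B v)) + (\<Sum>e\<in>edges K0. edge_exp (B (Min e)) (B (Max e))))"
    using num_edges_K0 by (simp add: prod.distrib power_sum[symmetric] power_add)
  also have "\<dots> \<le> C ^ 9 * p ^ 10"
    using p C by (intro mult_left_mono power_decreasing exponent_sum B special) auto
  finally show ?thesis .
qed

lemma block_weight_cong:
  assumes "\<And>v. v \<in> {0..5} \<Longrightarrow> B v = B' v"
  shows "block_weight s p w B = block_weight s p w B'"
  unfolding block_weight_def
  by (intro arg_cong2[where f = times] prod.cong refl) (simp_all only: assms K0_edge_ends)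

lemma block_weight_all_rest: "block_weight s p w all_rest = (1 - p) ^ 6 * w 3 3 ^ 9"
  by (simp add: block_weight_def all_rest_def size3_def num_edges_K0)

lemma block_weight_hub_block: "block_weight s p w hub_block = s\<^sup>2 * (p - s) ^ 4 * (w 1 2 ^ 8 * w 2 2)"
  unfolding block_weight_def atLeastAtMost_0_5 prod_edges_K0[of "\<lambda>a b. w (hub_block a) (hub_block b)"]
  by (simp add: hub_block_def size3_def power_numeral_reduce)

lemma block_weight_nonneg:
  assumes "0 \<le> s" "s \<le> p" "p \<le> 1" "B \<in> {0..5} \<rightarrow> {1..3}"
    "\<And>i j. i \<in> {1..3} \<Longrightarrow> j \<in> {1..3} \<Longrightarrow> 0 \<le> w i j"
  shows "0 \<le> block_weight s p w B"
proof -
  have Bv: "B v \<in> {1..3}" if "v \<in> {0..5}" for v using assms(4) that by auto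
  show ?thesis
    unfolding block_weight_def using assms(1-3)
    by (intro mult_nonneg_nonneg prod_nonneg ballI assms(5) Bv K0_edge_ends) (auto simp: size3_def)
qed

lemma block_weight_mono:
  assumes "0 \<le> s" "s \<le> p" "p \<le> 1" "B \<in> {0..5} \<rightarrow> {1..3}"
    "\<And>i j. i \<in> {1..3} \<Longrightarrow> j \<in> {1..3} \<Longrightarrow> 0 \<le> w i j \<and> w i j \<le> w' i j"
  shows "block_weight s p w B \<le> block_weight s p w' B"
proof -
  have Bv: "B v \<in> {1..3}" if "v \<in> {0..5}" for v using assms(4) that by auto
  have 1: "0 \<le> w (B (Min e)) (B (Max e)) \<and> w (B (Min e)) (B (Max e)) \<le> w' (B (Min e)) (B (Max e))"
    if "e \<in> edges K0" for e
    by (intro assms(5) Bv K0_edge_ends that)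
  show ?thesis
    unfolding block_weight_def
    by (intro mult_left_mono prod_mono 1 prod_nonneg ballI) (use assms(1-3) in \<open>auto simp: size3_def\<close>)
qed

text \<open>The ratio \<open>density_ratio\<close> of the edge density inside the second block to \<open>p\<close> minimises
  \<open>2 * sqrt \<delta> * ln (1 / p) / sqrt r + 2 / 3 * ln (ln (1 / p)) * r\<close>; in the size \<open>hub_size\<close> of the first block, the additional \<open>1 / ln (ln (1 / p))\<close> absorbs the lower order losses.\<close>

definition density_ratio :: "real \<Rightarrow> real \<Rightarrow> real" where
  "density_ratio \<delta> p = (3 * sqrt \<delta> * ln (1 / p) / (2 * ln (ln (1 / p)))) powr (2/3)"

definition hub_size :: "real \<Rightarrow> real \<Rightarrow> real" where
  "hub_size \<delta> p = sqrt ((\<delta> + 1 / ln (ln (1 / p))) / density_ratio \<delta> p) * p\<^sup>2"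

definition nbr_rest_weight :: "real \<Rightarrow> real \<Rightarrow> real" where
  "nbr_rest_weight \<delta> p = (p - hub_size \<delta> p - (p - hub_size \<delta> p) * (p * density_ratio \<delta> p)) / (1 - p)"

definition rest_weight :: "real \<Rightarrow> real \<Rightarrow> real" where
  "rest_weight \<delta> p = (p - (hub_size \<delta> p)\<^sup>2 - (p - hub_size \<delta> p) * nbr_rest_weight \<delta> p) / (1 - p)"

text \<open>The weights towards the third block are dictated by regularity. In the row of the hubs,
  s p + (p - s) + (1 - p) s = p for s = \<open>hub_size\<close>, so the weight between hubs and rest
  is again s; \<open>nbr_rest_weight\<close> and \<open>rest_weight\<close> solve the equations of
  the other two rows.\<close>

definition weight3 :: "real \<Rightarrow> real \<Rightarrow> nat \<Rightarrow> nat \<Rightarrow> real" where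
  "weight3 \<delta> p i j =
     (if i = 1 \<and> j = 1 then p else if i = 1 \<and> j = 2 \<or> i = 2 \<and> j = 1 then 1
      else if i = 2 \<and> j = 2 then p * density_ratio \<delta> p
      else if i = 3 \<and> j = 3 then rest_weight \<delta> p
      else if i = 1 \<or> j = 1 then hub_size \<delta> p
      else nbr_rest_weight \<delta> p)"

text \<open>Collects what is needed of p and holds for small p. The last inequality is the lower
  bound for the homomorphism density divided by p^9: up to logarithmic factors, its two losses are
  linear in p, and the additional 1 / l outweighs them.\<close>

definition admissible :: "real \<Rightarrow> real \<Rightarrow> bool" where
  "admissible \<delta> p \<longleftrightarrow> 0 < p \<and> p \<le> 1/2 \<and> 2 \<le> density_ratio \<delta> p \<and> 4 * p * density_ratio \<delta> p \<le> 1 \<and> 0 < ln (ln (1 / p)) \<and>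
     \<delta> + 1 / ln (ln (1 / p)) \<le> density_ratio \<delta> p \<and>
     1 + \<delta> \<le> (1 - p) ^ 6 + (\<delta> + 1 / ln (ln (1 / p))) * (1 - hub_size \<delta> p / p) ^ 4"

lemma eventually_admissible:
  assumes "\<delta> > 0"
  shows "\<forall>\<^sub>F p in at_right 0. admissible \<delta> p"
  unfolding admissible_def hub_size_def density_ratio_def using assms
  by (intro eventually_conj; real_asymp)

text \<open>The five terms belong, in this order, to the pairs of blocks hubs and neighbours, hubs
  and rest, neighbours and neighbours, neighbours and rest, rest and rest. Only the first and the
  third are of the order of the rate.\<close>

definition entropy_bound :: "real \<Rightarrow> real \<Rightarrow> real" where
  "entropy_bound \<delta> p = 2 * hub_size \<delta> p * p * ln (1 / p) + 4 * hub_size \<delta> p * p + p ^ 3 * density_ratio \<delta> p * ln (density_ratio \<delta> p)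
     + 64 * p ^ 4 * density_ratio \<delta> p ^ 2 + 200 * p ^ 5 * density_ratio \<delta> p ^ 2"

text \<open>Writing \<open>density_ratio\<close> as x (L / l)^(2/3), one has x^3 = 9 \<delta> / 4.
  In units of p^3 L^(2/3) l^(1/3), the two main terms are (4/3) x and (2/3) x, and their sum 2 x is
  the cube root of 18 \<delta>. The rest of the proof supplies this identity in \<open>powr\<close>
  form.\<close>

lemma entropy_bound_asymp:
  assumes "\<delta> > 0"
  shows "((\<lambda>p. entropy_bound \<delta> p / upper_tail_rate \<delta> p) \<longlongrightarrow> 1) (at_right 0)"
proof -
  define x where "x = (3 * root 2 \<delta> / 2) powr (2/3)"
  have "x > 0" using assms by (simp add: x_def)
  have "x ^ 3 = (3 * root 2 \<delta> / 2) powr 2"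
    unfolding x_def using assms by (simp add: powr_powr flip: powr_numeral)
  also have "\<dots> = 9 * \<delta> / 4"
    using assms by (simp add: powr_numeral power_divide power_mult_distrib)
  finally have x3: "\<delta> = 4 / 9 * x ^ 3" by simp
  have "(2 * x) powr 3 = 18 * \<delta>"
    using \<open>x > 0\<close> by (simp add: x3 power_mult_distrib powr_numeral)
  then have "(18 * \<delta>) powr (1/3) = ((2 * x) powr 3) powr (1/3)"
    by (simp only:)
  also have "\<dots> = 2 * x" unfolding powr_powr using \<open>x > 0\<close> by simp
  finally have z: "(18 * \<delta>) powr (1/3) = 2 * x" .
  have "(\<delta> * inverse x) powr (1/2) = ((2 / 3 * x) powr 2) powr (1/2)"
    using \<open>x > 0\<close> by (simp add: x3 power_mult_distrib powr_numeral power_divide field_simps power_numeral_reduce)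
  also have "\<dots> = 2 / 3 * x" using \<open>x > 0\<close> by (simp add: powr_powr)
  finally have "(\<delta> * inverse x) powr (1/2) = 2 / 3 * x" .
  with z have "(2 * (\<delta> * inverse x) powr (1/2) + x * 2 / 3) * inverse ((18 * \<delta>) powr (1/3))
      = (2 * (2 / 3 * x) + x * 2 / 3) * inverse (2 * x)"
    by (simp only:)
  also have "\<dots> = 1" using \<open>x > 0\<close> by (simp add: field_simps)
  finally have "(2 * (\<delta> * inverse x) powr (1/2) + x * 2 / 3) * inverse ((18 * \<delta>) powr (1/3)) = 1" .
  then show ?thesis
    unfolding x_def entropy_bound_def hub_size_def density_ratio_def upper_tail_rate_def using assms
    by real_asymp
qed

section \<open>Weights, homomorphism density and entropy of the optimal block graphon\<close>

context
  fixes \<delta> p :: real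
  assumes \<delta>: "\<delta> > 0" and adm: "admissible \<delta> p"
begin

lemma p_bounds: "0 < p" "p \<le> 1/2" "p < 1"
  using adm by (auto simp: admissible_def)

lemma p2_le: "p\<^sup>2 \<le> p / 2"
  using p_bounds by (simp add: power2_eq_square)

lemma density_ratio_bounds: "2 \<le> density_ratio \<delta> p" "4 * p * density_ratio \<delta> p \<le> 1"
  using adm by (auto simp: admissible_def)

text \<open>This relation defines the size of the hub block: multiplied by p^4 for the vertices 2 to
  5 and by p for the edge {2, 3}, it gives slightly more than the required \<delta> p^9.\<close>

lemma hub_size_power2: "(hub_size \<delta> p)\<^sup>2 * density_ratio \<delta> p = (\<delta> + 1 / ln (ln (1 / p))) * p ^ 4"
proof -
  have "0 \<le> (\<delta> + 1 / ln (ln (1 / p))) / density_ratio \<delta> p" "density_ratio \<delta> p \<noteq> 0"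
    using adm \<delta> by (auto simp: admissible_def)
  then show ?thesis
    by (simp add: hub_size_def power_mult_distrib flip: power_mult)
qed

lemma hub_size_bounds: "0 < hub_size \<delta> p" "hub_size \<delta> p \<le> p\<^sup>2"
proof -
  have "0 < (\<delta> + 1 / ln (ln (1 / p))) / density_ratio \<delta> p" "(\<delta> + 1 / ln (ln (1 / p))) / density_ratio \<delta> p \<le> 1"
    using adm \<delta> by (auto simp: admissible_def intro!: divide_pos_pos add_pos_pos)
  then show "0 < hub_size \<delta> p" "hub_size \<delta> p \<le> p\<^sup>2"
    using p_bounds unfolding hub_size_def by (auto intro!: mult_left_le_one_le)
qed

lemma hub_size_le: "hub_size \<delta> p \<le> p / 2"
  using hub_size_bounds p2_le by simp

lemma nbr_rest_weight_eq: "(1 - p) * nbr_rest_weight \<delta> p = p - hub_size \<delta> p - (p - hub_size \<delta> p) * (p * density_ratio \<delta> p)"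
  using p_bounds by (simp add: nbr_rest_weight_def)

lemma rest_weight_eq: "(1 - p) * rest_weight \<delta> p = p - (hub_size \<delta> p)\<^sup>2 - (p - hub_size \<delta> p) * nbr_rest_weight \<delta> p"
  using p_bounds by (simp add: rest_weight_def)

text \<open>The excess density in the second block, of size about p, is compensated over the rest;
  this costs a deviation of order p * p r. Nonnegativity comes from p r \<le> 1, the upper bound p
  from r \<ge> 2 and s \<le> p / 2, which give p^2 \<le> (p - s) p r.\<close>

lemma nbr_rest_weight_bounds: "0 \<le> nbr_rest_weight \<delta> p" "nbr_rest_weight \<delta> p \<le> p" "p - nbr_rest_weight \<delta> p \<le> 4 * p\<^sup>2 * density_ratio \<delta> p"
proof -
  let ?s = "hub_size \<delta> p" and ?r = "density_ratio \<delta> p"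
  note s = hub_size_bounds hub_size_le
  have "(p - ?s) * (p * ?r) \<le> (p - ?s) * 1"
    using density_ratio_bounds p_bounds s by (intro mult_left_mono) auto
  then have "0 \<le> (1 - p) * nbr_rest_weight \<delta> p" unfolding nbr_rest_weight_eq by simp
  then show "0 \<le> nbr_rest_weight \<delta> p" using p_bounds by (simp add: zero_le_mult_iff)
  have "p / 2 * (p * 2) \<le> (p - ?s) * (p * ?r)"
    using density_ratio_bounds p_bounds s by (intro mult_mono) auto
  then have "(1 - p) * nbr_rest_weight \<delta> p \<le> (1 - p) * p"
    unfolding nbr_rest_weight_eq using s by (simp add: algebra_simps)
  then show "nbr_rest_weight \<delta> p \<le> p" using p_bounds by simp
  have "(p - ?s) * (p * ?r) \<le> p * (p * ?r)"
    using density_ratio_bounds p_bounds s by (intro mult_right_mono) auto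
  moreover have "(1 - p) * (p - nbr_rest_weight \<delta> p) = ?s + (p - ?s) * (p * ?r) - p\<^sup>2"
    using nbr_rest_weight_eq by (simp add: algebra_simps power2_eq_square)
  ultimately have "(1 - p) * (p - nbr_rest_weight \<delta> p) \<le> p * (p * ?r)"
    using s by linarith
  also have "\<dots> \<le> (1 / 2) * (4 * p\<^sup>2 * ?r)"
    using density_ratio_bounds p_bounds by (simp add: power2_eq_square)
  also have "\<dots> \<le> (1 - p) * (4 * p\<^sup>2 * ?r)"
    using density_ratio_bounds p_bounds by (intro mult_right_mono) auto
  finally have "(1 - p) * (p - nbr_rest_weight \<delta> p) \<le> (1 - p) * (4 * p\<^sup>2 * ?r)" .
  then show "p - nbr_rest_weight \<delta> p \<le> 4 * p\<^sup>2 * density_ratio \<delta> p" using p_bounds by simp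
qed

text \<open>The deviation of \<open>nbr_rest_weight\<close> is compensated in turn, with one more
  factor p as the second block has size about p. The sign matters: a weight of at least p in the
  rest secures the constant term p^9 of the homomorphism density.\<close>

lemma rest_weight_bounds: "p \<le> rest_weight \<delta> p" "rest_weight \<delta> p \<le> 2 * p" "rest_weight \<delta> p - p \<le> 10 * p ^ 3 * density_ratio \<delta> p"
proof -
  let ?s = "hub_size \<delta> p" and ?r = "density_ratio \<delta> p"
  note s = hub_size_bounds hub_size_le
  have t: "(p - ?s) * nbr_rest_weight \<delta> p \<le> (p - ?s) * p"
    using nbr_rest_weight_bounds s p_bounds by (intro mult_left_mono) auto
  have "?s\<^sup>2 \<le> ?s * p" unfolding power2_eq_square using s p_bounds by (intro mult_left_mono) auto
  with t have "(1 - p) * p \<le> (1 - p) * rest_weight \<delta> p"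
    unfolding rest_weight_eq by (simp add: algebra_simps)
  then show "p \<le> rest_weight \<delta> p" using p_bounds by simp
  have "0 \<le> (p - ?s) * nbr_rest_weight \<delta> p" using nbr_rest_weight_bounds s p_bounds by simp
  then have "(1 - p) * rest_weight \<delta> p \<le> p"
    unfolding rest_weight_eq using zero_le_power2[of ?s] by linarith
  also have "p \<le> (1 - p) * (2 * p)" using p_bounds by (simp add: algebra_simps)
  finally show "rest_weight \<delta> p \<le> 2 * p" using p_bounds by simp
  have "(p - ?s) * (p - nbr_rest_weight \<delta> p) \<le> p * (4 * p\<^sup>2 * ?r)"
    using nbr_rest_weight_bounds s p_bounds by (intro mult_mono) auto
  then have "p * p - ?s * p - (p - ?s) * nbr_rest_weight \<delta> p \<le> 4 * p ^ 3 * ?r"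
    by (simp add: algebra_simps power2_eq_square power3_eq_cube)
  moreover have "?s * p \<le> p ^ 3"
    using mult_right_mono[OF s(2), of p] p_bounds by (simp add: power3_eq_cube power2_eq_square)
  moreover have "p ^ 3 * 1 \<le> p ^ 3 * ?r" using density_ratio_bounds p_bounds by (intro mult_left_mono) auto
  moreover have "(1 - p) * (rest_weight \<delta> p - p) = p * p - ?s\<^sup>2 - (p - ?s) * nbr_rest_weight \<delta> p"
    using rest_weight_eq by (simp add: algebra_simps)
  ultimately have "(1 - p) * (rest_weight \<delta> p - p) \<le> 5 * p ^ 3 * ?r"
    using zero_le_power2[of ?s] by linarith
  moreover have "5 * p ^ 3 * ?r \<le> (1 - p) * (10 * p ^ 3 * ?r)"
    using p_bounds density_ratio_bounds mult_right_mono[of p "1/2" "10 * p ^ 3 * ?r"] by (simp add: algebra_simps)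
  ultimately have "(1 - p) * (rest_weight \<delta> p - p) \<le> (1 - p) * (10 * p ^ 3 * ?r)"
    by (rule order_trans)
  then show "rest_weight \<delta> p - p \<le> 10 * p ^ 3 * density_ratio \<delta> p" using p_bounds by simp
qed

lemma hub_bounds: "0 \<le> hub_size \<delta> p" "hub_size \<delta> p \<le> p" "p \<le> 1"
  using hub_size_bounds hub_size_le p_bounds by auto

lemma weight3_values:
  "weight3 \<delta> p 1 1 = p" "weight3 \<delta> p 1 2 = 1" "weight3 \<delta> p 2 1 = 1" "weight3 \<delta> p 2 2 = p * density_ratio \<delta> p"
  "weight3 \<delta> p 1 3 = hub_size \<delta> p" "weight3 \<delta> p 3 1 = hub_size \<delta> p"
  "weight3 \<delta> p 2 3 = nbr_rest_weight \<delta> p" "weight3 \<delta> p 3 2 = nbr_rest_weight \<delta> p" "weight3 \<delta> p 3 3 = rest_weight \<delta> p"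
  by (simp_all add: weight3_def)

lemma weight3_bounds:
  assumes "i \<in> {1..3}" "j \<in> {1..3}"
  shows "0 \<le> weight3 \<delta> p i j \<and> weight3 \<delta> p i j \<le> 1 \<and> weight3 \<delta> p i j = weight3 \<delta> p j i"
proof -
  have "p * density_ratio \<delta> p \<le> 1" using density_ratio_bounds p_bounds by simp
  with assms show ?thesis
    using p_bounds density_ratio_bounds hub_bounds nbr_rest_weight_bounds rest_weight_bounds unfolding index_set3
    by (elim insertE emptyE; simp add: weight3_def)
qed

lemma regular_weight3: "regular_graphon p (block3 (hub_size \<delta> p) p (weight3 \<delta> p))"
proof (rule regular_graphon_block3[OF hub_bounds weight3_bounds])
  fix i :: nat assume "i \<in> {1..3}"
  then consider "i = 1" | "i = 2" | "i = 3" unfolding index_set3 by blast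
  then show "(\<Sum>j\<in>{1..3}. size3 (hub_size \<delta> p) p j * weight3 \<delta> p i j) = p"
    using nbr_rest_weight_eq rest_weight_eq unfolding index_set3
    by cases (simp_all add: size3_def weight3_values weight3_values[unfolded One_nat_def] algebra_simps power2_eq_square)
qed

text \<open>Of the expansion over assignments, only the two terms of exponent 9 are kept; the others
  are nonnegative. The final inequality in \<open>admissible\<close> is tailored to their
  sum.\<close>

lemma Hom_weight3_ge: "(1 + \<delta>) * p ^ 9 \<le> Hom K0 (block3 (hub_size \<delta> p) p (weight3 \<delta> p))"
proof -
  let ?s = "hub_size \<delta> p" and ?w = "weight3 \<delta> p"
  let ?B = "{restrict all_rest {0..5}, restrict hub_block {0..5}}"
  have w0: "0 \<le> ?w i j" if "i \<in> {1..3}" "j \<in> {1..3}" for i j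
    using weight3_bounds[OF that] by simp
  have ne: "restrict all_rest {0..5} \<noteq> restrict hub_block {0..5}"
    by (auto simp: fun_eq_iff all_rest_def hub_block_def restrict_def)
  have "(1 + \<delta>) * p ^ 9 \<le> ((1 - p) ^ 6 + (\<delta> + 1 / ln (ln (1 / p))) * (1 - ?s / p) ^ 4) * p ^ 9"
    using adm by (intro mult_right_mono) (auto simp: admissible_def)
  also have "\<dots> = (1 - p) ^ 6 * p ^ 9 + ?s\<^sup>2 * (p - ?s) ^ 4 * (p * density_ratio \<delta> p)"
  proof -
    have "(p - ?s) ^ 4 = (1 - ?s / p) ^ 4 * p ^ 4"
      using p_bounds by (simp add: field_simps flip: power_mult_distrib)
    then have "?s\<^sup>2 * (p - ?s) ^ 4 * (p * density_ratio \<delta> p) = (?s\<^sup>2 * density_ratio \<delta> p) * (1 - ?s / p) ^ 4 * p ^ 5"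
      by (simp add: power_numeral_reduce)
    then show ?thesis
      unfolding hub_size_power2 by (simp add: distrib_right power_numeral_reduce)
  qed
  also have "\<dots> \<le> block_weight ?s p ?w all_rest + block_weight ?s p ?w hub_block"
    unfolding block_weight_all_rest block_weight_hub_block weight3_values
    using p_bounds rest_weight_bounds by (intro add_mono mult_left_mono power_mono) auto
  also have "\<dots> = (\<Sum>B\<in>?B. block_weight ?s p ?w B)"
    using ne block_weight_cong[of "restrict all_rest {0..5}" all_rest ?s p ?w]
      block_weight_cong[of "restrict hub_block {0..5}" hub_block ?s p ?w] by simp
  also have "\<dots> \<le> (\<Sum>B\<in>{0..5} \<rightarrow>\<^sub>E {1..3}. block_weight ?s p ?w B)"
  proof (rule sum_mono2)
    show "0 \<le> block_weight ?s p ?w B" if "B \<in> ({0..5} \<rightarrow>\<^sub>E {1..3}) - ?B" for B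
      by (rule block_weight_nonneg[OF hub_bounds _ w0]) (use that in auto)
  qed (auto simp: finite_PiE all_rest_def hub_block_def)
  also have "\<dots> = Hom K0 (block3 ?s p ?w)"
    by (rule Hom_block3[OF hub_bounds w0, symmetric])
  finally show ?thesis .
qed

lemma entropy_weight3_le: "graphon_entropy p (block3 (hub_size \<delta> p) p (weight3 \<delta> p)) \<le> entropy_bound \<delta> p"
proof -
  let ?s = "hub_size \<delta> p" and ?r = "density_ratio \<delta> p" and ?I = "rel_entropy p"
  note s = hub_size_bounds hub_size_le
  have chi: "?I w \<le> 2 * d\<^sup>2 / p" if "0 \<le> w" "w \<le> 1" "\<bar>w - p\<bar> \<le> d" for w d
  proof -
    have "?I w \<le> (w - p)\<^sup>2 / (p * (1 - p))"
      using p_bounds that by (intro rel_entropy_le_chi_square) auto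
    also have "\<dots> \<le> d\<^sup>2 / (p * (1 / 2))"
      using p_bounds that by (intro frac_le mult_left_mono) (auto simp: abs_le_square_iff[symmetric])
    finally show ?thesis by (simp add: mult.commute)
  qed
  have Ip: "?I p = 0" using p_bounds by (simp add: rel_entropy_def)
  have I1: "?I 1 = ln (1 / p)" by (simp add: rel_entropy_def)
  have Is: "?I ?s \<le> 2 * p"
    using chi[of ?s p] s p_bounds by (simp add: power2_eq_square)
  have Iq: "?I (p * ?r) \<le> p * ?r * ln ?r"
  proof -
    have "p * 1 \<le> p * ?r" using density_ratio_bounds p_bounds by (intro mult_left_mono) auto
    moreover have "p * ?r < 1" using density_ratio_bounds by simp
    ultimately have pr: "p \<le> p * ?r" "p * ?r < 1" by simp_all
    then have "(1 - p * ?r) * ln ((1 - p * ?r) / (1 - p)) \<le> 0"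
      using p_bounds by (intro mult_nonneg_nonpos) auto
    then show ?thesis using p_bounds by (simp add: rel_entropy_def)
  qed
  have I23: "?I (nbr_rest_weight \<delta> p) \<le> 32 * p ^ 3 * ?r ^ 2"
  proof -
    have "?I (nbr_rest_weight \<delta> p) \<le> 2 * (4 * p\<^sup>2 * ?r)\<^sup>2 / p"
      using nbr_rest_weight_bounds p_bounds by (intro chi) auto
    also have "\<dots> = 32 * p ^ 3 * ?r ^ 2"
      using p_bounds by (simp add: field_simps power_numeral_reduce)
    finally show ?thesis .
  qed
  have I33: "?I (rest_weight \<delta> p) \<le> 200 * p ^ 5 * ?r ^ 2"
  proof -
    have "?I (rest_weight \<delta> p) \<le> 2 * (10 * p ^ 3 * ?r)\<^sup>2 / p"
      using rest_weight_bounds p_bounds by (intro chi) auto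
    also have "\<dots> = 200 * p ^ 5 * ?r ^ 2"
      using p_bounds by (simp add: field_simps power_numeral_reduce)
    finally show ?thesis .
  qed
  have I0: "0 \<le> ?I w" if "0 \<le> w" "w \<le> 1" for w
    using p_bounds that by (intro rel_entropy_nonneg) auto
  have L0: "0 \<le> ln (1 / p)" "0 \<le> ln ?r" using p_bounds density_ratio_bounds by auto
  have "graphon_entropy p (block3 ?s p (weight3 \<delta> p))
    = (\<Sum>i\<in>{1..3}. size3 ?s p i * (\<Sum>j\<in>{1..3}. size3 ?s p j * ?I (weight3 \<delta> p i j)))"
    by (rule graphon_entropy_block3[OF hub_bounds weight3_bounds p_bounds(1,3)])
  also have "\<dots> = 2 * (?s * (p - ?s)) * ln (1 / p) + 2 * (?s * (1 - p)) * ?I ?s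
     + (p - ?s)\<^sup>2 * ?I (p * ?r) + 2 * ((p - ?s) * (1 - p)) * ?I (nbr_rest_weight \<delta> p) + (1 - p)\<^sup>2 * ?I (rest_weight \<delta> p)"
    unfolding index_set3
    by (simp add: size3_def weight3_values weight3_values[unfolded One_nat_def] Ip I1 power2_eq_square algebra_simps)
  also have "\<dots> \<le> 2 * (?s * p) * ln (1 / p) + 2 * (?s * 1) * (2 * p)
     + p\<^sup>2 * (p * ?r * ln ?r) + 2 * (p * 1) * (32 * p ^ 3 * ?r ^ 2) + 1\<^sup>2 * (200 * p ^ 5 * ?r ^ 2)"
    using s p_bounds L0 nbr_rest_weight_bounds rest_weight_bounds Is Iq I23 I33 density_ratio_bounds
    by (intro add_mono mult_mono power_mono I0 mult_nonneg_nonneg) auto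
  also have "\<dots> = entropy_bound \<delta> p"
    by (simp add: entropy_bound_def power_numeral_reduce)
  finally show ?thesis .
qed

end

section \<open>Asymptotics and conditions\<close>

lemma eventually_entropy_weight3:
  assumes "\<delta> > 0"
  shows "\<forall>\<^sub>F p in at_right 0. admissible \<delta> p \<and>
    graphon_entropy p (block3 (hub_size \<delta> p) p (weight3 \<delta> p)) \<le> entropy_bound \<delta> p"
  using eventually_admissible[OF assms] by eventually_elim (use entropy_weight3_le[OF assms] in auto)

lemma upper_tail_rate_pos:
  assumes "\<delta> > 0"
  shows "\<forall>\<^sub>F p in at_right 0. upper_tail_rate \<delta> p > 0"
  unfolding upper_tail_rate_def using assms by real_asymp

text \<open>Stated for an arbitrary f, as it is applied both to the infimum and to the entropy of
  the explicit block graphon. The latter satisfies the lower bound because it competes in the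
  infimum.\<close>

lemma tendsto_upper_tail_rate_ratio:
  assumes "\<delta> > 0"
    and lower: "\<And>\<epsilon>. 0 < \<epsilon> \<Longrightarrow> \<epsilon> < 1 \<Longrightarrow> \<forall>\<^sub>F p in at_right 0. (1 - \<epsilon>) * upper_tail_rate \<delta> p \<le> f p"
    and upper: "\<forall>\<^sub>F p in at_right 0. f p \<le> entropy_bound \<delta> p"
  shows "f \<sim>[at_right 0] upper_tail_rate \<delta>"
proof (rule asymp_equivI', rule order_tendstoI)
  fix a :: real assume "a < 1"
  define \<epsilon> where "\<epsilon> = min (1/2) ((1 - a) / 2)"
  have \<epsilon>: "0 < \<epsilon>" "\<epsilon> < 1" "a < 1 - \<epsilon>"
    using \<open>a < 1\<close> by (auto simp: \<epsilon>_def min_def field_simps)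
  show "\<forall>\<^sub>F p in at_right 0. a < f p / upper_tail_rate \<delta> p"
    using lower[OF \<epsilon>(1,2)] upper_tail_rate_pos[OF assms(1)]
  proof eventually_elim
    case (elim p)
    then have "1 - \<epsilon> \<le> f p / upper_tail_rate \<delta> p" by (simp add: field_simps)
    with \<epsilon> show ?case by simp
  qed
next
  fix a :: real assume "a > 1"
  show "\<forall>\<^sub>F p in at_right 0. f p / upper_tail_rate \<delta> p < a"
    using upper upper_tail_rate_pos[OF assms(1)] order_tendstoD(2)[OF entropy_bound_asymp[OF assms(1)] \<open>a > 1\<close>]
  proof eventually_elim
    case (elim p)
    then have "f p / upper_tail_rate \<delta> p \<le> entropy_bound \<delta> p / upper_tail_rate \<delta> p"
      by (intro divide_right_mono) auto
    with elim show ?case by simp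
  qed
qed

lemma graphon_entropy_weight3_asymp:
  assumes "\<delta> > 0"
  shows "(\<lambda>p. graphon_entropy p (block3 (hub_size \<delta> p) p (weight3 \<delta> p))) \<sim>[at_right 0] upper_tail_rate \<delta>"
proof (rule tendsto_upper_tail_rate_ratio[OF assms])
  fix \<epsilon> :: real assume "0 < \<epsilon>" "\<epsilon> < 1"
  from eventually_graphon_entropy_ge[OF assms this] eventually_admissible[OF assms]
  show "\<forall>\<^sub>F p in at_right 0. (1 - \<epsilon>) * upper_tail_rate \<delta> p \<le> graphon_entropy p (block3 (hub_size \<delta> p) p (weight3 \<delta> p))"
    by eventually_elim (use regular_weight3[OF assms] Hom_weight3_ge[OF assms] in blast)
qed (use eventually_entropy_weight3[OF assms] in \<open>auto elim: eventually_mono\<close>)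

lemma INF_graphon_entropy_asymp:
  assumes "\<delta> > 0"
  shows "(\<lambda>p. INF W\<in>{W. regular_graphon p W \<and> Hom K0 W \<ge> (1 + \<delta>) * p ^ 9}. graphon_entropy p W)
    \<sim>[at_right 0] upper_tail_rate \<delta>"
proof (rule tendsto_upper_tail_rate_ratio[OF assms])
  let ?A = "\<lambda>p. {W. regular_graphon p W \<and> Hom K0 W \<ge> (1 + \<delta>) * p ^ 9}"
  have mem: "block3 (hub_size \<delta> p) p (weight3 \<delta> p) \<in> ?A p" if "admissible \<delta> p" for p
    using regular_weight3[OF assms that] Hom_weight3_ge[OF assms that] by blast
  {
    fix \<epsilon> :: real assume "0 < \<epsilon>" "\<epsilon> < 1"
    from eventually_graphon_entropy_ge[OF assms this] eventually_admissible[OF assms]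
    show "\<forall>\<^sub>F p in at_right 0. (1 - \<epsilon>) * upper_tail_rate \<delta> p \<le> (INF W\<in>?A p. graphon_entropy p W)"
      by eventually_elim (rule cINF_greatest, use mem in blast, blast)
  }
  \<comment> \<open>An infimum of real numbers is a lower bound only if the set is bounded below.
    The bound with 1/2 merely provides this.\<close>
  have "\<forall>\<^sub>F p in at_right 0. \<forall>W. regular_graphon p W \<longrightarrow> Hom K0 W \<ge> (1 + \<delta>) * p ^ 9 \<longrightarrow>
    (1 - 1/2) * upper_tail_rate \<delta> p \<le> graphon_entropy p W"
    by (rule eventually_graphon_entropy_ge[OF assms]) auto
  with eventually_entropy_weight3[OF assms]
  show "\<forall>\<^sub>F p in at_right 0. (INF W\<in>?A p. graphon_entropy p W) \<le> entropy_bound \<delta> p"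
  proof eventually_elim
    case (elim p)
    have "bdd_below (graphon_entropy p ` ?A p)"
      using elim(2) by (intro bdd_belowI2) blast
    from cINF_lower[OF this mem] elim(1) show ?case
      by (meson order_trans)
  qed
qed

text \<open>Adding p does not change the orders of the weights, which stay below 3 r
  p^\<open>edge_exp\<close>, so the count of exponents applies to W + p and, by monotonicity, to W.
  In the two exceptional terms, the weights in the rest are at most 3 p, and the nine weights
  between or within the first two blocks at most double, whence 512 = 2^9. Finally, 729 = 3^6 is the
  number of assignments.\<close>

lemma Hom_weight3_add_le:
  assumes \<delta>: "\<delta> > 0" and adm: "admissible \<delta> p"
  shows "Hom K0 (\<lambda>x y. block3 (hub_size \<delta> p) p (weight3 \<delta> p) x y + p) \<le>
    729 * ((3 * density_ratio \<delta> p) ^ 9 * p ^ 10 + ((3 * p) ^ 9 + 512 * (\<delta> + 1 / ln (ln (1 / p))) * p ^ 9))"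
    and "0 \<le> Hom K0 (\<lambda>x y. block3 (hub_size \<delta> p) p (weight3 \<delta> p) x y + p)"
    and "B \<in> {0..5} \<rightarrow> {1..3} \<Longrightarrow> \<not> (\<forall>v\<in>{0..5}. B v = all_rest v) \<Longrightarrow> \<not> (\<forall>v\<in>{0..5}. B v = hub_block v)
      \<Longrightarrow> block_weight (hub_size \<delta> p) p (weight3 \<delta> p) B \<le> (3 * density_ratio \<delta> p) ^ 9 * p ^ 10"
proof -
  let ?s = "hub_size \<delta> p" and ?w = "\<lambda>i j. weight3 \<delta> p i j + p" and ?r = "density_ratio \<delta> p"
  note p = p_bounds[OF \<delta> adm] and r = density_ratio_bounds[OF \<delta> adm] and s = hub_size_bounds[OF \<delta> adm] hub_bounds[OF \<delta> adm]
  note w = nbr_rest_weight_bounds[OF \<delta> adm] rest_weight_bounds[OF \<delta> adm]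
  have p1: "p * 1 \<le> p * ?r" "p * 2 \<le> p * ?r" using r p by (auto intro!: mult_left_mono)
  have w': "0 \<le> ?w i j \<and> ?w i j \<le> 3 * ?r * p ^ edge_exp i j" if "i \<in> {1..3}" "j \<in> {1..3}" for i j
  proof -
    have p2: "2 * p \<le> ?r * p" using p1 by (simp add: mult.commute)
    have "0 \<le> p + p \<and> p + p \<le> 3 * ?r * p ^ 1" "0 \<le> 1 + p \<and> 1 + p \<le> 3 * ?r * p ^ 0"
      "0 \<le> p * ?r + p \<and> p * ?r + p \<le> 3 * ?r * p ^ 1" "0 \<le> ?s + p \<and> ?s + p \<le> 3 * ?r * p ^ 1"
      "0 \<le> nbr_rest_weight \<delta> p + p \<and> nbr_rest_weight \<delta> p + p \<le> 3 * ?r * p ^ 1" "0 \<le> rest_weight \<delta> p + p \<and> rest_weight \<delta> p + p \<le> 3 * ?r * p ^ 1"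
      using p r(1) s(1,4) w(1,2,4,5) p2 mult.commute[of p ?r]
      unfolding power_one_right power_0 mult_1_right mult.assoc by linarith+
    moreover from that have "i = 1 \<or> i = 2 \<or> i = 3" "j = 1 \<or> j = 2 \<or> j = 3"
      unfolding index_set3 by blast+
    ultimately show ?thesis
      by (elim disjE) (simp_all only: weight3_values[OF \<delta> adm] edge_exp_def, simp_all)
  qed
  have w0: "0 \<le> ?w i j" if "i \<in> {1..3}" "j \<in> {1..3}" for i j using w'[OF that] by simp
  have w00: "0 \<le> weight3 \<delta> p i j" if "i \<in> {1..3}" "j \<in> {1..3}" for i j
    using weight3_bounds[OF \<delta> adm that] by simp
  have gen: "block_weight ?s p ?w B \<le> (3 * ?r) ^ 9 * p ^ 10"
    if "B \<in> {0..5} \<rightarrow> {1..3}" "\<not> (\<forall>v\<in>{0..5}. B v = all_rest v)" "\<not> (\<forall>v\<in>{0..5}. B v = hub_block v)" for B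
    using p r(1) s(1,2) by (intro block_weight_le that w') simp_all
  show "block_weight ?s p (weight3 \<delta> p) B \<le> (3 * ?r) ^ 9 * p ^ 10"
    if "B \<in> {0..5} \<rightarrow> {1..3}" "\<not> (\<forall>v\<in>{0..5}. B v = all_rest v)" "\<not> (\<forall>v\<in>{0..5}. B v = hub_block v)"
  proof -
    have "block_weight ?s p (weight3 \<delta> p) B \<le> block_weight ?s p ?w B"
      using w00 p(1) by (intro block_weight_mono s that) simp_all
    with gen[OF that] show ?thesis by simp
  qed
  have rest: "block_weight ?s p ?w all_rest \<le> (3 * p) ^ 9"
  proof -
    have "block_weight ?s p ?w all_rest \<le> 1 * (3 * p) ^ 9"
      unfolding block_weight_all_rest weight3_values[OF \<delta> adm] using p w
      by (intro mult_mono power_mono power_le_one) auto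
    then show ?thesis by simp
  qed
  have hub: "block_weight ?s p ?w hub_block \<le> 512 * (\<delta> + 1 / ln (ln (1 / p))) * p ^ 9"
  proof -
    have "block_weight ?s p ?w hub_block \<le> ?s\<^sup>2 * p ^ 4 * (2 ^ 8 * (2 * (p * ?r)))"
      unfolding block_weight_hub_block weight3_values[OF \<delta> adm]
    proof (intro mult_mono power_mono)
      show "p * ?r + p \<le> 2 * (p * ?r)" using p1 by simp
    qed (use p s(1,4) r(1) in \<open>simp_all add: add_nonneg_nonneg\<close>)
    also have "\<dots> = 512 * (?s\<^sup>2 * ?r) * p ^ 5"
      by (simp add: power_numeral_reduce)
    also have "\<dots> = 512 * (\<delta> + 1 / ln (ln (1 / p))) * p ^ 9"
      unfolding hub_size_power2[OF \<delta> adm] by (simp add: power_numeral_reduce)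
    finally show ?thesis .
  qed
  have eq: "(\<lambda>x y. block3 ?s p (weight3 \<delta> p) x y + p) = block3 ?s p ?w"
    by (simp add: block3_def fun_eq_iff)
  have nn: "0 \<le> block_weight ?s p ?w B" if "B \<in> {0..5} \<rightarrow> {1..3}" for B
    by (intro block_weight_nonneg s that w0)
  have "Hom K0 (block3 ?s p ?w) = (\<Sum>B\<in>{0..5} \<rightarrow>\<^sub>E {1..3}. block_weight ?s p ?w B)"
    by (intro Hom_block3 s w0)
  also have "\<dots> \<le> (\<Sum>B\<in>{0..5::nat} \<rightarrow>\<^sub>E {1..3::nat}. (3 * ?r) ^ 9 * p ^ 10 + ((3 * p) ^ 9 + 512 * (\<delta> + 1 / ln (ln (1 / p))) * p ^ 9))"
  proof (rule sum_mono)
    fix B assume "B \<in> {0..5::nat} \<rightarrow>\<^sub>E {1..3::nat}"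
    then have B: "B \<in> {0..5} \<rightarrow> {1..3}" by auto
    have bounds: "0 \<le> (3 * ?r) ^ 9 * p ^ 10" "0 \<le> (3 * p) ^ 9" "0 \<le> 512 * (\<delta> + 1 / ln (ln (1 / p))) * p ^ 9"
    proof -
      have "0 < ln (ln (1 / p))" using adm by (simp add: admissible_def)
      then have "0 \<le> \<delta> + 1 / ln (ln (1 / p))" using \<delta> by simp
      then show "0 \<le> 512 * (\<delta> + 1 / ln (ln (1 / p))) * p ^ 9" using p by simp
    qed (use p r in simp_all)
    consider "\<forall>v\<in>{0..5}. B v = all_rest v" | "\<forall>v\<in>{0..5}. B v = hub_block v"
      | "\<not> (\<forall>v\<in>{0..5}. B v = all_rest v)" "\<not> (\<forall>v\<in>{0..5}. B v = hub_block v)" by blast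
    then show "block_weight ?s p ?w B \<le> (3 * ?r) ^ 9 * p ^ 10 + ((3 * p) ^ 9 + 512 * (\<delta> + 1 / ln (ln (1 / p))) * p ^ 9)"
    proof cases
      case 1
      then have "block_weight ?s p ?w B = block_weight ?s p ?w all_rest"
        by (intro block_weight_cong) blast
      with rest bounds show ?thesis by linarith
    next
      case 2
      then have "block_weight ?s p ?w B = block_weight ?s p ?w hub_block"
        by (intro block_weight_cong) blast
      with hub bounds show ?thesis by linarith
    next
      case 3
      with gen[OF B] bounds show ?thesis by linarith
    qed
  qed
  also have "\<dots> = 729 * ((3 * ?r) ^ 9 * p ^ 10 + ((3 * p) ^ 9 + 512 * (\<delta> + 1 / ln (ln (1 / p))) * p ^ 9))"
    by (simp only: sum_constant card_PiE[OF finite_atLeastAtMost] card_atLeastAtMost prod_constant) simp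
  finally show "Hom K0 (\<lambda>x y. block3 ?s p (weight3 \<delta> p) x y + p) \<le>
    729 * ((3 * ?r) ^ 9 * p ^ 10 + ((3 * p) ^ 9 + 512 * (\<delta> + 1 / ln (ln (1 / p))) * p ^ 9))"
    unfolding eq .
  have "0 \<le> (\<Sum>B\<in>{0..5} \<rightarrow>\<^sub>E {1..3}. block_weight ?s p ?w B)"
    by (intro sum_nonneg nn) auto
  also have "\<dots> = Hom K0 (block3 ?s p ?w)"
    by (intro Hom_block3[symmetric] s w0)
  finally show "0 \<le> Hom K0 (\<lambda>x y. block3 ?s p (weight3 \<delta> p) x y + p)"
    unfolding eq .
qed

section \<open>Orders of magnitude behind the conditions\<close>

context
  fixes \<delta> :: real assumes \<delta>: "\<delta> > 0"
begin

lemma small_block_hub_hub: "(\<lambda>p. hub_size \<delta> p * hub_size \<delta> p * p) \<in> o[at_right 0](\<lambda>p. inverse (ln (ln (ln (1 / p)))) * upper_tail_rate \<delta> p)"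
  unfolding hub_size_def density_ratio_def upper_tail_rate_def using \<delta> by real_asymp

lemma small_block_hub_nbr: "(\<lambda>p. hub_size \<delta> p * (p - hub_size \<delta> p) * 1) \<in> o[at_right 0](\<lambda>p. inverse (ln (ln (ln (1 / p)))) * upper_tail_rate \<delta> p)"
  unfolding hub_size_def density_ratio_def upper_tail_rate_def using \<delta> by real_asymp

text \<open>The tight case of smallness. The mass p^3 r is smaller than the rate by a factor of
  order l only, and condition 6 asks for more than ln l.\<close>

lemma small_block_nbr_nbr: "(\<lambda>p. (p - hub_size \<delta> p) * (p - hub_size \<delta> p) * (p * density_ratio \<delta> p)) \<in> o[at_right 0](\<lambda>p. inverse (ln (ln (ln (1 / p)))) * upper_tail_rate \<delta> p)"
  unfolding hub_size_def density_ratio_def upper_tail_rate_def using \<delta> by real_asymp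

text \<open>Everything that conditions 4, 5 and 9 compare with n^(-1) or n^(-1) log n is at least of
  order p^3 up to logarithmic factors, so the assumed growth of p is ample there. It is the other
  half of condition 4 that uses it fully.\<close>

lemma power15_bigo:
  "(\<lambda>p. p ^ 15) \<in> O[at_right 0](\<lambda>p. p * hub_size \<delta> p)"
  "(\<lambda>p. p ^ 15) \<in> O[at_right 0](\<lambda>p. 1 * hub_size \<delta> p)"
  "(\<lambda>p. p ^ 15) \<in> O[at_right 0](\<lambda>p. 1 * (p - hub_size \<delta> p))"
  "(\<lambda>p. p ^ 15) \<in> O[at_right 0](\<lambda>p. p * density_ratio \<delta> p * (p - hub_size \<delta> p))"
  "(\<lambda>p. p ^ 15) \<in> O[at_right 0](\<lambda>p. 1 - p :: real)"
  "(\<lambda>p. p ^ 15) \<in> O[at_right 0](upper_tail_rate \<delta>)"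
  unfolding hub_size_def density_ratio_def upper_tail_rate_def[abs_def] using \<delta> by (real_asymp)+

lemma optimal_block_asymptotics:
  "(\<lambda>p. (3 * density_ratio \<delta> p) ^ 9 * p ^ 10) \<in> o[at_right 0](\<lambda>p. p ^ 9)"
  "(\<lambda>p. 729 * ((3 * density_ratio \<delta> p) ^ 9 * p ^ 10 + ((3 * p) ^ 9 + 512 * (\<delta> + 1 / ln (ln (1 / p))) * p ^ 9))) \<in> O[at_right 0](\<lambda>p. p ^ 9)"
  "(\<lambda>p. 10 * p ^ 3 * density_ratio \<delta> p) \<in> o[at_right 0](\<lambda>p. p)"
  "\<forall>\<^sub>F p in at_right 0. inverse p * entropy_bound \<delta> p \<le> (1 - p) * (1 - p)"
  unfolding hub_size_def density_ratio_def entropy_bound_def using \<delta> by (real_asymp)+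

end

section \<open>The sequence of block graphons and its conditions\<close>

context
  fixes \<delta> :: real and p :: "nat \<Rightarrow> real"
  assumes \<delta>: "\<delta> > 0" and p_pos: "\<And>n. 0 < p n"
    and growth: "(\<lambda>n. (ln (real n) / real n) powr (1/15)) \<in> o(p)"
    and p_small: "p \<in> o(\<lambda>_. 1)"
begin

text \<open>Where the parameters are not admissible, a trivial block graphon with two empty blocks is used.\<close>

definition seq_part :: "nat \<Rightarrow> nat \<Rightarrow> real set" where
  "seq_part n = (if admissible \<delta> (p n) then part3 (hub_size \<delta> (p n)) (p n) else part3 0 0)"

definition seq_weight :: "nat \<Rightarrow> nat \<Rightarrow> nat \<Rightarrow> real" where
  "seq_weight n = (if admissible \<delta> (p n) then weight3 \<delta> (p n) else (\<lambda>_ _. 0))"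

definition seq_graphon :: "nat \<Rightarrow> real \<Rightarrow> real \<Rightarrow> real" where
  "seq_graphon n = (if admissible \<delta> (p n) then block3 (hub_size \<delta> (p n)) (p n) (weight3 \<delta> (p n))
     else block3 0 0 (\<lambda>_ _. 0))"

lemma block_graphon_seq: "block_graphon 3 (seq_part n) (seq_weight n) (seq_graphon n)"
proof (cases "admissible \<delta> (p n)")
  case True
  then show ?thesis
    using block_graphon_block3[OF hub_bounds[OF \<delta> True] weight3_bounds[OF \<delta> True]]
    by (simp add: seq_part_def seq_weight_def seq_graphon_def)
next
  case False
  have "block_graphon 3 (part3 0 0) (\<lambda>_ _. 0) (block3 0 0 (\<lambda>_ _. 0))"
    by (rule block_graphon_block3) auto
  with False show ?thesis by (simp add: seq_part_def seq_weight_def seq_graphon_def)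
qed

lemma p_at_right: "filterlim p (at_right 0) sequentially"
proof (rule tendsto_imp_filterlim_at_right)
  show "p \<longlonglongrightarrow> 0" using smalloD_tendsto[OF p_small] by simp
qed (simp add: p_pos)

lemma eventually_p: "\<forall>\<^sub>F x in at_right 0. P x \<Longrightarrow> \<forall>\<^sub>F n in sequentially. P (p n)"
  using p_at_right by (simp add: filterlim_iff)

lemma eventually_adm: "\<forall>\<^sub>F n in sequentially. admissible \<delta> (p n)"
  by (rule eventually_p[OF eventually_admissible[OF \<delta>]])

lemmas smallo_p = landau_o.small.compose[OF _ p_at_right]
lemmas bigo_p = landau_o.big.compose[OF _ p_at_right]

lemma measure_seq_part:
  assumes "i \<in> {1..3}"
  shows "\<forall>\<^sub>F n in sequentially. measure lborel (seq_part n i) = size3 (hub_size \<delta> (p n)) (p n) i"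
  using eventually_adm
proof eventually_elim
  case (elim n)
  then show ?case
    using measure_part3[OF hub_bounds[OF \<delta> elim] assms] by (simp add: seq_part_def)
qed

lemma seq_weight_eventually: "\<forall>\<^sub>F n in sequentially. seq_weight n i j = weight3 \<delta> (p n) i j"
  using eventually_adm by eventually_elim (simp add: seq_weight_def)

lemma seq_graphon_eventually:
  "\<forall>\<^sub>F n in sequentially. seq_graphon n = block3 (hub_size \<delta> (p n)) (p n) (weight3 \<delta> (p n))"
  using eventually_adm by eventually_elim (simp add: seq_graphon_def)

lemma entropy_seq_asymp: "(\<lambda>n. graphon_entropy (p n) (seq_graphon n)) \<sim>[sequentially] (\<lambda>n. upper_tail_rate \<delta> (p n))"
proof -
  have "(\<lambda>n. graphon_entropy (p n) (block3 (hub_size \<delta> (p n)) (p n) (weight3 \<delta> (p n)))) \<sim>[sequentially] (\<lambda>n. upper_tail_rate \<delta> (p n))"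
    by (rule asymp_equiv_compose'[OF graphon_entropy_weight3_asymp[OF \<delta>] p_at_right])
  moreover have "\<forall>\<^sub>F n in sequentially. graphon_entropy (p n) (block3 (hub_size \<delta> (p n)) (p n) (weight3 \<delta> (p n))) = graphon_entropy (p n) (seq_graphon n)"
    using seq_graphon_eventually by eventually_elim simp
  ultimately show ?thesis
    by (rule asymp_equiv_transfer) simp
qed

lemma entropy_seq_bigtheta: "(\<lambda>n. graphon_entropy (p n) (seq_graphon n)) \<in> \<Theta>(\<lambda>n. upper_tail_rate \<delta> (p n))"
  by (rule asymp_equiv_imp_bigtheta[OF entropy_seq_asymp])

lemma ln_over_smallo: "(\<lambda>n. ln (real n) / real n) \<in> o(\<lambda>n. p n ^ 15)"
proof -
  have "(\<lambda>n. ((ln (real n) / real n) powr (1/15)) ^ 15) \<in> o(\<lambda>n. p n ^ 15)"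
    by (rule landau_o.small_power[OF growth]) simp
  moreover have "\<forall>\<^sub>F n in sequentially. ((ln (real n) / real n) powr (1/15)) ^ 15 = ln (real n) / real n"
    using eventually_gt_at_top[of 1]
  proof eventually_elim
    case (elim n)
    have "(x powr (1/15)) ^ 15 = x" if "x > 0" for x :: real
      using that by (subst powr_realpow[symmetric]) (simp_all add: powr_powr)
    moreover have "ln (real n) / real n > 0" using elim by simp
    ultimately show ?case by blast
  qed
  ultimately show ?thesis
    by (simp cong: landau_o.small.in_cong)
qed

lemma inverse_bigo: "(\<lambda>n. 1 / real n) \<in> O(\<lambda>n. ln (real n) / real n)"
  by real_asymp

lemma ln_over_smallo':
  assumes "(\<lambda>x. x ^ 15) \<in> O[at_right 0](f)"
  shows "(\<lambda>n. ln (real n) / real n) \<in> o(\<lambda>n. f (p n))"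
  by (rule landau_o.small_big_trans[OF ln_over_smallo bigo_p[OF assms]])

lemma small_block_seq:
  assumes "i \<in> {1..2}" "j \<in> {1..2}"
  shows "small_block p seq_part seq_weight seq_graphon i j"
proof -
  have ij: "i \<in> {1, 2}" "j \<in> {1, 2}" using assms by auto
  have "(\<lambda>x. size3 (hub_size \<delta> x) x i * size3 (hub_size \<delta> x) x j * weight3 \<delta> x i j)
     \<in> o[at_right 0](\<lambda>x. inverse (ln (ln (ln (1 / x)))) * upper_tail_rate \<delta> x)"
    using ij small_block_hub_hub[OF \<delta>] small_block_hub_nbr[OF \<delta>] small_block_nbr_nbr[OF \<delta>]
    by (elim insertE emptyE) (simp_all add: size3_def weight3_def mult.commute mult.left_commute)
  from smallo_p[OF this]
  have "(\<lambda>n. size3 (hub_size \<delta> (p n)) (p n) i * size3 (hub_size \<delta> (p n)) (p n) j * weight3 \<delta> (p n) i j)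
    \<in> o(\<lambda>n. inverse (ln (ln (ln (1 / p n)))) * graphon_entropy (p n) (seq_graphon n))"
    using landau_theta.mult[OF bigtheta_refl[of "\<lambda>n. inverse (ln (ln (ln (1 / p n))))"] entropy_seq_bigtheta]
    by (simp cong: landau_o.small.cong_bigtheta)
  moreover have "\<forall>\<^sub>F n in sequentially. size3 (hub_size \<delta> (p n)) (p n) i * size3 (hub_size \<delta> (p n)) (p n) j * weight3 \<delta> (p n) i j
    = measure lborel (seq_part n i) * measure lborel (seq_part n j) * seq_weight n i j"
  proof -
    have "i \<in> {1..3}" "j \<in> {1..3}" using assms by auto
    from measure_seq_part[OF this(1)] measure_seq_part[OF this(2)] seq_weight_eventually[of i j]
    show ?thesis by eventually_elim simp
  qed
  ultimately show ?thesis
    unfolding small_block_def by (simp cong: landau_o.small.in_cong)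
qed

lemma important_seq_iff: "important p 3 seq_part seq_weight seq_graphon i j \<longleftrightarrow> i \<in> {1..2} \<and> j \<in> {1..2}"
  using small_block_seq by (auto simp: important_def)

lemma Hom_block_seq:
  assumes "B \<in> verts K0 \<rightarrow> {1..3}"
  shows "\<forall>\<^sub>F n in sequentially. Hom_block K0 (seq_part n) B (seq_graphon n)
    = block_weight (hub_size \<delta> (p n)) (p n) (weight3 \<delta> (p n)) B"
  using eventually_adm
proof eventually_elim
  case (elim n)
  then show ?case
    using Hom_block_block3[OF hub_bounds[OF \<delta> elim], of B] assms
    by (simp add: seq_part_def seq_graphon_def verts_K0)
qed

text \<open>Any other assignment has weight at most p^10 times a power of
  \<open>density_ratio\<close>, and the latter is only a power of logarithms.\<close>

lemma not_negligible_seq: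
  assumes B: "B \<in> K_blocks K0 3" and "\<not> negligible_block K0 p seq_part seq_graphon B"
  shows "(\<forall>v\<in>{0..5}. B v = all_rest v) \<or> (\<forall>v\<in>{0..5}. B v = hub_block v)"
proof (rule ccontr)
  assume *: "\<not> ?thesis"
  have B': "B \<in> verts K0 \<rightarrow> {1..3}" "B \<in> {0..5} \<rightarrow> {1..3}"
    using B by (simp_all add: K_blocks_def verts_K0)
  have "(\<lambda>n. Hom_block K0 (seq_part n) B (seq_graphon n)) \<in> O(\<lambda>n. (3 * density_ratio \<delta> (p n)) ^ 9 * p n ^ 10)"
  proof (rule landau_o.bigI[of 1])
    show "\<forall>\<^sub>F n in sequentially. norm (Hom_block K0 (seq_part n) B (seq_graphon n)) \<le> 1 * norm ((3 * density_ratio \<delta> (p n)) ^ 9 * p n ^ 10)"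
      using eventually_adm Hom_block_seq[OF B'(1)]
    proof eventually_elim
      case (elim n)
      have "0 \<le> block_weight (hub_size \<delta> (p n)) (p n) (weight3 \<delta> (p n)) B"
        using weight3_bounds[OF \<delta> elim(1)] by (intro block_weight_nonneg hub_bounds[OF \<delta> elim(1)] B') auto
      moreover have "block_weight (hub_size \<delta> (p n)) (p n) (weight3 \<delta> (p n)) B \<le> (3 * density_ratio \<delta> (p n)) ^ 9 * p n ^ 10"
        using * by (intro Hom_weight3_add_le(3)[OF \<delta> elim(1)] B') auto
      ultimately show ?case by (simp add: elim(2))
    qed
  qed simp
  also have "(\<lambda>n. (3 * density_ratio \<delta> (p n)) ^ 9 * p n ^ 10) \<in> o(\<lambda>n. p n ^ 9)"
    by (rule smallo_p[OF optimal_block_asymptotics(1)[OF \<delta>]])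
  finally show False
    using assms(2) by (simp add: negligible_block_def num_edges_K0)
qed

lemma edges_K0_verts: "{u, v} \<in> edges K0 \<Longrightarrow> u \<in> {0..5} \<and> v \<in> {0..5}"
  by (auto simp: edges_K0 doubleton_eq_iff)

lemma edges_K0_hub_block:
  "{u, v} \<in> edges K0 \<Longrightarrow> {u, v} = {2, 3} \<or> hub_block u = 1 \<and> hub_block v = 2 \<or> hub_block u = 2 \<and> hub_block v = 1"
  by (auto simp: edges_K0 doubleton_eq_iff hub_block_def)

text \<open>For the upper bound, the rate is O(p^3 ln (1 / p)), and 1 / n \<le> ln n / n \<le> p^15
  \<le> p lets ln (1 / p) be replaced by ln n. Then p^3 ln n = o(p^18 n) is the assumption on p,
  multiplied by p^3 n.\<close>

lemma condition4_seq: "condition4 K0 p seq_graphon"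
proof -
  have 1: "(\<lambda>n. ln (real n) / real n) \<in> o(\<lambda>n. graphon_entropy (p n) (seq_graphon n))"
    using ln_over_smallo'[OF power15_bigo(6)[OF \<delta>]] entropy_seq_bigtheta
    by (simp cong: landau_o.small.cong_bigtheta)
  have "(\<lambda>n. upper_tail_rate \<delta> (p n)) \<in> O(\<lambda>n. p n ^ 3 * ln (real n))"
  proof -
    have "(\<lambda>n. upper_tail_rate \<delta> (p n)) \<in> O(\<lambda>n. p n ^ 3 * ln (1 / p n))"
      by (rule bigo_p) (unfold upper_tail_rate_def, use \<delta> in real_asymp)
    also have "(\<lambda>n. p n ^ 3 * ln (1 / p n)) \<in> O(\<lambda>n. p n ^ 3 * ln (real n))"
    proof (rule landau_o.big.mult_left, rule landau_o.bigI[of 1])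
      have "\<forall>\<^sub>F n in sequentially. norm (ln (real n) / real n) \<le> 1 * norm (p n ^ 15)"
        using landau_o.smallD[OF ln_over_smallo, of 1] by simp
      moreover have "\<forall>\<^sub>F n in sequentially. ln (real n) \<ge> 1"
        by real_asymp
      ultimately show "\<forall>\<^sub>F n in sequentially. norm (ln (1 / p n)) \<le> 1 * norm (ln (real n))"
        using eventually_adm eventually_gt_at_top[of 0]
      proof eventually_elim
        case (elim n)
        have p: "0 < p n" "p n \<le> 1" using p_bounds[OF \<delta> elim(3)] by auto
        have "1 / real n \<le> ln (real n) / real n" using elim by (simp add: divide_right_mono)
        also have "\<dots> \<le> p n ^ 15" using elim p by simp
        also have "\<dots> \<le> p n ^ 1" using p by (intro power_decreasing) auto
        finally have "1 / p n \<le> real n" using p elim by (simp add: field_simps)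
        then have "ln (1 / p n) \<le> ln (real n)" using p by (intro ln_mono) auto
        moreover have "0 \<le> ln (1 / p n)" using p by simp
        ultimately show ?case by simp
      qed
    qed simp
    finally show ?thesis .
  qed
  also have "(\<lambda>n. p n ^ 3 * ln (real n)) \<in> o(\<lambda>n. p n ^ 18 * real n)"
  proof -
    have "\<forall>\<^sub>F n in sequentially. (p n ^ 3 * real n) * (ln (real n) / real n) = p n ^ 3 * ln (real n)"
      using eventually_gt_at_top[of 0] by eventually_elim simp
    from landau_o.small.in_cong[OF this]
    have "(\<lambda>n. p n ^ 3 * ln (real n)) \<in> o(\<lambda>n. (p n ^ 3 * real n) * p n ^ 15)"
      using landau_o.small.mult_left[OF ln_over_smallo, of "\<lambda>n. p n ^ 3 * real n"] by blast
    moreover have "(\<lambda>n. (p n ^ 3 * real n) * p n ^ 15) = (\<lambda>n. p n ^ 18 * real n)"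
      by (simp add: fun_eq_iff power_numeral_reduce)
    ultimately show ?thesis by (simp only:)
  qed
  finally have "(\<lambda>n. graphon_entropy (p n) (seq_graphon n)) \<in> o(\<lambda>n. p n ^ 18 * real n)"
    using entropy_seq_bigtheta by (simp cong: landau_o.small.in_cong_bigtheta)
  with 1 show ?thesis by (simp add: condition4_def num_edges_K0)
qed

text \<open>In the assignment to hubs and neighbours all pairs are important. So only the pair (3,
  3) of the trivial assignment remains, whose area is near 1 while the entropy divided by p tends to
  0; hence \<epsilon> = 0 is possible.\<close>

lemma condition8_seq: "condition8 K0 p 3 seq_part seq_weight seq_graphon"
  unfolding condition8_def
proof (intro ballI impI allI, elim conjE)
  fix B u v
  assume B: "B \<in> K_blocks K0 3" "\<not> negligible_block K0 p seq_part seq_graphon B"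
    and uv: "{u, v} \<in> edges K0" "\<not> important p 3 seq_part seq_weight seq_graphon (B u) (B v)"
  have uv': "u \<in> {0..5}" "v \<in> {0..5}" using edges_K0_verts[OF uv(1)] by auto
  have "\<not> (\<forall>v\<in>{0..5}. B v = hub_block v)"
  proof
    assume "\<forall>v\<in>{0..5}. B v = hub_block v"
    then have "B u = hub_block u" "B v = hub_block v" using uv' by blast+
    with uv(2) show False unfolding important_seq_iff by (auto simp: hub_block_def split: if_splits)
  qed
  then have B3: "B u = 3" "B v = 3"
    using not_negligible_seq[OF B] uv' by (auto simp: all_rest_def)
  have three: "3 \<in> {1..3::nat}" by simp
  have "\<forall>\<^sub>F n in sequentially. measure lborel (seq_part n 3) * measure lborel (seq_part n 3)
      \<ge> (1 + 0) * (inverse (p n) * graphon_entropy (p n) (seq_graphon n))"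
    using measure_seq_part[OF three] eventually_p[OF optimal_block_asymptotics(4)[OF \<delta>]] eventually_p[OF eventually_entropy_weight3[OF \<delta>]] seq_graphon_eventually
  proof eventually_elim
    case (elim n)
    have "inverse (p n) * graphon_entropy (p n) (seq_graphon n) \<le> inverse (p n) * entropy_bound \<delta> (p n)"
      using elim p_pos[of n] by (intro mult_left_mono) auto
    with elim show ?case by (simp add: size3_def)
  qed
  moreover have "(\<lambda>n. seq_weight n 3 3 - p n) \<in> o(p)"
  proof -
    have "(\<lambda>n. seq_weight n 3 3 - p n) \<in> O(\<lambda>n. 10 * p n ^ 3 * density_ratio \<delta> (p n))"
    proof (rule landau_o.bigI[of 1])
      show "\<forall>\<^sub>F n in sequentially. norm (seq_weight n 3 3 - p n) \<le> 1 * norm (10 * p n ^ 3 * density_ratio \<delta> (p n))"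
        using eventually_adm seq_weight_eventually[of 3 3]
      proof eventually_elim
        case (elim n)
        then show ?case
          using rest_weight_bounds[OF \<delta> elim(1)] by (simp add: weight3_values[OF \<delta> elim(1)])
      qed
    qed simp
    also have "(\<lambda>n. 10 * p n ^ 3 * density_ratio \<delta> (p n)) \<in> o(\<lambda>n. p n)"
      by (rule smallo_p[OF optimal_block_asymptotics(3)[OF \<delta>]])
    finally show ?thesis by simp
  qed
  ultimately show "(\<exists>\<epsilon>. \<epsilon> \<longlonglongrightarrow> 0 \<and> (\<forall>\<^sub>F n in sequentially. measure lborel (seq_part n (B u)) * measure lborel (seq_part n (B v))
      \<ge> (1 + \<epsilon> n) * (inverse (p n) * graphon_entropy (p n) (seq_graphon n)))) \<and>
      (\<lambda>n. seq_weight n (B u) (B v) - p n) \<in> o(p)"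
    unfolding B3 by (intro conjI exI[of _ "\<lambda>_. 0"]) simp_all
qed

text \<open>In the trivial assignment no pair is important. In the other one the edges at 0 and 1 go
  to the block of weight 1, so that {2, 3} is left, and a single edge is a matching.\<close>

lemma condition7_seq: "condition7 K0 p 3 seq_part seq_weight seq_graphon"
  unfolding condition7_def
proof (intro ballI impI)
  fix B assume B: "B \<in> K_blocks K0 3" "\<not> negligible_block K0 p seq_part seq_graphon B"
  let ?M = "{{u, v} |u v. {u, v} \<in> edges K0 \<and> somewhat_important p 3 seq_part seq_weight seq_graphon (B u) (B v)}"
  have "?M \<subseteq> {{2, 3}}"
  proof
    fix e assume "e \<in> ?M"
    then obtain u v where e: "e = {u, v}" "{u, v} \<in> edges K0"
      and *: "somewhat_important p 3 seq_part seq_weight seq_graphon (B u) (B v)" by blast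
    have uv: "u \<in> {0..5}" "v \<in> {0..5}" using edges_K0_verts[OF e(2)] by auto
    have imp: "B u \<in> {1..2}" "\<exists>\<^sub>F n in sequentially. seq_weight n (B u) (B v) < 1"
      using * by (auto simp: somewhat_important_def important_seq_iff)
    have "\<not> (\<forall>v\<in>{0..5}. B v = all_rest v)"
    proof
      assume "\<forall>v\<in>{0..5}. B v = all_rest v"
      then have "B u = 3" using uv(1) unfolding all_rest_def by blast
      with imp(1) show False by simp
    qed
    with not_negligible_seq[OF B] uv have hub: "B u = hub_block u" "B v = hub_block v" by auto
    have "\<not> (hub_block u = 1 \<and> hub_block v = 2 \<or> hub_block u = 2 \<and> hub_block v = 1)"
    proof
      assume "hub_block u = 1 \<and> hub_block v = 2 \<or> hub_block u = 2 \<and> hub_block v = 1"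
      then have "\<forall>\<^sub>F n in sequentially. \<not> seq_weight n (B u) (B v) < 1"
        using seq_weight_eventually[of "B u" "B v"] unfolding hub
        by (auto elim!: eventually_mono simp: weight3_def)
      with imp(2) show False by (simp add: frequently_def)
    qed
    with edges_K0_hub_block[OF e(2)] e(1) show "e \<in> {{2, 3}}" by blast
  qed
  moreover have "pairwise disjnt {{2, 3 :: nat}}" by simp
  ultimately show "matching ?M"
    unfolding matching_def by (rule pairwise_subset[rotated])
qed

lemma block_conditions_seq: "block_conditions K0 p 3 seq_part seq_weight seq_graphon"
  unfolding block_conditions_def
proof (intro conjI condition4_seq condition7_seq condition8_seq)
  show "condition1 p seq_graphon"
    unfolding condition1_def using eventually_adm
    by eventually_elim (simp add: seq_graphon_def regular_weight3[OF \<delta>])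
  show "condition2 p 3 seq_part"
    unfolding condition2_def using measure_seq_part[of 3]
    by (auto elim!: eventually_mono simp: size3_def)
  show "condition3 K0 p seq_graphon"
    unfolding condition3_def num_edges_K0
  proof (intro exI[of _ \<delta>] conjI \<delta>)
    show "\<forall>\<^sub>F n in sequentially. Hom K0 (seq_graphon n) \<ge> (1 + \<delta>) * p n ^ 9"
      using eventually_adm by eventually_elim (simp add: seq_graphon_def Hom_weight3_ge[OF \<delta>])
  qed
  show "condition5 3 seq_part"
    unfolding condition5_def
  proof
    fix i :: nat assume i: "i \<in> {1..3}"
    then have "(\<lambda>x. x ^ 15) \<in> O[at_right 0](\<lambda>x. size3 (hub_size \<delta> x) x i)"
      using power15_bigo[OF \<delta>] unfolding index_set3 by (elim insertE emptyE) (simp_all add: size3_def)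
    from landau_o.big_small_trans[OF inverse_bigo ln_over_smallo'[OF this]]
    show "(\<lambda>n. 1 / real n) \<in> o(\<lambda>n. measure lborel (seq_part n i))"
      using measure_seq_part[OF i] by (simp cong: landau_o.small.cong)
  qed
  show "condition6 p 3 seq_part seq_weight seq_graphon"
    unfolding condition6_def
  \<comment> \<open>All four pairs among the first two blocks are small, including (1, 1), whose
    weight is p.\<close>
  proof (intro ballI conjI disjI2)
    fix i j :: nat assume ij: "i \<in> {1..3-1}" "j \<in> {1..3-1}"
    show "small_block p seq_part seq_weight seq_graphon i j"
      using ij by (intro small_block_seq) auto
    have ij': "i = 1 \<or> i = 2" "j = 1 \<or> j = 2" using ij by auto
    show "\<forall>\<^sub>F n in sequentially. seq_weight n i j \<ge> p n"
      using eventually_adm seq_weight_eventually[of i j]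
    proof eventually_elim
      case (elim n)
      have "p n * 1 \<le> p n * density_ratio \<delta> (p n)" "p n \<le> 1"
        using p_bounds[OF \<delta> elim(1)] density_ratio_bounds[OF \<delta> elim(1)] by (auto intro!: mult_left_mono)
      with elim ij' show ?case by (auto simp: weight3_def)
    qed
  qed
  show "condition9 p 3 seq_part seq_weight seq_graphon"
    unfolding condition9_def
  proof (intro allI impI)
    fix i j assume "important p 3 seq_part seq_weight seq_graphon i j"
    then have ij: "i \<in> {1, 2}" "j \<in> {1, 2}" unfolding important_seq_iff by auto
    then have "(\<lambda>x. x ^ 15) \<in> O[at_right 0](\<lambda>x. weight3 \<delta> x i j * size3 (hub_size \<delta> x) x i)"
      using power15_bigo[OF \<delta>] by (elim insertE emptyE) (simp_all add: size3_def weight3_def)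
    from ln_over_smallo'[OF this]
    have "(\<lambda>n. ln (real n) / real n) \<in> o(\<lambda>n. weight3 \<delta> (p n) i j * size3 (hub_size \<delta> (p n)) (p n) i)" .
    moreover have "\<forall>\<^sub>F n in sequentially. weight3 \<delta> (p n) i j * size3 (hub_size \<delta> (p n)) (p n) i = seq_weight n i j * measure lborel (seq_part n i)"
      using measure_seq_part[of i] seq_weight_eventually[of i j] ij by (auto elim: eventually_elim2)
    ultimately show "(\<lambda>n. ln (real n) / real n) \<in> o(\<lambda>n. seq_weight n i j * measure lborel (seq_part n i))"
      by (simp cong: landau_o.small.cong)
  qed
  show "condition10 K0 p seq_graphon"
    unfolding condition10_def num_edges_K0
  proof (rule landau_o.big_trans)
    show "(\<lambda>n. 729 * ((3 * density_ratio \<delta> (p n)) ^ 9 * p n ^ 10 + ((3 * p n) ^ 9 + 512 * (\<delta> + 1 / ln (ln (1 / p n))) * p n ^ 9))) \<in> O(\<lambda>n. p n ^ 9)"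
      by (rule bigo_p[OF optimal_block_asymptotics(2)[OF \<delta>]])
    show "(\<lambda>n. Hom K0 (\<lambda>x y. seq_graphon n x y + p n)) \<in>
       O(\<lambda>n. 729 * ((3 * density_ratio \<delta> (p n)) ^ 9 * p n ^ 10 + ((3 * p n) ^ 9 + 512 * (\<delta> + 1 / ln (ln (1 / p n))) * p n ^ 9)))"
    proof (rule landau_o.bigI[of 1])
      show "\<forall>\<^sub>F n in sequentially. norm (Hom K0 (\<lambda>x y. seq_graphon n x y + p n)) \<le>
        1 * norm (729 * ((3 * density_ratio \<delta> (p n)) ^ 9 * p n ^ 10 + ((3 * p n) ^ 9 + 512 * (\<delta> + 1 / ln (ln (1 / p n))) * p n ^ 9)))"
        using eventually_adm
      proof eventually_elim
        case (elim n)
        have "seq_graphon n = block3 (hub_size \<delta> (p n)) (p n) (weight3 \<delta> (p n))"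
          using elim by (simp add: seq_graphon_def)
        with Hom_weight3_add_le(1,2)[OF \<delta> elim] show ?case by simp
      qed
    qed simp
  qed
qed

lemma exists_optimal_block_graphons:
  "\<exists>k S w W. (\<forall>n. block_graphon k (S n) (w n) (W n)) \<and> block_conditions K0 p k S w W \<and>
     (\<forall>\<^sub>F n in sequentially. Hom K0 (W n) \<ge> (1 + \<delta>) * p n ^ 9) \<and>
     (\<lambda>n. graphon_entropy (p n) (W n)) \<sim>[sequentially] (\<lambda>n. upper_tail_rate \<delta> (p n))"
proof (intro exI conjI allI)
  show "block_graphon 3 (seq_part n) (seq_weight n) (seq_graphon n)" for n
    by (rule block_graphon_seq)
  show "\<forall>\<^sub>F n in sequentially. Hom K0 (seq_graphon n) \<ge> (1 + \<delta>) * p n ^ 9"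
    using eventually_adm by eventually_elim (simp add: seq_graphon_def Hom_weight3_ge[OF \<delta>])
qed (rule block_conditions_seq entropy_seq_asymp)+

end

theorem theorem2p22:
  fixes \<delta> :: real
  assumes "\<delta> > 0"
  shows
    "((\<lambda>p. INF W\<in>{W. regular_graphon p W \<and> Hom K0 W \<ge> (1 + \<delta>) * p ^ 9}. graphon_entropy p W)
        \<sim>[at_right 0] upper_tail_rate \<delta>) \<and>
     (\<forall>p :: nat \<Rightarrow> real.
        (\<forall>n. 0 < p n) \<longrightarrow>
        (\<lambda>n. (ln (real n) / real n) powr (1/15)) \<in> o(p) \<longrightarrow>
        p \<in> o(\<lambda>_. 1) \<longrightarrow>
        (\<exists>k S w W.
           (\<forall>n. block_graphon k (S n) (w n) (W n)) \<and>
           block_conditions K0 p k S w W \<and>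
           (\<forall>\<^sub>F n in sequentially. Hom K0 (W n) \<ge> (1 + \<delta>) * p n ^ 9) \<and>
           (\<lambda>n. graphon_entropy (p n) (W n)) \<sim>[sequentially] (\<lambda>n. upper_tail_rate \<delta> (p n))))"
  using INF_graphon_entropy_asymp[OF assms] exists_optimal_block_graphons[OF assms] by blast

end
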